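(* Let $1\le r\le m$ and $n\ge 1$ be integers, let $\gamma:[a,b]\to \mathrm{Gr}(r,m)$ be a $C^{n+1}$ curve, and let $t_0\in[a,b)$. For $h>0$ with $t_0+nh\le b$ put $t_j=t_0+jh$ and $\mathcal{Y}_j=\gamma(t_j)$ for $j=0,1,\ldots,n$, and let $$\widehat\gamma_h(t)=\mathrm{GIDER}_n(\mathcal{Y}_0,\ldots,\mathcal{Y}_n;t),\qquad t\in[t_0,t_n].$$ Assume the local normal-neighborhood assumption: there are a normal coordinate neighborhood $U\subset \mathrm{Gr}(r,m)$ and a compact set $K\subset U$ such that, for all sufficiently small $h>0$, the exact curve $\gamma([t_0,t_n])$, the data points $\mathcal{Y}_0,\ldots,\mathcal{Y}_n$, and all intermediate $\mathrm{GLERP}$ evaluations $\mathcal{I}_j^k(t)$ ($t\in[t_0,t_n]$) in the $\mathrm{GIDER}_n$ recursion lie in $K$; in particular all logarithm maps used by $\mathrm{GLERP}$ in the recursion are uniquely defined and all geodesic interpolation and extrapolation steps in the recursion are well-defined. Then there exists a constant $C$, independent of $h$, such that for all sufficiently small $h>0$ $$d_{\mathrm{Gr}}\bigl(\gamma(t),\widehat\gamma_h(t)\bigr)\le C h^{n+1},\qquad t\in[t_0,t_n].$$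
   Context: $\mathrm{Gr}(r,m)$ is the Grassmann manifold of $r$-dimensional linear subspaces of $\mathbb{R}^m$. A point $\mathcal{Y}$ is represented by $Y\in\mathbb{R}^{m\times r}$ with $Y^TY=I_r$ and $\mathcal{Y}=\mathrm{span}(Y)$ (column span); $Y$ and $YR$, $R\in O(r)$, represent the same point. The tangent space is identified with $\{\Delta\in\mathbb{R}^{m\times r}:Y^T\Delta=0\}$, with the canonical Riemannian metric $\langle\Delta_1,\Delta_2\rangle=\mathrm{tr}(\Delta_1^T\Delta_2)$. The principal angles $\theta_1,\ldots,\theta_r\in[0,\pi/2]$ between $\mathrm{span}(Y_0)$ and $\mathrm{span}(Y_1)$ are defined by the requirement that $\cos\theta_j$ are the singular values of $Y_0^TY_1$, and the geodesic distance is $d_{\mathrm{Gr}}=(\sum_j\theta_j^2)^{1/2}$. Exponential map: if $\Delta=U\Theta V^T$ is a thin SVD ($V\in O(r)$), then $\mathrm{Exp}_{\mathcal{Y}}(\Delta)=\mathrm{span}(YV\cos\Theta+U\sin\Theta)$. Logarithm map: when all principal angles between $\mathcal{Y}_0=\mathrm{span}(Y_0)$ and $\mathcal{Y}_1=\mathrm{span}(Y_1)$ are $<\pi/2$ (equivalently $Y_0^TY_1$ is invertible, in which case the minimizing geodesic is unique), $\mathrm{Log}_{\mathcal{Y}_0}(\mathcal{Y}_1)=U\arctan(\Sigma)V^T$, where $Y_1(Y_0^TY_1)^{-1}-Y_0=U\Sigma V^T$ is an SVD. $\mathrm{GLERP}(\mathcal{A},\mathcal{B};\lambda)=\mathrm{Exp}_{\mathcal{A}}\bigl(\lambda\,\mathrm{Log}_{\mathcal{A}}(\mathcal{B})\bigr)$,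 used for all real $\lambda$ (including $\lambda\notin[0,1]$) whenever the logarithm is uniquely defined. $\mathrm{GIDER}_n$: given $\mathcal{Y}_0,\ldots,\mathcal{Y}_n$ at nodes $t_j=t_0+jh$, set $\mathcal{I}_j^0(t)=\mathcal{Y}_j$ and for $k=1,\ldots,n$, $j=0,\ldots,n-k$, $$\mathcal{I}_j^k(t)=\mathrm{GLERP}\bigl(\mathcal{I}_j^{k-1}(t),\mathcal{I}_{j+1}^{k-1}(t);\lambda_j^k(t)\bigr),\qquad \lambda_j^k(t)=\frac{t-t_j}{t_{j+k}-t_j}.$$ Then $\mathrm{GIDER}_n(\mathcal{Y}_0,\ldots,\mathcal{Y}_n;t)=\mathcal{I}_0^n(t)$ for $t\in[t_0,t_n]$. A normal coordinate neighborhood is an open subset of the manifold which is the diffeomorphic image under $\mathrm{Exp}_q$, for some point $q$, of an open neighborhood of $0$ in the tangent space at $q$ that is star-shaped about $0$. *)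

theory Defs
  imports "HOL-Analysis.Analysis"
begin

text \<open>
  Matrices in \<open>\<real>\<^bsup>m\<times>r\<^esup>\<close> have type \<open>real^'r^'m\<close>, with \<open>r = CARD('r)\<close> and \<open>m = CARD('m)\<close>. A point of
  \<open>Gr(r,m)\<close> is a subspace, of type \<open>(real^'m) set\<close>, which does not mention \<open>'r\<close>. Hence notions
  on points take an argument of type \<open>'r itself\<close> when \<open>'r\<close> does not occur in their result type.
\<close>

subsection \<open>Points and their matrix representatives\<close>

definition grassmannian :: "'r::finite itself \<Rightarrow> (real^'m::finite) set set" where
  "grassmannian r = {S. subspace S \<and> dim S = CARD('r)}"

definition stiefel :: "(real^'r::finite^'m::finite) set" where
  "stiefel = {Y. transpose Y ** Y = mat 1}"

definition colspan :: "real^'r::finite^'m::finite \<Rightarrow> (real^'m) set" where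
  "colspan Y = span (columns Y)"

definition gr_rep :: "(real^'m::finite) set \<Rightarrow> real^'r::finite^'m" where
  "gr_rep S = (SOME Y. Y \<in> stiefel \<and> colspan Y = S)"

definition tangent :: "real^'r::finite^'m::finite \<Rightarrow> (real^'r^'m) set" where
  "tangent Y = {\<Delta>. transpose Y ** \<Delta> = 0}"


subsection \<open>Singular values, principal angles and geodesic distance\<close>

definition diag :: "real^'r::finite \<Rightarrow> real^'r^'r" where
  "diag v = (\<chi> i j. if i = j then v $ i else 0)"

definition thin_svd ::
    "real^'r::finite^'k::finite \<Rightarrow> real^'r^'k \<Rightarrow> real^'r \<Rightarrow> real^'r^'r \<Rightarrow> bool" where
  "thin_svd A U s V \<longleftrightarrow>
     transpose U ** U = mat 1 \<and> orthogonal_matrix V \<and> (\<forall>j. 0 \<le> s $ j) \<and>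
     A = U ** diag s ** transpose V"

text \<open>
  The principal angles are determined up to their order only, so one ordering is chosen.
\<close>

definition principal_angles ::
    "(real^'m::finite) set \<Rightarrow> (real^'m) set \<Rightarrow> real^'r::finite" where
  "principal_angles A B =
     (let Y0 = (gr_rep A :: real^'r^'m); Y1 = (gr_rep B :: real^'r^'m)
      in SOME \<theta>. (\<forall>j. 0 \<le> \<theta> $ j \<and> \<theta> $ j \<le> pi / 2) \<and>
           (\<exists>U V. thin_svd (transpose Y0 ** Y1) U (\<chi> j. cos (\<theta> $ j)) V))"

definition gr_dist ::
    "'r::finite itself \<Rightarrow> (real^'m::finite) set \<Rightarrow> (real^'m) set \<Rightarrow> real" where
  "gr_dist r A B = sqrt (\<Sum>j\<in>UNIV. ((principal_angles A B :: real^'r) $ j)\<^sup>2)"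


subsection \<open>Exponential and logarithm\<close>

text \<open>
  The tangent vector at \<open>colspan Y\<close> is given by its matrix with respect to the representative
  \<open>Y\<close>. The singular value decompositions chosen below do not influence the results.
\<close>

definition gr_exp :: "real^'r::finite^'m::finite \<Rightarrow> real^'r^'m \<Rightarrow> (real^'m) set" where
  "gr_exp Y \<Delta> =
     (let (U, \<theta>, V) = (SOME (U, \<theta>, V). thin_svd \<Delta> U \<theta> V)
      in colspan (Y ** V ** diag (\<chi> j. cos (\<theta> $ j)) + U ** diag (\<chi> j. sin (\<theta> $ j))))"

definition gr_log :: "real^'r::finite^'m::finite \<Rightarrow> real^'r^'m \<Rightarrow> real^'r^'m" where
  "gr_log Y0 Y1 =
     (let (U, s, V) =
        (SOME (U, s, V). thin_svd (Y1 ** matrix_inv (transpose Y0 ** Y1) - Y0) U s V)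
      in U ** diag (\<chi> j. arctan (s $ j)) ** transpose V)"

definition gr_log_unique ::
    "'r::finite itself \<Rightarrow> (real^'m::finite) set \<Rightarrow> (real^'m) set \<Rightarrow> bool" where
  "gr_log_unique r A B \<longleftrightarrow> (\<forall>j. (principal_angles A B :: real^'r) $ j < pi / 2)"


subsection \<open>Geodesic interpolation\<close>

definition glerp ::
    "'r::finite itself \<Rightarrow> (real^'m::finite) set \<Rightarrow> (real^'m) set \<Rightarrow> real \<Rightarrow> (real^'m) set" where
  "glerp r A B l =
     (let Y0 = (gr_rep A :: real^'r^'m); Y1 = (gr_rep B :: real^'r^'m)
      in gr_exp Y0 (l *\<^sub>R gr_log Y0 Y1))"

text \<open>
  \<open>gider_step r \<tau> Y k j t\<close> is the intermediate value \<open>I\<close> with upper index \<open>k\<close> and lower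
  index \<open>j\<close> at \<open>t\<close>, for the data \<open>Y\<close> at the nodes \<open>\<tau>\<close>.
\<close>

primrec gider_step ::
    "'r::finite itself \<Rightarrow> (nat \<Rightarrow> real) \<Rightarrow> (nat \<Rightarrow> (real^'m::finite) set) \<Rightarrow>
     nat \<Rightarrow> nat \<Rightarrow> real \<Rightarrow> (real^'m) set" where
  "gider_step r \<tau> Y 0 j t = Y j"
| "gider_step r \<tau> Y (Suc k) j t =
     glerp r (gider_step r \<tau> Y k j t) (gider_step r \<tau> Y k (Suc j) t)
       ((t - \<tau> j) / (\<tau> (j + Suc k) - \<tau> j))"

definition gider ::
    "'r::finite itself \<Rightarrow> nat \<Rightarrow> (nat \<Rightarrow> real) \<Rightarrow> (nat \<Rightarrow> (real^'m::finite) set) \<Rightarrow>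
     real \<Rightarrow> (real^'m) set" where
  "gider r n \<tau> Y t = gider_step r \<tau> Y n 0 t"


subsection \<open>Topology and smooth structure of the Grassmann manifold\<close>

text \<open>The quotient topology of the Stiefel manifold.\<close>

definition gr_topology :: "'r::finite itself \<Rightarrow> (real^'m::finite) set topology" where
  "gr_topology r =
     topology (\<lambda>U. U \<subseteq> grassmannian r \<and>
       openin (top_of_set stiefel) {Y \<in> (stiefel :: (real^'r^'m) set). colspan Y \<in> U})"

lemma openin_gr_topology:
  fixes U :: "(real^'m::finite) set set"
  shows "openin (gr_topology TYPE('r::finite)) U \<longleftrightarrow>
     U \<subseteq> grassmannian TYPE('r) \<and>
     openin (top_of_set stiefel) {Y \<in> (stiefel :: (real^'r^'m) set). colspan Y \<in> U}"
proof -
  let ?p = "\<lambda>U. {Y \<in> (stiefel :: (real^'r^'m) set). colspan Y \<in> U}"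
  have int: "?p (S \<inter> T) = ?p S \<inter> ?p T" for S T by auto
  have un: "?p (\<Union>\<K>) = \<Union>(?p ` \<K>)" for \<K> by auto
  have "istopology (\<lambda>U. U \<subseteq> (grassmannian TYPE('r) :: (real^'m) set set) \<and>
          openin (top_of_set stiefel) (?p U))"
    unfolding istopology_def int un by (auto intro!: openin_Int openin_Union)
  then show ?thesis
    by (simp add: gr_topology_def topology_inverse')
qed

text \<open>
  \<open>C\<^sup>k\<close> maps between normed spaces, in finite dimension: the derivative is unique, and the
  notion the usual one, when \<open>S\<close> is relatively open in a nontrivial interval (one-sided derivatives at
  the end points). When \<open>S\<close> is relatively open in a linear subspace \<open>T\<close>, the derivative \<open>D x\<close>
  is determined on \<open>T\<close> only, and its arbitrary linear extension can be taken to be composed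
  with a projection onto \<open>T\<close>, so this is the usual notion of a \<open>C\<^sup>k\<close> map on an open
  subset of \<open>T\<close>.
\<close>

primrec Ck_on ::
    "nat \<Rightarrow> 'a::real_normed_vector set \<Rightarrow> ('a \<Rightarrow> 'b::real_normed_vector) \<Rightarrow> bool" where
  "Ck_on 0 S f \<longleftrightarrow> continuous_on S f"
| "Ck_on (Suc k) S f \<longleftrightarrow>
     (\<exists>D. (\<forall>x\<in>S. (f has_derivative D x) (at x within S)) \<and> (\<forall>v. Ck_on k S (\<lambda>x. D x v)))"

text \<open>
  The affine chart centred at \<open>colspan Y0\<close>, with values in \<open>tangent Y0\<close>. Its value does not
  depend on the representative of \<open>S\<close>, and its inverse is \<open>\<lambda>X. colspan (Y0 + X)\<close>.
\<close>

definition gr_chart_dom :: "real^'r::finite^'m::finite \<Rightarrow> (real^'m) set set" where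
  "gr_chart_dom Y0 =
     {S \<in> grassmannian TYPE('r). invertible (transpose Y0 ** (gr_rep S :: real^'r^'m))}"

definition gr_chart :: "real^'r::finite^'m::finite \<Rightarrow> (real^'m) set \<Rightarrow> real^'r^'m" where
  "gr_chart Y0 S =
     (let Y = (gr_rep S :: real^'r^'m) in Y ** matrix_inv (transpose Y0 ** Y) - Y0)"

definition Ck_into_gr ::
    "'r::finite itself \<Rightarrow> nat \<Rightarrow> 'a::real_normed_vector set \<Rightarrow> ('a \<Rightarrow> (real^'m::finite) set) \<Rightarrow> bool"
  where
  "Ck_into_gr r k S f \<longleftrightarrow>
     continuous_map (top_of_set S) (gr_topology r) f \<and>
     (\<forall>Y0 \<in> (stiefel :: (real^'r^'m) set).
        Ck_on k {x \<in> S. f x \<in> gr_chart_dom Y0} (\<lambda>x. gr_chart Y0 (f x)))"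

definition Ck_from_gr ::
    "'r::finite itself \<Rightarrow> nat \<Rightarrow> (real^'m::finite) set set \<Rightarrow>
     ((real^'m) set \<Rightarrow> 'b::real_normed_vector) \<Rightarrow> bool" where
  "Ck_from_gr r k U g \<longleftrightarrow>
     (\<forall>Y0 \<in> (stiefel :: (real^'r^'m) set).
        Ck_on k {X \<in> tangent Y0. colspan (Y0 + X) \<in> U} (\<lambda>X. g (colspan (Y0 + X))))"

definition normal_nbhd :: "'r::finite itself \<Rightarrow> (real^'m::finite) set set \<Rightarrow> bool" where
  "normal_nbhd r U \<longleftrightarrow>
     openin (gr_topology r) U \<and>
     (\<exists>Q \<in> (stiefel :: (real^'r^'m) set). \<exists>W.
        openin (top_of_set (tangent Q)) W \<and> 0 \<in> W \<and>
        (\<forall>\<Delta>\<in>W. closed_segment 0 \<Delta> \<subseteq> W) \<and>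
        bij_betw (gr_exp Q) W U \<and>
        (\<forall>k. Ck_into_gr r k W (gr_exp Q)) \<and>
        (\<forall>k. Ck_from_gr r k U (inv_into W (gr_exp Q))))"

end

theory Submission
  imports Defs
begin

text \<open>
  A point of the Grassmannian is encoded by the reflection \<open>S = 2 P - 1\<close> in the subspace. In the principal
  planes of two subspaces the reflections act by complex scalars, which gives
  \<open>S(GLERP(A, B; l)) = (S\<^sub>B S\<^sub>A)\<^sup>l S\<^sub>A = S\<^sub>A + l D + \<Sum> (l gchoose p) (D S\<^sub>A)\<^sup>p S\<^sub>A\<close> with \<open>D = S\<^sub>B - S\<^sub>A\<close>, where
  the sum starts at \<open>p = 2\<close>. Truncated at \<open>p = n\<close>, this is a polynomial in the matrices, up to \<open>O(|D|\<^sup>n\<^sup>+\<^sup>1)\<close>.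
  Taylor's formula makes the data polynomial in \<open>x = t\<^sub>j - t\<^sub>0\<close> up to \<open>O(h\<^sup>n\<^sup>+\<^sup>1)\<close>. By induction on \<open>k\<close>, the error
  of \<open>I\<^sub>j\<^sup>k(t)\<close> is \<open>\<Prod>\<^sub>i\<^sub>\<le>\<^sub>k (t - t\<^sub>j\<^sub>+\<^sub>i) R\<^sub>k(t - t\<^sub>0, t\<^sub>j - t\<^sub>0, h) + O(h\<^sup>n\<^sup>+\<^sup>1)\<close> with a polynomial \<open>R\<^sub>k\<close> that does
  not depend on \<open>j\<close>: the linear part is Neville's scheme for divided differences, and the nonlinear terms
  are divisible by the new product. For \<open>k = n\<close> the product is \<open>O(h\<^sup>n\<^sup>+\<^sup>1)\<close>.
\<close>

text \<open>In a principal plane the product of two reflections is a rotation by twice the principal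
  angle, so moving a fraction \<open>l\<close> along the geodesic raises this product to the power
  \<open>l\<close>, for extrapolation as well as interpolation. The error must be divisible by
  products of node distances, and such divisions cost derivatives for a curve that is only
  \<open>C^(n+1)\<close>. Replacing the data at once by polynomials, at the price of
  \<open>O(h^(n+1))\<close>, makes every division exact: the difference of neighbours is
  \<open>h\<close> times the product over their common nodes times a polynomial, and the factor
  \<open>l (l - 1) h^2\<close> hidden in each nonlinear binomial term turns into the distances to
  the two extreme nodes. Polynomial models need not be involutions, so the truncated series is from
  then on an algebraic map on arbitrary matrices. The estimates have to be uniform in
  \<open>t\<close>, hence they are taken along pairs of a position and a step. Back on the manifold,
  each principal angle is bounded by the norm of the difference of the two reflections.\<close>

declare transpose_matrix_vector [simp del]

subsection \<open>Matrices by columns\<close>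

lemma column_matrix_mult: "column j (A ** B) = A *v column j B"
  by (simp add: column_def matrix_matrix_mult_def matrix_vector_mult_def vec_eq_iff)

lemma matrix_mult_diag: "A ** diag s = (\<chi> i j. s $ j * A $ i $ j)"
  by (simp add: matrix_matrix_mult_def diag_def vec_eq_iff if_distrib cong: if_cong)

lemma diag_matrix_mult: "diag s ** A = (\<chi> i j. s $ i * A $ i $ j)"
  by (simp add: matrix_matrix_mult_def diag_def vec_eq_iff if_distrib if_distribR cong: if_cong)

lemma column_mult_diag: "column j (A ** diag s) = s $ j *\<^sub>R column j A"
  by (simp add: matrix_mult_diag column_def vec_eq_iff)

lemma transpose_diag [simp]: "transpose (diag s) = diag s"
  by (simp add: transpose_def diag_def vec_eq_iff)

lemma diag_mult_diag: "diag s ** diag t = diag (\<chi> j. s $ j * t $ j)"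
  unfolding matrix_mult_diag by (simp add: diag_def vec_eq_iff mult.commute)

lemma diag_one: "diag (\<chi> j. 1) = mat 1"
  by (simp add: diag_def mat_def vec_eq_iff)

lemma matrix_eq_columns:
  assumes "\<And>j. column j A = column j B"
  shows "A = B"
  using assms by (simp add: column_def vec_eq_iff)

lemma transpose_mult_columns:
  fixes A :: "real^'a^'c" and B :: "real^'b^'c"
  shows "transpose A ** B = (\<chi> i j. column i A \<bullet> column j B)"
  by (simp add: matrix_matrix_mult_def vec_eq_iff transpose_def column_def inner_vec_def)

lemma transpose_mult_eq_1_iff:
  fixes A :: "real^'a^'c"
  shows "transpose A ** A = mat 1 \<longleftrightarrow>
     (\<forall>i j. column i A \<bullet> column j A = (if i = j then 1 else 0))"
  by (simp add: transpose_mult_columns mat_def vec_eq_iff)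

lemma matrix_vector_mult_columns:
  fixes A :: "real^'a^'c"
  shows "A *v x = (\<Sum>j\<in>UNIV. (x $ j) *\<^sub>R column j A)"
  by (simp add: matrix_mult_sum scalar_mult_eq_scaleR)

lemma transpose_matrix_vector_component:
  fixes A :: "real^'a^'c"
  shows "(transpose A *v x) $ j = column j A \<bullet> x"
  by (simp add: matrix_vector_mult_def transpose_def column_def inner_vec_def)

lemma inner_transpose_matrix_vector:
  fixes A :: "real^'a^'c"
  shows "(transpose A *v x) \<bullet> y = x \<bullet> (A *v y)"
  by (metis dot_lmul_matrix transpose_matrix_vector)

definition of_columns :: "('a::finite \<Rightarrow> real^'c::finite) \<Rightarrow> real^'a^'c" where
  "of_columns u = (\<chi> i j. u j $ i)"

lemma column_of_columns [simp]: "column j (of_columns u) = u j"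
  by (simp add: of_columns_def column_def vec_eq_iff)

subsection \<open>Singular value decomposition\<close>

text \<open>A maximiser \<open>v\<close> of the Rayleigh quotient on the unit sphere of
  \<open>S\<close> is an eigenvector: moving \<open>v\<close> in a direction \<open>w\<close> of
  \<open>S\<close> orthogonal to it cannot increase the quotient to first order, which forces
  \<open>w \<bullet> f v = 0\<close>.\<close>

lemma self_adjoint_eigenvector:
  fixes f :: "'a::euclidean_space \<Rightarrow> 'a"
  assumes lin: "linear f" and adj: "\<And>x y. f x \<bullet> y = x \<bullet> f y"
    and S: "subspace S" "\<And>x. x \<in> S \<Longrightarrow> f x \<in> S" "S \<noteq> {0}"
  obtains v where "v \<in> S" "norm v = 1" "f v = (v \<bullet> f v) *\<^sub>R v"
proof -
  have "compact (S \<inter> sphere 0 1)"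
    using closed_subspace[OF S(1)] by (simp add: closed_Int_compact)
  moreover obtain z where "z \<in> S" "z \<noteq> 0" using S subspace_0 by blast
  then have "z /\<^sub>R norm z \<in> S \<inter> sphere 0 1" using S(1) by (simp add: subspace_scale)
  then have "S \<inter> sphere 0 1 \<noteq> {}" by blast
  moreover have "continuous_on (S \<inter> sphere 0 1) (\<lambda>x. x \<bullet> f x)"
    using linear_continuous_on[OF lin[unfolded linear_conv_bounded_linear]]
    by (intro continuous_intros)
  ultimately obtain v where v: "v \<in> S \<inter> sphere 0 1"
    and max: "\<And>x. x \<in> S \<inter> sphere 0 1 \<Longrightarrow> x \<bullet> f x \<le> v \<bullet> f v"
    using continuous_attains_sup[of "S \<inter> sphere 0 1" "\<lambda>x. x \<bullet> f x"] by blast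
  define M where "M = v \<bullet> f v"
  have vS: "v \<in> S" and nv: "v \<bullet> v = 1" using v by (auto simp: norm_eq_1)
  have le: "x \<bullet> f x \<le> M * (x \<bullet> x)" if "x \<in> S" for x
  proof (cases "x = 0")
    case True
    then show ?thesis by (simp add: linear_0[OF lin])
  next
    case False
    then have "x /\<^sub>R norm x \<in> S \<inter> sphere 0 1" using S(1) that by (simp add: subspace_scale)
    from max[OF this] have "(x \<bullet> f x) / (x \<bullet> x) \<le> M"
      using lin by (simp add: linear_scale M_def dot_square_norm power2_eq_square divide_inverse mult_ac)
    then show ?thesis using False by (simp add: pos_divide_le_eq mult.commute)
  qed
  have orth: "w \<bullet> f v = 0" if w: "w \<in> S" "w \<bullet> v = 0" for w
  proof (rule ccontr)
    assume ne: "w \<bullet> f v \<noteq> 0"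
    define c where "c = w \<bullet> f v"
    define K where "K = M * (w \<bullet> w) - w \<bullet> f w"
    \<comment> \<open>Maximality at \<open>v + e w\<close>. A linear term in \<open>e\<close>
      dominated by a quadratic one has coefficient 0; the choice
      \<open>e = c / (\<bar>K\<bar> + 1)\<close> below makes this explicit.\<close>
    have "2 * e * c \<le> e\<^sup>2 * K" for e
    proof -
      have "v + e *\<^sub>R w \<in> S" using vS w S(1) by (simp add: subspace_add subspace_scale)
      from le[OF this] show ?thesis
        using nv w(2) adj[of v w]
        by (simp add: linear_add[OF lin] linear_scale[OF lin] inner_simps M_def K_def c_def
            inner_commute algebra_simps power2_eq_square)
    qed
    from this[of "c / (\<bar>K\<bar> + 1)"] have "2 * c\<^sup>2 / (\<bar>K\<bar> + 1) \<le> c\<^sup>2 * (K / (\<bar>K\<bar> + 1)\<^sup>2)"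
      by (simp add: power2_eq_square)
    also have "\<dots> \<le> c\<^sup>2 * (1 / (\<bar>K\<bar> + 1))"
    proof (intro mult_left_mono)
      have "K / (\<bar>K\<bar> + 1)\<^sup>2 \<le> (\<bar>K\<bar> + 1) / (\<bar>K\<bar> + 1)\<^sup>2"
        by (intro divide_right_mono) auto
      then show "K / (\<bar>K\<bar> + 1)\<^sup>2 \<le> 1 / (\<bar>K\<bar> + 1)"
        by (simp add: power2_eq_square)
    qed auto
    finally have "c\<^sup>2 / (\<bar>K\<bar> + 1) \<le> 0" by simp
    then show False using ne by (simp add: c_def divide_le_0_iff)
  qed
  \<comment> \<open>The residual is itself an admissible direction: it is orthogonal to
    \<open>f v\<close> and to \<open>v\<close>, hence to itself.\<close>
  have "f v - M *\<^sub>R v \<in> S" using vS S by (simp add: subspace_diff subspace_scale)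
  moreover have vf: "(f v - M *\<^sub>R v) \<bullet> v = 0" using nv by (simp add: inner_simps M_def inner_commute)
  ultimately have "(f v - M *\<^sub>R v) \<bullet> f v = 0" by (rule orth)
  with vf have "(f v - M *\<^sub>R v) \<bullet> (f v - M *\<^sub>R v) = 0" by (simp add: inner_diff_right)
  then have "f v = M *\<^sub>R v" by simp
  then show ?thesis using that[of v] vS nv by (simp add: M_def norm_eq_1)
qed

text \<open>Induction on the dimension: self-adjointness makes the orthogonal complement of an
  eigenvector invariant.\<close>

lemma self_adjoint_eigenbasis:
  fixes f :: "'a::euclidean_space \<Rightarrow> 'a"
  assumes lin: "linear f" and adj: "\<And>x y. f x \<bullet> y = x \<bullet> f y"
    and S: "subspace S" "\<And>x. x \<in> S \<Longrightarrow> f x \<in> S"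
  shows "\<exists>B\<subseteq>S. finite B \<and> card B = dim S \<and> pairwise orthogonal B \<and>
           (\<forall>v\<in>B. norm v = 1 \<and> f v = (v \<bullet> f v) *\<^sub>R v)"
  using S
proof (induction "dim S" arbitrary: S)
  case 0
  then show ?case by (intro exI[of _ "{}"]) auto
next
  case (Suc n)
  then have "S \<noteq> {0}" by auto
  then obtain v where v: "v \<in> S" "norm v = 1" "f v = (v \<bullet> f v) *\<^sub>R v"
    using self_adjoint_eigenvector[OF lin adj Suc.prems] by metis
  define T where "T = {y \<in> S. \<forall>x \<in> span {v}. orthogonal x y}"
  have T: "T = {y \<in> S. orthogonal v y}"
    unfolding T_def span_singleton by (auto simp: orthogonal_def dest: spec[of _ 1])
  have "dim T + dim (span {v}) = dim S"
    unfolding T_def using Suc.prems v by (intro dim_subspace_orthogonal_to_vectors)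
      (auto simp: span_minimal)
  then have dT: "n = dim T" using Suc.hyps(2) v by (auto simp: dim_insert split: if_splits)
  have "subspace T" unfolding T using Suc.prems
    by (auto simp: subspace_def orthogonal_clauses)
  moreover have "f x \<in> T" if "x \<in> T" for x
  proof -
    have "v \<bullet> f x = 0" using adj[of v x] that v(3) unfolding T orthogonal_def
      by (metis (mono_tags, lifting) inner_scaleR_left mem_Collect_eq mult_zero_right)
    then show ?thesis using that Suc.prems by (simp add: T orthogonal_def)
  qed
  ultimately obtain B where B: "B \<subseteq> T" "finite B" "card B = dim T" "pairwise orthogonal B"
    "\<forall>v\<in>B. norm v = 1 \<and> f v = (v \<bullet> f v) *\<^sub>R v"
    using Suc.hyps(1)[OF dT] by blast
  have "v \<notin> B" using B(1) v(2) by (auto simp: T orthogonal_self)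
  then have "card (insert v B) = dim S" using B Suc.hyps(2) dT by simp
  moreover have "pairwise orthogonal (insert v B)"
    using B(1,4) by (auto simp: pairwise_insert T orthogonal_commute)
  moreover have "insert v B \<subseteq> S" using v B(1) by (auto simp: T)
  ultimately show ?case using B(2,5) v(2,3)
    by (intro exI[of _ "insert v B"]) (metis finite_insert insert_iff)
qed

text \<open>An orthonormal eigenbasis of \<open>transpose A ** A\<close> has pairwise orthogonal
  images under \<open>A\<close>. Their lengths are the singular values, the normalised nonzero
  images are columns of \<open>U\<close>, and the remaining columns are any orthonormal vectors in
  the complement; the dimension hypothesis guarantees room for them.\<close>

lemma thin_svd_exists:
  fixes A :: "real^'r::finite^'k::finite"
  assumes le: "CARD('r) \<le> CARD('k)"
  shows "\<exists>U s V. thin_svd A U s V"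
proof -
  define f where "f x = transpose A *v (A *v x)" for x
  have "linear f" unfolding f_def matrix_vector_mul_assoc by simp
  have adj: "f x \<bullet> y = (A *v x) \<bullet> (A *v y)" for x y
    by (simp add: f_def inner_transpose_matrix_vector)
  obtain B where B: "finite B" "card B = CARD('r)" "pairwise orthogonal B"
     "\<And>v. v \<in> B \<Longrightarrow> norm v = 1" "\<And>v. v \<in> B \<Longrightarrow> f v = (v \<bullet> f v) *\<^sub>R v"
  proof -
    have "f x \<bullet> y = x \<bullet> f y" for x y by (metis adj inner_commute)
    from self_adjoint_eigenbasis[OF \<open>linear f\<close> this subspace_UNIV]
    show thesis using that by (metis UNIV_I dim_UNIV DIM_cart DIM_real mult.right_neutral)
  qed
  then obtain v where v: "bij_betw v (UNIV :: 'r set) B"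
    by (metis finite finite_same_card_bij)
  have vB: "v i \<in> B" for i using v by (auto simp: bij_betw_def)
  have vo: "v i \<bullet> v j = (if i = j then 1 else 0)" for i j
  proof (cases "i = j")
    case True
    then show ?thesis using B(4)[OF vB] by (simp add: norm_eq_1)
  next
    case False
    then have "v i \<noteq> v j" using v by (auto simp: bij_betw_def inj_on_def)
    then show ?thesis using B(3) vB False by (auto simp: pairwise_def orthogonal_def)
  qed
  define w where "w j = A *v v j" for j
  have wo: "w i \<bullet> w j = 0" if "i \<noteq> j" for i j
  proof -
    have "w i \<bullet> w j = f (v i) \<bullet> v j" by (simp add: adj w_def)
    also have "\<dots> = ((v i \<bullet> f (v i)) *\<^sub>R v i) \<bullet> v j" using B(5)[OF vB, of i] by simp
    also have "\<dots> = 0" using vo that by simp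
    finally show ?thesis .
  qed
  define J where "J = {j. w j \<noteq> 0}"
  define e where "e j = w j /\<^sub>R norm (w j)" for j
  have eo: "e i \<bullet> e j = (if i = j then 1 else 0)" if "i \<in> J" "j \<in> J" for i j
    using that wo[of i j] by (auto simp: e_def J_def dot_square_norm power2_eq_square field_simps)
  have inj: "inj_on e J"
    using eo by (intro inj_onI) (metis zero_neq_one)
  define T where "T = {y \<in> UNIV. \<forall>x \<in> span (e ` J). orthogonal x y}"
  have "dim T + dim (span (e ` J)) = dim (UNIV :: (real^'k) set)"
    unfolding T_def by (intro dim_subspace_orthogonal_to_vectors) auto
  moreover have "dim (span (e ` J)) \<le> card J"
    using dim_le_card[of "span (e ` J)" "e ` J"] by (simp add: card_image[OF inj])
  moreover have "card J + card (- J) = CARD('r)" by (simp add: Compl_eq_Diff_UNIV card_Diff_subset card_mono)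
  ultimately have le: "card (- J) \<le> dim T" using le by simp
  have sT: "subspace T" unfolding T_def by (auto simp: subspace_def orthogonal_clauses)
  obtain B' where B': "B' \<subseteq> T" "pairwise orthogonal B'" "\<And>x. x \<in> B' \<Longrightarrow> norm x = 1"
     "independent B'" "card B' = dim T" using orthonormal_basis_subspace[OF sT] by metis
  then obtain g where g: "g ` (- J) \<subseteq> B'" "inj_on g (- J)"
    using le card_le_inj[of "- J" B'] independent_imp_finite[OF B'(4)] by auto
  define u where "u j = (if j \<in> J then e j else g j)" for j
  have eg: "e i \<bullet> g j = 0" if "i \<in> J" "j \<notin> J" for i j
  proof -
    have "g j \<in> T" using that g B'(1) by auto
    then show ?thesis using that by (auto simp: T_def orthogonal_def span_base)
  qed
  have gg: "g i \<bullet> g j = (if i = j then 1 else 0)" if "i \<notin> J" "j \<notin> J" for i j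
  proof -
    have "g i \<in> B'" "g j \<in> B'" using that g by auto
    moreover have "g i \<noteq> g j" if "i \<noteq> j" using g(2) \<open>i \<notin> J\<close> \<open>j \<notin> J\<close> that
      by (auto simp: inj_on_def)
    ultimately show ?thesis using B'(2,3)
      by (cases "i = j") (simp_all add: pairwise_def orthogonal_def norm_eq_1)
  qed
  have uo: "u i \<bullet> u j = (if i = j then 1 else 0)" for i j
    using eo[of i j] eg[of i j] eg[of j i] gg[of i j] by (auto simp: u_def inner_commute)
  define s where "s = (\<chi> j. norm (w j))"
  define V where "V = of_columns v"
  have oV: "orthogonal_matrix V" by (simp add: orthogonal_matrix V_def transpose_mult_eq_1_iff vo)
  have "A ** V = of_columns u ** diag s"
  proof (rule matrix_eq_columns)
    fix j
    have "column j (A ** V) = w j" by (simp add: column_matrix_mult V_def w_def)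
    also have "\<dots> = s $ j *\<^sub>R u j" by (auto simp: s_def u_def e_def J_def)
    finally show "column j (A ** V) = column j (of_columns u ** diag s)"
      by (simp add: column_mult_diag)
  qed
  then have "A ** (V ** transpose V) = of_columns u ** diag s ** transpose V"
    by (simp add: matrix_mul_assoc)
  then have "A = of_columns u ** diag s ** transpose V"
    using oV by (simp add: orthogonal_matrix_def)
  then show ?thesis using oV uo
    by (intro exI[of _ "of_columns u"] exI[of _ s] exI[of _ V])
      (simp add: thin_svd_def transpose_mult_eq_1_iff s_def)
qed

lemma bounded_bilinear_matrix_mult:
  "bounded_bilinear ((**) :: real^'b::finite^'a::finite \<Rightarrow> real^'c::finite^'b \<Rightarrow> real^'c^'a)"
proof -
  have "bilinear ((**) :: real^'b::finite^'a::finite \<Rightarrow> real^'c::finite^'b \<Rightarrow> real^'c^'a)"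
    unfolding bilinear_def
    by (auto intro!: linearI simp: matrix_matrix_mult_def vec_eq_iff algebra_simps sum.distrib
        sum_distrib_left)
  then show ?thesis by (simp add: bilinear_conv_bounded_bilinear)
qed

interpretation mm: bounded_bilinear
  "(**) :: real^'b::finite^'a::finite \<Rightarrow> real^'c::finite^'b \<Rightarrow> real^'c^'a"
  by (rule bounded_bilinear_matrix_mult)

lemma matrix_inv:
  assumes "invertible (A :: real^'a^'b)"
  shows "A ** matrix_inv A = mat 1" "matrix_inv A ** A = mat 1"
  using someI_ex[OF assms[unfolded invertible_def]] by (simp_all add: matrix_inv_def)

subsection \<open>Representatives and projections\<close>

lemma stiefel_iff:
  fixes Y :: "real^'r::finite^'m::finite"
  shows "Y \<in> stiefel \<longleftrightarrow> (\<forall>i j. column i Y \<bullet> column j Y = (if i = j then 1 else 0))"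
  by (simp add: stiefel_def transpose_mult_eq_1_iff)

lemma colspan_eq_range:
  fixes Y :: "real^'r::finite^'m::finite"
  shows "colspan Y = range ((*v) Y)"
proof
  show "colspan Y \<subseteq> range ((*v) Y)"
    unfolding colspan_def
  proof (rule span_minimal)
    show "columns Y \<subseteq> range ((*v) Y)"
      by (auto simp: columns_def matrix_vector_mult_basis[symmetric])
    show "subspace (range ((*v) Y))"
      by (intro linear_subspace_image) auto
  qed
  show "range ((*v) Y) \<subseteq> colspan Y"
    unfolding colspan_def matrix_vector_mult_columns
    by (intro image_subsetI span_sum span_scale span_base) (auto simp: columns_def)
qed

lemma colspan_mult_invertible:
  fixes Y :: "real^'r::finite^'m::finite"
  assumes "invertible R"
  shows "colspan (Y ** R) = colspan Y"
proof -
  obtain R' where "R ** R' = mat 1" using assms by (auto simp: invertible_def)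
  then have "Y *v x = (Y ** R) *v (R' *v x)" for x
    by (metis matrix_mul_assoc matrix_mul_rid matrix_vector_mul_assoc)
  then show ?thesis
    by (force simp: colspan_eq_range matrix_vector_mul_assoc[symmetric])
qed

lemma stiefel_proj_mult:
  fixes Y Z :: "real^'r::finite^'m::finite"
  assumes "Y \<in> stiefel" "colspan Z \<subseteq> colspan Y"
  shows "Y ** transpose Y ** Z = Z"
proof (rule matrix_eq_columns)
  fix j
  have "column j Z \<in> colspan Y"
    using assms(2) span_base[of "column j Z" "columns Z"] by (auto simp: colspan_def columns_def)
  then obtain x where x: "column j Z = Y *v x" by (auto simp: colspan_eq_range)
  have "Y ** transpose Y ** Y = Y"
    using assms(1) by (simp add: stiefel_def matrix_mul_assoc[symmetric])
  then show "column j (Y ** transpose Y ** Z) = column j Z"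
    by (simp add: column_matrix_mult x matrix_vector_mul_assoc)
qed

text \<open>Each of the two orthogonal projections fixes the range of the other, and transposing one
  of these absorption identities yields equality. The projection is thus an invariant of the
  subspace alone.\<close>

lemma stiefel_proj_eq:
  fixes Y Z :: "real^'r::finite^'m::finite"
  assumes Y: "Y \<in> stiefel" and Z: "Z \<in> stiefel" and eq: "colspan Y = colspan Z"
  shows "Y ** transpose Y = Z ** transpose Z"
proof -
  have "Y ** transpose Y ** (Z ** transpose Z) = Z ** transpose Z"
    using stiefel_proj_mult[OF Y, of Z] eq by (simp add: matrix_mul_assoc)
  moreover have "Z ** transpose Z ** (Y ** transpose Y) = Y ** transpose Y"
    using stiefel_proj_mult[OF Z, of Y] eq by (simp add: matrix_mul_assoc)
  then have "transpose (Z ** transpose Z ** (Y ** transpose Y)) = transpose (Y ** transpose Y)"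
    by simp
  then have "Y ** transpose Y ** (Z ** transpose Z) = Y ** transpose Y"
    by (simp add: matrix_transpose_mul)
  ultimately show ?thesis by simp
qed

lemma gr_rep:
  fixes Y :: "real^'r::finite^'m::finite"
  assumes "Y \<in> stiefel" "colspan Y = S"
  shows "(gr_rep S :: real^'r^'m) \<in> stiefel" "colspan (gr_rep S :: real^'r^'m) = S"
  using someI[of "\<lambda>Y::real^'r^'m. Y \<in> stiefel \<and> colspan Y = S" Y] assms
  by (simp_all add: gr_rep_def)

lemma grassmannian_rep:
  fixes S :: "(real^'m::finite) set"
  assumes "S \<in> grassmannian TYPE('r::finite)"
  shows "\<exists>Y::real^'r^'m. Y \<in> stiefel \<and> colspan Y = S"
proof -
  from assms have "subspace S" and d: "dim S = CARD('r)" by (auto simp: grassmannian_def)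
  then obtain B where B: "pairwise orthogonal B" "\<And>x. x \<in> B \<Longrightarrow> norm x = 1"
     "independent B" "card B = CARD('r)" "span B = S"
    using orthonormal_basis_subspace[of S] by metis
  then obtain v where v: "bij_betw v (UNIV :: 'r set) B"
    by (metis finite finite_same_card_bij independent_imp_finite)
  have "v i \<bullet> v j = (if i = j then 1 else 0)" for i j
  proof (cases "i = j")
    case True
    then show ?thesis using B(2) v by (auto simp: norm_eq_1 bij_betw_def)
  next
    case False
    then have "v i \<noteq> v j" using v by (auto simp: bij_betw_def inj_on_def)
    then show ?thesis using B(1) v False by (auto simp: pairwise_def orthogonal_def bij_betw_def)
  qed
  then have "(of_columns v :: real^'r^'m) \<in> stiefel" by (simp add: stiefel_iff)
  moreover have "columns (of_columns v :: real^'r^'m) = B"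
    using v by (auto simp: columns_def bij_betw_def)
  ultimately show ?thesis using B(5) unfolding colspan_def by metis
qed

section \<open>Reflections in subspaces\<close>

definition reflection :: "real^'r::finite^'m::finite \<Rightarrow> real^'m^'m" where
  "reflection Y = 2 *\<^sub>R (Y ** transpose Y) - mat 1"

definition gr_refl :: "'r::finite itself \<Rightarrow> (real^'m::finite) set \<Rightarrow> real^'m^'m" where
  "gr_refl r S = reflection (gr_rep S :: real^'r^'m)"

lemma gr_refl_colspan:
  fixes Y :: "real^'r::finite^'m::finite"
  assumes "Y \<in> stiefel" "colspan Y = S"
  shows "gr_refl TYPE('r) S = reflection Y"
  using stiefel_proj_eq[OF assms(1) gr_rep(1)[OF assms]] gr_rep(2)[OF assms] assms(2)
  by (simp add: gr_refl_def reflection_def)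

lemma reflection_mult_vector:
  fixes Y :: "real^'r::finite^'m::finite"
  shows "reflection Y *v x = 2 *\<^sub>R (Y *v (transpose Y *v x)) - x"
  by (simp add: reflection_def matrix_vector_mult_diff_rdistrib
      scaleR_matrix_vector_assoc[symmetric] matrix_vector_mul_assoc)

lemma reflection_vector:
  fixes Y :: "real^'r::finite^'m::finite"
  shows "reflection Y *v x = 2 *\<^sub>R (\<Sum>j\<in>UNIV. (column j Y \<bullet> x) *\<^sub>R column j Y) - x"
  by (simp add: reflection_mult_vector matrix_vector_mult_columns[of Y] transpose_matrix_vector_component)

subsection \<open>Exponential and geodesics\<close>

text \<open>
  Two decompositions of \<open>\<Delta>\<close> diagonalise \<open>transpose \<Delta> ** \<Delta>\<close>, so the change of basis between
  them intertwines \<open>f \<theta>'\<close> with \<open>f \<theta>\<close> for every even function \<open>f\<close>.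
\<close>

lemma gr_exp_eq:
  fixes Y U :: "real^'r::finite^'m::finite" and V :: "real^'r^'r"
  assumes le: "CARD('r) \<le> CARD('m)"
    and U: "transpose U ** U = mat 1" and V: "orthogonal_matrix V"
    and D: "\<Delta> = U ** diag \<theta> ** transpose V"
  shows "gr_exp Y \<Delta> =
     colspan (Y ** V ** diag (\<chi> j. cos (\<theta> $ j)) + U ** diag (\<chi> j. sin (\<theta> $ j)))"
proof -
  obtain U' \<theta>' V' where eq: "(SOME (U, \<theta>, V). thin_svd \<Delta> U \<theta> V) = (U', \<theta>', V')"
    by (cases "SOME (U, \<theta>, V). thin_svd \<Delta> U \<theta> V") auto
  obtain U0 \<theta>0 V0 where "thin_svd \<Delta> U0 \<theta>0 V0" using thin_svd_exists[OF le] by blast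
  then have "\<exists>p. case p of (U, \<theta>, V) \<Rightarrow> thin_svd \<Delta> U \<theta> V" by auto
  from someI_ex[OF this] eq have "thin_svd \<Delta> U' \<theta>' V'" by simp
  then have U': "transpose U' ** U' = mat 1" and V': "orthogonal_matrix V'"
    and D': "\<Delta> = U' ** diag \<theta>' ** transpose V'"
    by (auto simp: thin_svd_def)
  define P where "P = transpose V' ** V"
  have VV: "transpose V ** V = mat 1" "V ** transpose V = mat 1"
     "transpose V' ** V' = mat 1" "V' ** transpose V' = mat 1"
    using V V' by (auto simp: orthogonal_matrix_def)
  have VP: "V' ** P = V" by (simp add: P_def matrix_mul_assoc VV)
  have gram: "transpose (A ** diag t ** transpose B) ** (A ** diag t ** transpose B)
      = B ** diag (\<chi> j. t $ j * t $ j) ** transpose B"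
    if "transpose A ** A = mat 1" for A :: "real^'r^'m" and t and B :: "real^'r^'r"
  proof -
    have "transpose (A ** diag t ** transpose B) ** (A ** diag t ** transpose B)
       = B ** (diag t ** (transpose A ** A) ** diag t) ** transpose B"
      by (simp add: matrix_transpose_mul matrix_mul_assoc)
    then show ?thesis by (simp add: that diag_mult_diag)
  qed
  have "V' ** diag (\<chi> j. \<theta>' $ j * \<theta>' $ j) ** transpose V' =
        V ** diag (\<chi> j. \<theta> $ j * \<theta> $ j) ** transpose V"
    using gram[OF U', of \<theta>' V'] gram[OF U, of \<theta> V] D D' by metis
  then have "transpose V' ** (V' ** diag (\<chi> j. \<theta>' $ j * \<theta>' $ j) ** transpose V') ** V =
        transpose V' ** (V ** diag (\<chi> j. \<theta> $ j * \<theta> $ j) ** transpose V) ** V"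
    by simp
  moreover have "transpose V' ** (V' ** diag (\<chi> j. \<theta>' $ j * \<theta>' $ j) ** transpose V') ** V =
      (transpose V' ** V') ** diag (\<chi> j. \<theta>' $ j * \<theta>' $ j) ** P"
    by (simp add: P_def matrix_mul_assoc)
  moreover have "transpose V' ** (V ** diag (\<chi> j. \<theta> $ j * \<theta> $ j) ** transpose V) ** V =
      P ** diag (\<chi> j. \<theta> $ j * \<theta> $ j) ** (transpose V ** V)"
    by (simp add: P_def matrix_mul_assoc)
  ultimately have "diag (\<chi> j. \<theta>' $ j * \<theta>' $ j) ** P = P ** diag (\<chi> j. \<theta> $ j * \<theta> $ j)"
    by (simp add: VV)
  then have ent: "P $ i $ j = 0 \<or> \<theta>' $ i * \<theta>' $ i = \<theta> $ j * \<theta> $ j" for i j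
    by (auto simp: diag_matrix_mult matrix_mult_diag vec_eq_iff)
  have comm: "diag (\<chi> j. f (\<theta>' $ j)) ** P = P ** diag (\<chi> j. f (\<theta> $ j))"
    if even: "\<And>x. f (- x) = f x" for f :: "real \<Rightarrow> real"
  proof -
    have "f x = f y" if "x * x = y * y" for x y
      using that even[of y] by (auto simp: square_eq_iff)
    then have "P $ i $ j = 0 \<or> f (\<theta>' $ i) = f (\<theta> $ j)" for i j using ent by blast
    then show ?thesis by (auto simp: diag_matrix_mult matrix_mult_diag vec_eq_iff)
  qed
  \<comment> \<open>The sine is odd and need not intertwine by itself. It is written as
    \<open>t * sc t\<close> with \<open>sc\<close> even, and the factor \<open>t\<close> is absorbed
    into \<open>\<Delta>\<close>, which both decompositions share.\<close>
  define sc where "sc x = (if x = 0 then 1 else sin x / x)" for x :: real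
  have sc: "diag (\<chi> j. sin (t $ j)) = diag t ** diag (\<chi> j. sc (t $ j))" for t :: "real^'r"
    by (simp add: diag_mult_diag sc_def) (simp add: diag_def vec_eq_iff)
  have "U' ** diag (\<chi> j. sin (\<theta>' $ j)) ** P = U' ** diag \<theta>' ** (diag (\<chi> j. sc (\<theta>' $ j)) ** P)"
    by (simp add: sc matrix_mul_assoc)
  also have "\<dots> = U' ** diag \<theta>' ** (P ** diag (\<chi> j. sc (\<theta> $ j)))"
    by (subst comm) (auto simp: sc_def)
  also have "\<dots> = (\<Delta> ** V) ** diag (\<chi> j. sc (\<theta> $ j))"
    by (simp add: D' P_def matrix_mul_assoc)
  also have "\<Delta> ** V = U ** diag \<theta> ** (transpose V ** V)"
    unfolding D by (simp add: matrix_mul_assoc)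
  also have "U ** diag \<theta> ** (transpose V ** V) ** diag (\<chi> j. sc (\<theta> $ j)) =
     U ** diag (\<chi> j. sin (\<theta> $ j))"
    by (simp add: sc VV matrix_mul_assoc)
  finally have s: "U' ** diag (\<chi> j. sin (\<theta>' $ j)) ** P = U ** diag (\<chi> j. sin (\<theta> $ j))" .
  have "Y ** V' ** diag (\<chi> j. cos (\<theta>' $ j)) ** P = Y ** (V' ** P) ** diag (\<chi> j. cos (\<theta> $ j))"
    using comm[of cos] by (simp add: matrix_mul_assoc[symmetric])
  with s have "(Y ** V' ** diag (\<chi> j. cos (\<theta>' $ j)) + U' ** diag (\<chi> j. sin (\<theta>' $ j))) ** P =
     Y ** V ** diag (\<chi> j. cos (\<theta> $ j)) + U ** diag (\<chi> j. sin (\<theta> $ j))"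
    by (simp add: VP mm.add_left)
  moreover have "invertible P"
    unfolding invertible_def P_def
  proof (intro exI conjI)
    show "transpose V' ** V ** (transpose V ** V') = mat 1"
      by (metis VV(2,3) matrix_mul_assoc matrix_mul_rid)
    show "transpose V ** V' ** (transpose V' ** V) = mat 1"
      by (metis VV(1,4) matrix_mul_assoc matrix_mul_rid)
  qed
  ultimately show ?thesis
    unfolding gr_exp_def eq Let_def prod.case by (metis colspan_mult_invertible)
qed

text \<open>\<open>y\<close> and \<open>u\<close> are principal vectors: the columns of
  \<open>Y0 ** V\<close> and of \<open>U\<close> in the decomposition chosen by
  \<open>gr_log\<close>, and the angles are the arctangents of its singular values. A thin
  decomposition leaves the columns of \<open>U\<close> at zero singular values arbitrary, so
  orthogonality to \<open>y\<close> is available only for \<open>\<theta> j \<noteq> 0\<close>; for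
  the other \<open>j\<close> the sine suppresses \<open>u j\<close>.\<close>

lemma glerp_geodesic:
  fixes Y0 Y1 :: "real^'r::finite^'m::finite"
  assumes le: "CARD('r) \<le> CARD('m)"
    and Y0: "Y0 \<in> stiefel" and inv: "invertible (transpose Y0 ** Y1)"
  obtains y u :: "'r \<Rightarrow> real^'m" and \<theta> :: "'r \<Rightarrow> real" where
    "\<And>i j. y i \<bullet> y j = (if i = j then 1 else 0)"
    "\<And>i j. u i \<bullet> u j = (if i = j then 1 else 0)"
    "\<And>i j. \<theta> j \<noteq> 0 \<Longrightarrow> y i \<bullet> u j = 0"
    "\<And>j. 0 \<le> \<theta> j" "\<And>j. \<theta> j < pi / 2"
    "colspan (of_columns y :: real^'r^'m) = colspan Y0"
    "colspan (of_columns (\<lambda>j. cos (\<theta> j) *\<^sub>R y j + sin (\<theta> j) *\<^sub>R u j) :: real^'r^'m) = colspan Y1"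
    "\<And>l. gr_exp Y0 (l *\<^sub>R gr_log Y0 Y1) =
       colspan (of_columns (\<lambda>j. cos (l * \<theta> j) *\<^sub>R y j + sin (l * \<theta> j) *\<^sub>R u j) :: real^'r^'m)"
proof -
  define G where "G = matrix_inv (transpose Y0 ** Y1)"
  have G: "transpose Y0 ** Y1 ** G = mat 1" "G ** (transpose Y0 ** Y1) = mat 1"
    unfolding G_def by (simp_all add: inv matrix_inv)
  define L where "L = Y1 ** G - Y0"
  obtain U s V where eq: "(SOME (U, s, V). thin_svd L U s V) = (U, s, V)"
    by (cases "SOME (U, s, V). thin_svd L U s V") auto
  obtain U0 \<theta>0 V0 where "thin_svd L U0 \<theta>0 V0" using thin_svd_exists[OF le] by blast
  then have "\<exists>p. case p of (U, \<theta>, V) \<Rightarrow> thin_svd L U \<theta> V" by auto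
  from someI_ex[OF this] eq have "thin_svd L U s V" by simp
  then have U: "transpose U ** U = mat 1" and V: "orthogonal_matrix V"
    and L: "L = U ** diag s ** transpose V" and s: "\<And>j. 0 \<le> s $ j"
    by (auto simp: thin_svd_def)
  have VV: "transpose V ** V = mat 1" "V ** transpose V = mat 1"
    using V by (auto simp: orthogonal_matrix_def)
  define \<theta> where "\<theta> = (\<lambda>j. arctan (s $ j))"
  define y where "y = (\<lambda>j. column j (Y0 ** V))"
  define u where "u = (\<lambda>j. column j U)"
  have log: "gr_log Y0 Y1 = U ** diag (\<chi> j. \<theta> j) ** transpose V"
    unfolding gr_log_def using eq by (simp add: L_def G_def \<theta>_def)
  have yo: "y i \<bullet> y j = (if i = j then 1 else 0)" for i j
  proof -
    have "transpose (Y0 ** V) ** (Y0 ** V) = transpose V ** (transpose Y0 ** Y0) ** V"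
      by (simp add: matrix_transpose_mul matrix_mul_assoc)
    then have "transpose (Y0 ** V) ** (Y0 ** V) = mat 1"
      using Y0 by (simp add: stiefel_def VV)
    then show ?thesis by (simp add: y_def transpose_mult_eq_1_iff)
  qed
  have uo: "u i \<bullet> u j = (if i = j then 1 else 0)" for i j
    using U by (simp add: u_def transpose_mult_eq_1_iff)
  have "transpose Y0 ** L = 0"
    using Y0 G by (simp add: L_def mm.diff_right matrix_mul_assoc stiefel_def)
  have LV: "L ** V = U ** diag s"
    unfolding L by (simp add: matrix_mul_assoc[symmetric] VV)
  have "transpose (Y0 ** V) ** (U ** diag s) = transpose V ** (transpose Y0 ** L) ** V"
    unfolding LV[symmetric] by (simp add: matrix_transpose_mul matrix_mul_assoc)
  also have "\<dots> = 0" by (simp add: \<open>transpose Y0 ** L = 0\<close>)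
  finally have "y i \<bullet> (s $ j *\<^sub>R u j) = 0" for i j
    by (simp add: transpose_mult_columns vec_eq_iff column_mult_diag y_def u_def)
  then have yu: "y i \<bullet> u j = 0" if "\<theta> j \<noteq> 0" for i j
    using that by (auto simp: \<theta>_def)
  have cols: "Y0 ** V ** diag (\<chi> j. a j) + U ** diag (\<chi> j. b j) =
      of_columns (\<lambda>j. a j *\<^sub>R y j + b j *\<^sub>R u j)" for a b
    by (simp add: y_def u_def matrix_mult_diag of_columns_def column_def vec_eq_iff)
  have e: "gr_exp Y0 (l *\<^sub>R gr_log Y0 Y1) =
       colspan (of_columns (\<lambda>j. cos (l * \<theta> j) *\<^sub>R y j + sin (l * \<theta> j) *\<^sub>R u j) :: real^'r^'m)" for l
  proof -
    have "l *\<^sub>R gr_log Y0 Y1 = U ** diag (\<chi> j. l * \<theta> j) ** transpose V"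
    proof -
      have "l *\<^sub>R diag (\<chi> j. \<theta> j) = diag (\<chi> j. l * \<theta> j)"
        by (simp add: diag_def vec_eq_iff)
      then show ?thesis unfolding log by (metis matrix_scalar_ac scalar_matrix_assoc)
    qed
    from gr_exp_eq[OF le U V this] show ?thesis by (simp add: cols)
  qed
  have "colspan (of_columns y :: real^'r^'m) = colspan (Y0 ** V)"
    by (simp add: y_def of_columns_def column_def)
  also have "\<dots> = colspan Y0"
    using VV by (intro colspan_mult_invertible) (auto simp: invertible_def)
  finally have c0: "colspan (of_columns y :: real^'r^'m) = colspan Y0" .
  have cpos: "cos (\<theta> j) > 0" for j
    unfolding \<theta>_def using arctan by (intro cos_gt_zero_pi) auto
  \<comment> \<open>As \<open>tan (\<theta> j) = s $ j\<close>, the end point is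
    \<open>(Y0 + L) V cos \<Theta> = Y1 G V cos \<Theta>\<close>, an invertible recombination of the
    columns of \<open>Y1\<close>.\<close>
  have "of_columns (\<lambda>j. cos (\<theta> j) *\<^sub>R y j + sin (\<theta> j) *\<^sub>R u j) =
     Y0 ** V ** diag (\<chi> j. cos (\<theta> j)) + U ** diag (\<chi> j. s $ j * cos (\<theta> j))"
  proof -
    have "s $ j * cos (\<theta> j) = sin (\<theta> j)" for j
      using cpos[of j] tan_arctan[of "s $ j"] unfolding \<theta>_def by (simp add: tan_def field_simps)
    then show ?thesis by (simp add: cols)
  qed
  also have "\<dots> = (Y0 ** V + L ** V) ** diag (\<chi> j. cos (\<theta> j))"
    unfolding LV by (simp add: mm.add_left matrix_mul_assoc[symmetric] diag_mult_diag)
  also have "\<dots> = Y1 ** (G ** V ** diag (\<chi> j. cos (\<theta> j)))"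
    by (simp add: L_def matrix_mul_assoc mm.add_left[symmetric])
  finally have Z: "of_columns (\<lambda>j. cos (\<theta> j) *\<^sub>R y j + sin (\<theta> j) *\<^sub>R u j) =
     Y1 ** (G ** V ** diag (\<chi> j. cos (\<theta> j)))" .
  have "diag (\<chi> j. cos (\<theta> j)) ** diag (\<chi> j. 1 / cos (\<theta> j)) = mat 1"
     "diag (\<chi> j. 1 / cos (\<theta> j)) ** diag (\<chi> j. cos (\<theta> j)) = mat 1"
    using cpos by (simp_all add: diag_mult_diag less_imp_neq[symmetric] diag_one)
  then have "invertible (diag (\<chi> j. cos (\<theta> j)))" unfolding invertible_def by blast
  then have "invertible (G ** V ** diag (\<chi> j. cos (\<theta> j)))"
    using G VV by (intro invertible_mult) (auto simp: invertible_def)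
  then have c1: "colspan (of_columns (\<lambda>j. cos (\<theta> j) *\<^sub>R y j + sin (\<theta> j) *\<^sub>R u j) :: real^'r^'m) = colspan Y1"
    unfolding Z by (rule colspan_mult_invertible)
  show ?thesis
  proof (rule that[of y u \<theta>])
    show "0 \<le> \<theta> j" "\<theta> j < pi / 2" for j
      using s[of j] arctan_ubound[of "s $ j"] by (simp_all add: \<theta>_def)
  qed (use yo uo yu c0 c1 e in auto)
qed

lemma geodesic_stiefel:
  fixes y u :: "'r::finite \<Rightarrow> real^'m::finite"
  assumes "\<And>i j. y i \<bullet> y j = (if i = j then 1 else 0)"
    "\<And>i j. u i \<bullet> u j = (if i = j then 1 else 0)"
    "\<And>i j. \<theta> j \<noteq> 0 \<Longrightarrow> y i \<bullet> u j = 0"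
  shows "(of_columns (\<lambda>j. cos (l * \<theta> j) *\<^sub>R y j + sin (l * \<theta> j) *\<^sub>R u j) :: real^'r^'m) \<in> stiefel"
proof -
  have *: "sin (l * \<theta> j) * (y i \<bullet> u j) = 0" for i j
    using assms(3)[of j i] by (cases "\<theta> j = 0") auto
  show ?thesis
    unfolding stiefel_iff column_of_columns
  proof (intro allI)
    fix i j
    have "(cos (l * \<theta> i) *\<^sub>R y i + sin (l * \<theta> i) *\<^sub>R u i) \<bullet> (cos (l * \<theta> j) *\<^sub>R y j + sin (l * \<theta> j) *\<^sub>R u j) =
      cos (l * \<theta> i) * cos (l * \<theta> j) * (y i \<bullet> y j) + sin (l * \<theta> i) * sin (l * \<theta> j) * (u i \<bullet> u j) +
      cos (l * \<theta> i) * (sin (l * \<theta> j) * (y i \<bullet> u j)) + cos (l * \<theta> j) * (sin (l * \<theta> i) * (y j \<bullet> u i))"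
      by (simp add: inner_simps inner_commute[of "u i" "y j"] algebra_simps)
    also have "\<dots> = (if i = j then 1 else 0)"
      using sin_cos_squared_add2[of "l * \<theta> i"] by (simp add: * assms(1,2) power2_eq_square)
    finally show "(cos (l * \<theta> i) *\<^sub>R y i + sin (l * \<theta> i) *\<^sub>R u i) \<bullet>
       (cos (l * \<theta> j) *\<^sub>R y j + sin (l * \<theta> j) *\<^sub>R u j) = (if i = j then 1 else 0)" .
  qed
qed

subsection \<open>Expansion of the geodesic in the reflections\<close>

text \<open>Every factor of the numerator satisfies
  \<open>\<bar>l - i\<bar> \<le> \<Lambda> + i\<close>, so the coefficients of exponent
  \<open>- \<Lambda>\<close> dominate uniformly in \<open>l\<close>.\<close>

lemma abs_gbinomial_le:
  fixes l \<Lambda> :: real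
  assumes "\<bar>l\<bar> \<le> \<Lambda>"
  shows "\<bar>l gchoose p\<bar> \<le> \<bar>(- \<Lambda>) gchoose p\<bar>"
proof -
  have "\<bar>\<Prod>i=0..<p. l - real i\<bar> \<le> \<bar>\<Prod>i=0..<p. - \<Lambda> - real i\<bar>"
    unfolding abs_prod using assms by (intro prod_mono) auto
  then show ?thesis
    by (simp add: gbinomial_prod_rev divide_right_mono)
qed

text \<open>With \<open>\<omega> = cis (2 * \<theta>) - 1\<close> the difference is the tail of the
  binomial series of \<open>(1 + \<omega>) powr l\<close>. For modulus up to 1/2, well inside the
  disc of convergence, it is dominated by the absolute tail for exponent \<open>- \<Lambda>\<close>,
  which makes \<open>C\<close> independent of \<open>l\<close> and of
  \<open>\<theta>\<close>.\<close>

lemma cis_power_expansion: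
  assumes "0 \<le> \<Lambda>"
  shows "\<exists>C\<ge>0. \<forall>\<theta> l. 0 \<le> \<theta> \<longrightarrow> \<theta> < pi / 2 \<longrightarrow> \<bar>l\<bar> \<le> \<Lambda> \<longrightarrow> cmod (cis (2 * \<theta>) - 1) \<le> 1 / 2 \<longrightarrow>
     cmod (cis (2 * l * \<theta>) - (\<Sum>p\<le>N. of_real (l gchoose p) * (cis (2 * \<theta>) - 1) ^ p))
       \<le> C * cmod (cis (2 * \<theta>) - 1) ^ (N + 1)"
proof -
  define g where "g p = \<bar>(- \<Lambda>) gchoose p\<bar>" for p
  have "summable (\<lambda>p. norm (((- \<Lambda>) gchoose p) * (1 / 2 :: real) ^ p))"
    by (rule abs_summable_in_conv_radius) (simp add: conv_radius_gchoose)
  then have sg: "summable (\<lambda>p. g p * (1 / 2) ^ p)"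
    by (simp add: g_def abs_mult power_abs)
  then have sg': "summable (\<lambda>p. g (p + (N + 1)) * (1 / 2) ^ (p + (N + 1)))"
    by (subst summable_iff_shift)
  \<comment> \<open>In each tail term \<open>N + 1\<close> factors \<open>\<omega>\<close> are kept
    and the others are bounded by 1/2; the power of 2 compensates for the kept ones.\<close>
  define C where "C = 2 ^ (N + 1) * (\<Sum>p. g (p + (N + 1)) * (1 / 2) ^ (p + (N + 1)))"
  have C0: "C \<ge> 0" unfolding C_def using suminf_nonneg[OF sg'] by (simp add: g_def)
  show ?thesis
  proof (intro exI[of _ C] conjI allI impI C0)
    fix \<theta> l :: real
    assume \<theta>: "0 \<le> \<theta>" "\<theta> < pi / 2" and l: "\<bar>l\<bar> \<le> \<Lambda>"
      and small: "cmod (cis (2 * \<theta>) - 1) \<le> 1 / 2"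
    define \<omega> where "\<omega> = cis (2 * \<theta>) - 1"
    define a where "a p = of_real (l gchoose p) * \<omega> ^ p" for p
    have ofr: "(of_real l gchoose p :: complex) = of_real (l gchoose p)" for p
      by (simp add: gbinomial_prod_rev)
    have "(\<lambda>p. (of_real l gchoose p) * \<omega> ^ p) sums (1 + \<omega>) powr (of_real l)"
      using small by (intro gen_binomial_complex) (simp add: \<omega>_def)
    moreover have "(1 + \<omega>) powr (of_real l) = cis (2 * l * \<theta>)"
    proof -
      \<comment> \<open>The bound \<open>2 * \<theta> < pi\<close> keeps the exponent in the
        principal strip, so \<open>powr\<close> selects the branch
        \<open>2 * l * \<theta>\<close>.\<close>
      have "Ln (exp (\<i> * of_real (2 * \<theta>))) = \<i> * of_real (2 * \<theta>)"
        using \<theta> by (intro Ln_exp) auto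
      then show ?thesis
        by (simp add: \<omega>_def powr_def cis_conv_exp mult_ac)
    qed
    ultimately have sums: "a sums cis (2 * l * \<theta>)" by (simp add: a_def[abs_def] ofr)
    then have "(\<lambda>p. a (p + (N + 1))) sums (cis (2 * l * \<theta>) - (\<Sum>p<N + 1. a p))"
      by (rule sums_split_initial_segment)
    then have eq: "cis (2 * l * \<theta>) - (\<Sum>p\<le>N. a p) = (\<Sum>p. a (p + (N + 1)))"
      by (simp add: sums_iff lessThan_Suc_atMost)
    have bound: "norm (a (p + (N + 1))) \<le>
       2 ^ (N + 1) * cmod \<omega> ^ (N + 1) * (g (p + (N + 1)) * (1 / 2) ^ (p + (N + 1)))" for p
    proof -
      have "norm (a (p + (N + 1))) = \<bar>l gchoose (p + (N + 1))\<bar> * (cmod \<omega> ^ p * cmod \<omega> ^ (N + 1))"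
        by (simp add: a_def norm_mult norm_power power_add)
      also have "\<dots> \<le> g (p + (N + 1)) * ((1 / 2) ^ p * cmod \<omega> ^ (N + 1))"
        unfolding g_def using l small
        by (intro mult_mono abs_gbinomial_le mult_right_mono power_mono) (auto simp: \<omega>_def)
      also have "\<dots> = 2 ^ (N + 1) * cmod \<omega> ^ (N + 1) * (g (p + (N + 1)) * (1 / 2) ^ (p + (N + 1)))"
        by (simp add: power_add power_divide)
      finally show ?thesis .
    qed
    have "norm (\<Sum>p. a (p + (N + 1))) \<le>
        (\<Sum>p. 2 ^ (N + 1) * cmod \<omega> ^ (N + 1) * (g (p + (N + 1)) * (1 / 2) ^ (p + (N + 1))))"
      by (rule norm_suminf_le[OF bound]) (rule summable_mult[OF sg'])
    also have "\<dots> = C * cmod \<omega> ^ (N + 1)"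
      by (subst suminf_mult[OF sg']) (simp add: C_def)
    finally show "cmod (cis (2 * l * \<theta>) - (\<Sum>p\<le>N. of_real (l gchoose p) * (cis (2 * \<theta>) - 1) ^ p))
       \<le> C * cmod (cis (2 * \<theta>) - 1) ^ (N + 1)"
      using eq by (simp add: a_def \<omega>_def)
  qed
qed

section \<open>Euclidean norm of a matrix versus its action on vectors\<close>

lemma norm_matrix_vector_mult:
  fixes A :: "real^'a::finite^'b::finite"
  shows "norm (A *v x) \<le> norm A * norm x"
proof -
  have "norm (A *v x) = L2_set (\<lambda>i. norm (A $ i \<bullet> x)) UNIV"
    by (simp add: norm_vec_def matrix_vector_mul_component)
  also have "\<dots> \<le> L2_set (\<lambda>i. norm (A $ i) * norm x) UNIV"
    by (intro L2_set_mono) (auto simp: Cauchy_Schwarz_ineq2)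
  also have "\<dots> = norm A * norm x"
    by (simp add: norm_vec_def[of A] L2_set_left_distrib)
  finally show ?thesis .
qed

lemma norm_matrix_le:
  fixes A :: "real^'a::finite^'b::finite"
  assumes "\<And>x. norm (A *v x) \<le> K * norm x"
  shows "norm A \<le> real (CARD('b) * CARD('a)) * K"
proof -
  have *: "\<bar>A $ i $ j\<bar> \<le> K" for i j
  proof -
    have "\<bar>A $ i $ j\<bar> = \<bar>(A *v axis j 1) $ i\<bar>"
      by (simp add: matrix_vector_mult_basis column_def)
    also have "\<dots> \<le> norm (A *v axis j 1)" by (rule component_le_norm_cart)
    also have "\<dots> \<le> K" using assms[of "axis j 1"] by simp
    finally show ?thesis .
  qed
  have "norm A \<le> (\<Sum>i\<in>UNIV. norm (A $ i))"
    unfolding norm_vec_def[of A] by (rule L2_set_le_sum) auto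
  also have "\<dots> \<le> (\<Sum>i\<in>UNIV. \<Sum>j\<in>UNIV. \<bar>A $ i $ j\<bar>)"
    by (intro sum_mono norm_le_l1_cart)
  also have "\<dots> \<le> (\<Sum>i\<in>(UNIV::'b set). \<Sum>j\<in>(UNIV::'a set). K)"
    by (intro sum_mono *)
  finally show ?thesis by (simp add: mult.assoc)
qed

lemma norm_stiefel_mult:
  fixes Y :: "real^'r::finite^'m::finite"
  assumes "Y \<in> stiefel"
  shows "norm (Y *v x) = norm x"
proof -
  have "(Y *v x) \<bullet> (Y *v x) = (transpose Y *v (Y *v x)) \<bullet> x"
    by (simp add: inner_transpose_matrix_vector)
  also have "\<dots> = x \<bullet> x" using assms by (simp add: matrix_vector_mul_assoc stiefel_def)
  finally show ?thesis by (simp add: norm_eq_sqrt_inner)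
qed

text \<open>A kernel vector \<open>x\<close> yields \<open>w = Y1 *v x\<close> in the second
  subspace and orthogonal to the first. The reflections map \<open>w\<close> to \<open>w\<close> and
  to \<open>- w\<close>, so their difference stretches \<open>w\<close> by 2.\<close>

lemma invertible_cross_gram:
  fixes Y0 Y1 :: "real^'r::finite^'m::finite"
  assumes Y1: "Y1 \<in> stiefel" and small: "norm (reflection Y1 - reflection Y0) < 2"
  shows "invertible (transpose Y0 ** Y1)"
proof -
  have "x = 0" if x: "(transpose Y0 ** Y1) *v x = 0" for x
  proof (rule ccontr)
    assume "x \<noteq> 0"
    define w where "w = Y1 *v x"
    have "transpose Y1 *v w = x"
      using Y1 by (simp add: w_def matrix_vector_mul_assoc stiefel_def)
    then have w0: "w \<noteq> 0" using \<open>x \<noteq> 0\<close> by auto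
    have "(reflection Y1 - reflection Y0) *v w = 2 *\<^sub>R w"
      using x \<open>transpose Y1 *v w = x\<close>
      by (simp add: matrix_vector_mult_diff_rdistrib reflection_mult_vector) (simp add: w_def matrix_vector_mul_assoc)
    then have "2 * norm w \<le> norm (reflection Y1 - reflection Y0) * norm w"
      using norm_matrix_vector_mult[of "reflection Y1 - reflection Y0" w] by simp
    also have "\<dots> < 2 * norm w" using small w0 by simp
    finally show False by simp
  qed
  then show ?thesis
    by (simp add: invertible_left_inverse matrix_left_invertible_ker)
qed

text \<open>The binomial series of \<open>(1 + (B - A) A)^l A\<close>, truncated at
  \<open>N\<close>. Its term for 1 would be \<open>(B - A) A A\<close>, which equals
  \<open>B - A\<close> only for an involution \<open>A\<close>. Writing \<open>B - A\<close> keeps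
  the linear part an exact affine combination also for the polynomial models of the data, as
  Neville's scheme requires.\<close>

definition glerp_poly :: "nat \<Rightarrow> real \<Rightarrow> real^'m::finite^'m \<Rightarrow> real^'m^'m \<Rightarrow> real^'m^'m" where
  "glerp_poly N l A B = A + l *\<^sub>R (B - A) +
     (\<Sum>p=2..N. (l gchoose p) *\<^sub>R (((\<lambda>X. (B - A) ** A ** X) ^^ p) A))"

text \<open>
  In the principal plane spanned by \<open>y j\<close> and \<open>u j\<close>, identified with the complex numbers, a reflection
  acts as complex conjugation followed by a rotation; so the operators below are computed with
  complex scalars, and the statement reduces to the binomial series.
\<close>

lemma reflection_geodesic_expansion:
  fixes y u :: "'r::finite \<Rightarrow> real^'m::finite" and \<theta> :: "'r \<Rightarrow> real" and l :: real
  assumes yo: "\<And>i j. y i \<bullet> y j = (if i = j then 1 else 0)"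
    and uo: "\<And>i j. u i \<bullet> u j = (if i = j then 1 else 0)"
    and yu: "\<And>i j. \<theta> j \<noteq> 0 \<Longrightarrow> y i \<bullet> u j = 0"
    and N: "1 \<le> N"
    and z: "z = (\<lambda>l j. cos (l * \<theta> j) *\<^sub>R y j + sin (l * \<theta> j) *\<^sub>R u j)"
    and S: "S = reflection (of_columns y)"
    and D: "D = reflection (of_columns (z 1)) - S"
    and C: "\<And>j. cmod (cis (2 * \<theta> j) - 1) \<le> 2 * norm D \<Longrightarrow> 
      cmod (cis (2 * l * \<theta> j) - (\<Sum>p\<le>N. of_real (l gchoose p) * (cis (2 * \<theta> j) - 1) ^ p))
       \<le> C * cmod (cis (2 * \<theta> j) - 1) ^ (N + 1)" and C0: "0 \<le> C"
  shows "norm (reflection (of_columns (z l)) - (S + l *\<^sub>R D +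
           (\<Sum>p=2..N. (l gchoose p) *\<^sub>R (((\<lambda>X. D ** S ** X) ^^ p) S)))) \<le>
         real (CARD('m) * CARD('m)) * (real CARD('r) * (4 * C * 2 ^ (N + 1))) * norm D ^ (N + 1)"
proof -
  \<comment> \<open>Where the angle vanishes the geodesic is stationary, so only the planes in
    \<open>J\<close> contribute. There \<open>y\<close> and \<open>u\<close> together are
    orthonormal, and \<open>c\<close> and \<open>syn\<close> translate between vectors and complex
    coordinates.\<close>
  define J where "J = {j. \<theta> j \<noteq> 0}"
  define c where "c j x = Complex (y j \<bullet> x) (u j \<bullet> x)" for j x
  define syn where "syn \<zeta> = (\<Sum>j\<in>J. Re (\<zeta> j) *\<^sub>R y j + Im (\<zeta> j) *\<^sub>R u j)" for \<zeta> :: "'r \<Rightarrow> complex"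
  define \<omega> where "\<omega> j = cis (2 * \<theta> j) - 1" for j
  have syn_cong: "syn f = syn g" if "\<And>j. j \<in> J \<Longrightarrow> f j = g j" for f g
    using that by (simp add: syn_def)
  have syn_add: "syn f + syn g = syn (\<lambda>j. f j + g j)" for f g
    by (simp add: syn_def sum.distrib scaleR_add_left algebra_simps)
  have syn_diff: "syn f - syn g = syn (\<lambda>j. f j - g j)" for f g
    by (simp add: syn_def sum_subtractf[symmetric] scaleR_diff_left algebra_simps)
  have syn_scale: "r *\<^sub>R syn f = syn (\<lambda>j. of_real r * f j)" for f r
    by (simp add: syn_def scaleR_sum_right scaleR_add_right)
  have syn_sum: "(\<Sum>p\<in>A. syn (f p)) = syn (\<lambda>j. \<Sum>p\<in>A. f p j)" if "finite A"
    for f and A :: "nat set"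
    using that by (induction A rule: finite_induct) (auto simp: syn_add, simp add: syn_def)
  have uy: "u i \<bullet> y j = 0" if "i \<in> J" for i j
    using yu[of i j] that by (simp add: J_def inner_commute)
  have yu': "y i \<bullet> u j = 0" if "j \<in> J" for i j
    using yu[of j i] that by (simp add: J_def)
  have c_syn: "c i (syn \<zeta>) = \<zeta> i" if "i \<in> J" for i \<zeta>
  proof -
    have "y i \<bullet> syn \<zeta> = (\<Sum>j\<in>J. if j = i then Re (\<zeta> i) else 0)"
      unfolding syn_def inner_sum_right using that
      by (intro sum.cong) (auto simp: inner_simps yo yu')
    moreover have "u i \<bullet> syn \<zeta> = (\<Sum>j\<in>J. if j = i then Im (\<zeta> i) else 0)"
      unfolding syn_def inner_sum_right using that
      by (intro sum.cong) (auto simp: inner_simps uo uy)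
    ultimately show ?thesis using that by (simp add: c_def)
  qed
  have refl_c: "c i (S *v x) = cnj (c i x)" if "i \<in> J" for i x
  proof -
    have "y i \<bullet> (\<Sum>j\<in>UNIV. (y j \<bullet> x) *\<^sub>R y j) = (\<Sum>j\<in>UNIV. if j = i then y i \<bullet> x else 0)"
      unfolding inner_sum_right by (intro sum.cong) (auto simp: yo)
    moreover have "u i \<bullet> (\<Sum>j\<in>UNIV. (y j \<bullet> x) *\<^sub>R y j) = 0"
      unfolding inner_sum_right using that by (intro sum.neutral) (auto simp: uy)
    ultimately show ?thesis
      by (simp add: S reflection_vector c_def inner_simps complex_eq_iff)
  qed
  have SS: "S ** S = mat 1"
  proof -
    have "(of_columns y :: real^'r^'m) \<in> stiefel" by (simp add: stiefel_iff yo)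
    then have "transpose (of_columns y :: real^'r^'m) ** of_columns y = mat 1"
      by (simp add: stiefel_def)
    then have "(of_columns y :: real^'r^'m) ** transpose (of_columns y) **
       ((of_columns y :: real^'r^'m) ** transpose (of_columns y)) =
       (of_columns y :: real^'r^'m) ** transpose (of_columns y)"
      by (metis matrix_mul_assoc matrix_mul_rid)
    then show ?thesis
      unfolding S reflection_def
      by (simp only: mm.diff_left mm.diff_right mm.scaleR_left mm.scaleR_right
          matrix_mul_lid matrix_mul_rid) (simp add: vec_eq_iff)
  qed
  have diff: "(reflection (of_columns (z l)) - S) *v x =
      syn (\<lambda>j. (cis (2 * l * \<theta> j) - 1) * cnj (c j x))" for l x
  proof -
    have "(reflection (of_columns (z l)) - S) *v x =
       (\<Sum>j\<in>UNIV. 2 *\<^sub>R ((z l j \<bullet> x) *\<^sub>R z l j - (y j \<bullet> x) *\<^sub>R y j))"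
      by (simp add: S matrix_vector_mult_diff_rdistrib reflection_vector scaleR_sum_right
          sum_subtractf scaleR_diff_right)
    also have "\<dots> = (\<Sum>j\<in>J. 2 *\<^sub>R ((z l j \<bullet> x) *\<^sub>R z l j - (y j \<bullet> x) *\<^sub>R y j))"
      by (rule sum.mono_neutral_right) (auto simp: J_def z)
    also have "\<dots> = syn (\<lambda>j. (cis (2 * l * \<theta> j) - 1) * cnj (c j x))"
      unfolding syn_def
    proof (rule sum.cong[OF refl])
      fix j assume "j \<in> J"
      define \<phi> a b where "\<phi> = l * \<theta> j" and "a = y j \<bullet> x" and "b = u j \<bullet> x"
      have e: "cis (2 * l * \<theta> j) - 1 = Complex (- 2 * (sin \<phi>)\<^sup>2) (2 * sin \<phi> * cos \<phi>)"
        using cos_double_sin[of \<phi>] sin_double[of \<phi>]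
        by (simp add: complex_eq_iff \<phi>_def mult.assoc)
      have "2 *\<^sub>R ((z l j \<bullet> x) *\<^sub>R z l j - a *\<^sub>R y j) =
        (2 * (cos \<phi> * a + sin \<phi> * b) * cos \<phi> - 2 * a) *\<^sub>R y j +
        (2 * (cos \<phi> * a + sin \<phi> * b) * sin \<phi>) *\<^sub>R u j"
        by (simp add: z \<phi>_def a_def b_def inner_simps algebra_simps)
      moreover have "2 * (cos \<phi> * a + sin \<phi> * b) * cos \<phi> - 2 * a =
          - 2 * (sin \<phi>)\<^sup>2 * a + 2 * sin \<phi> * cos \<phi> * b"
        using sin_cos_squared_add[of \<phi>] by algebra
      moreover have "2 * (cos \<phi> * a + sin \<phi> * b) * sin \<phi> =
          2 * sin \<phi> * cos \<phi> * a + 2 * (sin \<phi>)\<^sup>2 * b"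
        by (simp add: algebra_simps power2_eq_square)
      moreover have "Re ((cis (2 * l * \<theta> j) - 1) * cnj (c j x)) =
          - 2 * (sin \<phi>)\<^sup>2 * a + 2 * sin \<phi> * cos \<phi> * b"
        "Im ((cis (2 * l * \<theta> j) - 1) * cnj (c j x)) =
          2 * sin \<phi> * cos \<phi> * a + 2 * (sin \<phi>)\<^sup>2 * b"
        unfolding e by (simp_all add: c_def a_def b_def)
      ultimately show "2 *\<^sub>R ((z l j \<bullet> x) *\<^sub>R z l j - (y j \<bullet> x) *\<^sub>R y j) =
        Re ((cis (2 * l * \<theta> j) - 1) * cnj (c j x)) *\<^sub>R y j +
        Im ((cis (2 * l * \<theta> j) - 1) * cnj (c j x)) *\<^sub>R u j"
        by (simp only: a_def)
    qed
    finally show ?thesis .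
  qed
  have Dv: "D *v x = syn (\<lambda>j. \<omega> j * cnj (c j x))" for x
    unfolding D using diff[of 1 x] by (simp add: \<omega>_def)
  have DSv: "(D ** S) *v x = syn (\<lambda>j. \<omega> j * c j x)" for x
    unfolding matrix_vector_mul_assoc[symmetric] Dv by (rule syn_cong) (simp add: refl_c)
  \<comment> \<open>The exponent starts at 1: \<open>S\<close> itself also acts outside the
    principal planes and is in general not of the form \<open>syn\<close>, whereas
    \<open>D ** S ** S = D\<close> is.\<close>
  have Tv: "((\<lambda>X. D ** S ** X) ^^ p) S *v x = syn (\<lambda>j. \<omega> j ^ p * cnj (c j x))" if "1 \<le> p" for p x
    using that
  proof (induction p rule: dec_induct)
    case base
    show ?case
      by (simp add: matrix_mul_assoc[symmetric] SS Dv)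
  next
    case (step p)
    have "((\<lambda>X. D ** S ** X) ^^ Suc p) S *v x = (D ** S) *v (((\<lambda>X. D ** S ** X) ^^ p) S *v x)"
      by (simp add: matrix_vector_mul_assoc)
    also have "\<dots> = syn (\<lambda>j. \<omega> j ^ Suc p * cnj (c j x))"
      unfolding step.IH DSv by (rule syn_cong) (simp add: c_syn)
    finally show ?case .
  qed
  have c_le: "cmod (c j x) \<le> 2 * norm x" for j x
  proof -
    have "cmod (c j x) \<le> \<bar>Re (c j x)\<bar> + \<bar>Im (c j x)\<bar>" by (rule cmod_le)
    also have "\<dots> \<le> norm (y j) * norm x + norm (u j) * norm x"
      unfolding c_def by (intro add_mono) (auto simp: Cauchy_Schwarz_ineq2)
    also have "\<dots> = 2 * norm x" using yo[of j j] uo[of j j] by (simp add: norm_eq_sqrt_inner)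
    finally show ?thesis by simp
  qed
  \<comment> \<open>Evaluating \<open>D\<close> at \<open>y j\<close> exposes
    \<open>\<omega> j\<close>. This is how smallness of \<open>D\<close> reaches every plane and
    meets the premise of the assumed binomial estimate.\<close>
  have \<omega>_le: "cmod (\<omega> j) \<le> 2 * norm D" for j
  proof (cases "j \<in> J")
    case True
    have "c j (D *v y j) = \<omega> j"
      unfolding Dv c_syn[OF True] using True by (simp add: c_def yo uy complex_eq_iff)
    then have "cmod (\<omega> j) \<le> 2 * norm (D *v y j)" using c_le by metis
    also have "\<dots> \<le> 2 * (norm D * norm (y j))" by (simp add: norm_matrix_vector_mult)
    also have "norm (y j) = 1" using yo by (simp add: norm_eq_sqrt_inner)
    finally show ?thesis by simp
  qed (simp add: J_def \<omega>_def)
  define \<rho> where "\<rho> j = cis (2 * l * \<theta> j) - (\<Sum>p\<le>N. of_real (l gchoose p) * \<omega> j ^ p)" for j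
  have \<rho>_le: "cmod (\<rho> j) \<le> C * 2 ^ (N + 1) * norm D ^ (N + 1)" for j
  proof -
    have "cmod (\<rho> j) \<le> C * cmod (\<omega> j) ^ (N + 1)"
      using C[of j] \<omega>_le[of j] by (simp add: \<rho>_def \<omega>_def)
    also have "\<dots> \<le> C * (2 * norm D) ^ (N + 1)"
      using \<omega>_le[of j] C0 by (intro mult_left_mono power_mono) auto
    finally show ?thesis by (simp add: power_mult_distrib mult_ac)
  qed
  define E where "E = reflection (of_columns (z l)) - (S + l *\<^sub>R D +
           (\<Sum>p=2..N. (l gchoose p) *\<^sub>R (((\<lambda>X. D ** S ** X) ^^ p) S)))"
  have sumv: "(\<Sum>p\<in>A. M p) *v x = (\<Sum>p\<in>A. M p *v x)" if "finite A"
    for M :: "nat \<Rightarrow> real^'m^'m" and A x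
    using that by (induction A rule: finite_induct) (auto simp: matrix_vector_mult_add_rdistrib)
  \<comment> \<open>The terms for 0 and 1 account for the \<open>- 1\<close> that comes from
    subtracting \<open>S\<close> and for the linear term in \<open>D\<close>; this is where
    \<open>1 \<le> N\<close> enters.\<close>
  have split: "{..N} = {0, 1} \<union> {2..N}" using N by auto
  have "E *v x = syn (\<lambda>j. \<rho> j * cnj (c j x))" for x
  proof -
    have "E *v x = (reflection (of_columns (z l)) - S) *v x - (l *\<^sub>R (D *v x) +
           (\<Sum>p=2..N. (l gchoose p) *\<^sub>R (((\<lambda>X. D ** S ** X) ^^ p) S *v x)))"
      by (simp add: E_def matrix_vector_mult_diff_rdistrib matrix_vector_mult_add_rdistrib sumv
          scaleR_matrix_vector_assoc[symmetric])
    also have "(\<Sum>p=2..N. (l gchoose p) *\<^sub>R (((\<lambda>X. D ** S ** X) ^^ p) S *v x)) =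
       (\<Sum>p=2..N. syn (\<lambda>j. of_real (l gchoose p) * (\<omega> j ^ p * cnj (c j x))))"
      by (intro sum.cong refl) (simp add: Tv syn_scale)
    finally have "E *v x = syn (\<lambda>j. (cis (2 * l * \<theta> j) - 1) * cnj (c j x) -
       (of_real l * (\<omega> j * cnj (c j x)) +
         (\<Sum>p=2..N. of_real (l gchoose p) * (\<omega> j ^ p * cnj (c j x)))))"
      by (simp add: diff Dv syn_scale syn_sum syn_add syn_diff)
    also have "\<dots> = syn (\<lambda>j. \<rho> j * cnj (c j x))"
      unfolding \<rho>_def split
      by (rule syn_cong, subst sum.union_disjoint)
        (auto simp: algebra_simps sum_distrib_left)
    finally show ?thesis .
  qed
  then have "norm (E *v x) \<le> real CARD('r) * (4 * C * 2 ^ (N + 1)) * norm D ^ (N + 1) * norm x" for x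
  proof -
    define B where "B = C * 2 ^ (N + 1) * norm D ^ (N + 1) * (2 * norm x)"
    have B0: "0 \<le> B" using C0 by (simp add: B_def)
    have le: "cmod (\<rho> j * cnj (c j x)) \<le> B" for j
      unfolding B_def norm_mult complex_mod_cnj using C0 by (intro mult_mono \<rho>_le c_le) auto
    have "norm (E *v x) \<le> (\<Sum>j\<in>J. norm (Re (\<rho> j * cnj (c j x)) *\<^sub>R y j + Im (\<rho> j * cnj (c j x)) *\<^sub>R u j))"
      unfolding \<open>E *v x = _\<close> syn_def by (rule norm_sum)
    also have "\<dots> \<le> (\<Sum>j\<in>J. 2 * B)"
    proof (rule sum_mono)
      fix j
      let ?w = "\<rho> j * cnj (c j x)"
      have "norm (Re ?w *\<^sub>R y j + Im ?w *\<^sub>R u j) \<le> \<bar>Re ?w\<bar> * norm (y j) + \<bar>Im ?w\<bar> * norm (u j)"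
        by (metis norm_triangle_ineq norm_scaleR)
      also have "\<dots> = \<bar>Re ?w\<bar> + \<bar>Im ?w\<bar>"
        using yo[of j j] uo[of j j] by (simp add: norm_eq_sqrt_inner)
      also have "\<dots> \<le> 2 * B"
        using abs_Re_le_cmod[of ?w] abs_Im_le_cmod[of ?w] le[of j] by linarith
      finally show "norm (Re ?w *\<^sub>R y j + Im ?w *\<^sub>R u j) \<le> 2 * B" .
    qed
    also have "\<dots> \<le> real CARD('r) * (2 * B)"
      using B0 by (simp add: mult_right_mono card_mono)
    finally show ?thesis by (simp add: B_def mult_ac)
  qed
  from norm_matrix_le[of E, OF this] show ?thesis
    unfolding E_def by (simp add: mult.assoc)
qed

text \<open>The threshold 1/4 serves twice: it lies below 2, so the Gram matrix is invertible and
  the logarithm is given by principal vectors, and it forces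
  \<open>cis (2 * \<theta> j) - 1\<close>, once bounded by twice the norm of the difference, into
  the disc of radius 1/2. The constant depends on the dimensions, \<open>N\<close> and
  \<open>\<Lambda>\<close>, not on the subspaces.\<close>

lemma glerp_expansion:
  assumes le: "CARD('r::finite) \<le> CARD('m::finite)" and N: "1 \<le> N" and "0 \<le> \<Lambda>"
  obtains C where
    "\<And>(A :: (real^'m) set) B l. \<lbrakk>\<exists>Y::real^'r^'m. Y \<in> stiefel \<and> colspan Y = A;
       \<exists>Y::real^'r^'m. Y \<in> stiefel \<and> colspan Y = B; \<bar>l\<bar> \<le> \<Lambda>;
       norm (gr_refl TYPE('r) B - gr_refl TYPE('r) A) \<le> 1 / 4\<rbrakk> \<Longrightarrow>
       (\<exists>Y::real^'r^'m. Y \<in> stiefel \<and> colspan Y = glerp TYPE('r) A B l) \<and>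
       norm (gr_refl TYPE('r) (glerp TYPE('r) A B l) -
           glerp_poly N l (gr_refl TYPE('r) A) (gr_refl TYPE('r) B)) \<le>
         C * norm (gr_refl TYPE('r) B - gr_refl TYPE('r) A) ^ (N + 1)"
proof -
  obtain C where C0: "C \<ge> 0" and C: "\<And>\<theta> l. \<lbrakk>0 \<le> \<theta>; \<theta> < pi / 2; \<bar>l\<bar> \<le> \<Lambda>; cmod (cis (2 * \<theta>) - 1) \<le> 1 / 2\<rbrakk> \<Longrightarrow>
     cmod (cis (2 * l * \<theta>) - (\<Sum>p\<le>N. of_real (l gchoose p) * (cis (2 * \<theta>) - 1) ^ p))
       \<le> C * cmod (cis (2 * \<theta>) - 1) ^ (N + 1)"
    using cis_power_expansion[OF \<open>0 \<le> \<Lambda>\<close>, of N] by blast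
  show ?thesis
  proof (rule that)
    fix A B :: "(real^'m) set" and l :: real
    assume "\<exists>Y::real^'r^'m. Y \<in> stiefel \<and> colspan Y = A" "\<exists>Y::real^'r^'m. Y \<in> stiefel \<and> colspan Y = B"
      and l: "\<bar>l\<bar> \<le> \<Lambda>" and small: "norm (gr_refl TYPE('r) B - gr_refl TYPE('r) A) \<le> 1 / 4"
    then obtain YA YB :: "real^'r^'m"
      where YA: "YA \<in> stiefel" "colspan YA = A" and YB: "YB \<in> stiefel" "colspan YB = B"
      by blast
    define Y0 Y1 where "Y0 = (gr_rep A :: real^'r^'m)" and "Y1 = (gr_rep B :: real^'r^'m)"
    have Y0: "Y0 \<in> stiefel" "colspan Y0 = A" and Y1: "Y1 \<in> stiefel" "colspan Y1 = B"
      using gr_rep[OF YA] gr_rep[OF YB] by (simp_all add: Y0_def Y1_def)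
    have "invertible (transpose Y0 ** Y1)"
      using small by (intro invertible_cross_gram Y1) (simp add: gr_refl_def Y0_def Y1_def)
    note inv = this
    obtain y u :: "'r \<Rightarrow> real^'m" and \<theta> where
      yo: "\<And>i j. y i \<bullet> y j = (if i = j then 1 else 0)" and
      uo: "\<And>i j. u i \<bullet> u j = (if i = j then 1 else 0)" and
      yu: "\<And>i j. \<theta> j \<noteq> 0 \<Longrightarrow> y i \<bullet> u j = 0" and
      \<theta>: "\<And>j. 0 \<le> \<theta> j" "\<And>j. \<theta> j < pi / 2" and
      c0: "colspan (of_columns y :: real^'r^'m) = colspan Y0" and
      c1: "colspan (of_columns (\<lambda>j. cos (\<theta> j) *\<^sub>R y j + sin (\<theta> j) *\<^sub>R u j) :: real^'r^'m) = colspan Y1" and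
      e: "\<And>l. gr_exp Y0 (l *\<^sub>R gr_log Y0 Y1) =
       colspan (of_columns (\<lambda>j. cos (l * \<theta> j) *\<^sub>R y j + sin (l * \<theta> j) *\<^sub>R u j) :: real^'r^'m)"
      by (rule glerp_geodesic[OF le Y0(1) inv]) (rule that)
    define z where "z = (\<lambda>l j. cos (l * \<theta> j) *\<^sub>R y j + sin (l * \<theta> j) *\<^sub>R u j)"
    have st: "(of_columns (z l) :: real^'r^'m) \<in> stiefel" for l
      unfolding z_def by (rule geodesic_stiefel) (use yo uo yu in auto)
    have gl: "glerp TYPE('r) A B l = colspan (of_columns (z l) :: real^'r^'m)" for l
      using e[of l] by (simp add: glerp_def z_def Y0_def Y1_def)
    have S: "gr_refl TYPE('r) A = reflection (of_columns y :: real^'r^'m)"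
      using c0 Y0 by (intro gr_refl_colspan) (auto simp: stiefel_iff yo)
    have "colspan (of_columns (z 1) :: real^'r^'m) = B" using c1 Y1 by (simp add: z_def)
    then have D: "gr_refl TYPE('r) B = reflection (of_columns (z 1) :: real^'r^'m)"
      using st by (intro gr_refl_colspan) auto
    have L: "gr_refl TYPE('r) (glerp TYPE('r) A B l) = reflection (of_columns (z l) :: real^'r^'m)"
      using st gl by (intro gr_refl_colspan) auto
    show "(\<exists>Y::real^'r^'m. Y \<in> stiefel \<and> colspan Y = glerp TYPE('r) A B l) \<and>
      norm (gr_refl TYPE('r) (glerp TYPE('r) A B l) -
          glerp_poly N l (gr_refl TYPE('r) A) (gr_refl TYPE('r) B)) \<le>
        (real (CARD('m) * CARD('m)) * (real CARD('r) * (4 * C * 2 ^ (N + 1)))) *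
          norm (gr_refl TYPE('r) B - gr_refl TYPE('r) A) ^ (N + 1)"
    proof
      show "\<exists>Y::real^'r^'m. Y \<in> stiefel \<and> colspan Y = glerp TYPE('r) A B l"
        using st[of l] gl[of l] by auto
      show "norm (gr_refl TYPE('r) (glerp TYPE('r) A B l) -
          glerp_poly N l (gr_refl TYPE('r) A) (gr_refl TYPE('r) B)) \<le>
        (real (CARD('m) * CARD('m)) * (real CARD('r) * (4 * C * 2 ^ (N + 1)))) *
          norm (gr_refl TYPE('r) B - gr_refl TYPE('r) A) ^ (N + 1)"
        unfolding L D S glerp_poly_def
      proof (rule reflection_geodesic_expansion[OF yo uo yu N z_def refl refl _ C0])
        fix j
        assume "cmod (cis (2 * \<theta> j) - 1) \<le>
          2 * norm (reflection (of_columns (z 1) :: real^'r^'m) - reflection (of_columns y :: real^'r^'m))"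
        then show "cmod (cis (2 * l * \<theta> j) - (\<Sum>p\<le>N. of_real (l gchoose p) * (cis (2 * \<theta> j) - 1) ^ p))
            \<le> C * cmod (cis (2 * \<theta> j) - 1) ^ (N + 1)"
          using small unfolding D S by (intro C \<theta> l) simp
      qed
    qed
  qed
qed

subsection \<open>Polynomial functions of \<open>u = t - t0\<close>, the node offset \<open>x\<close> and the step \<open>h\<close>\<close>

text \<open>Given by generators, so that divisibility can be proved by structural induction. The
  node index is absent: node \<open>j\<close> is reached by setting \<open>x = j h\<close>, which
  makes passage to the next node the shift \<open>x + h\<close>.\<close>

inductive polyfun :: "(real \<Rightarrow> real \<Rightarrow> real \<Rightarrow> 'v::real_normed_vector) \<Rightarrow> bool" where
  const: "polyfun (\<lambda>u x h. c)"
| add: "polyfun f \<Longrightarrow> polyfun g \<Longrightarrow> polyfun (\<lambda>u x h. f u x h + g u x h)"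
| mult_u: "polyfun f \<Longrightarrow> polyfun (\<lambda>u x h. u *\<^sub>R f u x h)"
| mult_x: "polyfun f \<Longrightarrow> polyfun (\<lambda>u x h. x *\<^sub>R f u x h)"
| mult_h: "polyfun f \<Longrightarrow> polyfun (\<lambda>u x h. h *\<^sub>R f u x h)"

lemma polyfun_linear:
  assumes "bounded_linear L" "polyfun f"
  shows "polyfun (\<lambda>u x h. L (f u x h))"
proof -
  interpret bounded_linear L by fact
  show ?thesis using assms(2)
    by induction (simp_all add: add scaleR polyfun.intros)
qed

lemma polyfun_bilinear:
  assumes "bounded_bilinear B" "polyfun f" "polyfun g"
  shows "polyfun (\<lambda>u x h. B (f u x h) (g u x h))"
proof -
  interpret bounded_bilinear B by fact
  show ?thesis using assms(2)
    by induction
      (simp_all add: add_left scaleR_left polyfun.intros polyfun_linear[OF bounded_linear_right assms(3)])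
qed

lemmas polyfun_scaleR = polyfun_bilinear[OF bounded_bilinear_scaleR]
lemmas polyfun_mult = polyfun_bilinear[OF bounded_bilinear_mult]
lemmas polyfun_matrix_mult = polyfun_bilinear[OF bounded_bilinear_matrix_mult]

lemma polyfun_vars:
  "polyfun (\<lambda>u x h. u)" "polyfun (\<lambda>u x h. x)" "polyfun (\<lambda>u x h. h)"
  using polyfun.mult_u[OF polyfun.const[of "1::real"]] polyfun.mult_x[OF polyfun.const[of "1::real"]]
    polyfun.mult_h[OF polyfun.const[of "1::real"]] by simp_all

lemma polyfun_diff: "polyfun f \<Longrightarrow> polyfun g \<Longrightarrow> polyfun (\<lambda>u x h. f u x h - g u x h)"
  using polyfun.add[of f "\<lambda>u x h. - g u x h"]
    polyfun_linear[OF bounded_linear_minus[OF bounded_linear_ident], of g]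
  by simp

lemma polyfun_sum:
  "finite A \<Longrightarrow> (\<And>i. i \<in> A \<Longrightarrow> polyfun (f i)) \<Longrightarrow> polyfun (\<lambda>u x h. \<Sum>i\<in>A. f i u x h)"
  by (induction A rule: finite_induct) (auto intro: polyfun.intros)

lemma polyfun_prod:
  fixes f :: "'i \<Rightarrow> real \<Rightarrow> real \<Rightarrow> real \<Rightarrow> real"
  shows "finite A \<Longrightarrow> (\<And>i. i \<in> A \<Longrightarrow> polyfun (f i)) \<Longrightarrow> polyfun (\<lambda>u x h. \<Prod>i\<in>A. f i u x h)"
  by (induction A rule: finite_induct) (auto intro: polyfun.intros polyfun_mult)

lemma polyfun_power:
  fixes f :: "real \<Rightarrow> real \<Rightarrow> real \<Rightarrow> real"
  shows "polyfun f \<Longrightarrow> polyfun (\<lambda>u x h. f u x h ^ p)"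
  by (induction p) (auto intro: polyfun.intros polyfun_mult)

lemma polyfun_funpow:
  fixes f :: "real \<Rightarrow> real \<Rightarrow> real \<Rightarrow> real^'m::finite^'m"
  shows "polyfun f \<Longrightarrow> polyfun g \<Longrightarrow> polyfun (\<lambda>u x h. ((\<lambda>X. f u x h ** X) ^^ p) (g u x h))"
  by (induction p) (auto intro: polyfun_matrix_mult)

lemmas polyfun_intros = polyfun.const polyfun.add polyfun_diff polyfun_vars polyfun_scaleR
  polyfun_mult polyfun_matrix_mult polyfun_sum polyfun_prod polyfun_power polyfun_funpow

lemma polyfun_shift: "polyfun f \<Longrightarrow> polyfun (\<lambda>u x h. f u (x + h) h)"
proof (induction rule: polyfun.induct)
  case (mult_x f)
  from mult_x.IH show ?case
    by (rule polyfun_scaleR[OF polyfun.add[OF polyfun_vars(2,3)]])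
qed (simp_all add: polyfun.intros)

text \<open>A polynomial in one variable, such as the jet of the curve, is stored in the slot
  \<open>x\<close> with zeros in the other two slots; it can then be read at \<open>u\<close> or at
  \<open>x\<close>.\<close>

lemma polyfun_at_zero:
  assumes "polyfun f"
  shows "polyfun (\<lambda>u x h. f 0 u 0)" "polyfun (\<lambda>u x h. f 0 x 0)"
  using assms by (induction; simp add: polyfun.intros)+

text \<open>Passing to the neighbouring node changes a polynomial by an exact multiple of
  \<open>h\<close>; the only case with content is the product rule for the factor
  \<open>x\<close>.\<close>

lemma polyfun_shift_quotient:
  assumes "polyfun f"
  shows "\<exists>g. polyfun g \<and> (\<forall>u x h. f u (x + h) h - f u x h = h *\<^sub>R g u x h)"
  using assms
proof induction
  case (const c)
  show ?case by (intro exI[of _ "\<lambda>u x h. 0"]) (auto intro: polyfun.const)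
next
  case (add f g)
  then obtain f' g' where "polyfun f'" "polyfun g'"
    and "\<And>u x h. f u (x + h) h - f u x h = h *\<^sub>R f' u x h" "\<And>u x h. g u (x + h) h - g u x h = h *\<^sub>R g' u x h"
    by blast
  then show ?case
    by (intro exI[of _ "\<lambda>u x h. f' u x h + g' u x h"])
      (auto intro: polyfun.add simp: scaleR_add_right algebra_simps)
next
  case (mult_u f)
  then obtain f' where "polyfun f'" and "\<And>u x h. f u (x + h) h - f u x h = h *\<^sub>R f' u x h" by blast
  then show ?case
    by (intro exI[of _ "\<lambda>u x h. u *\<^sub>R f' u x h"])
      (auto intro: polyfun.intros simp: scaleR_diff_right[symmetric] mult.commute)
next
  case (mult_h f)
  then obtain f' where "polyfun f'" and "\<And>u x h. f u (x + h) h - f u x h = h *\<^sub>R f' u x h" by blast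
  then show ?case
    by (intro exI[of _ "\<lambda>u x h. h *\<^sub>R f' u x h"])
      (auto intro: polyfun.intros simp: scaleR_diff_right[symmetric])
next
  case (mult_x f)
  then obtain f' where f': "polyfun f'" "\<And>u x h. f u (x + h) h - f u x h = h *\<^sub>R f' u x h" by blast
  have "(x + h) *\<^sub>R f u (x + h) h - x *\<^sub>R f u x h = h *\<^sub>R (f u (x + h) h + x *\<^sub>R f' u x h)" for u x h
  proof -
    have "(x + h) *\<^sub>R f u (x + h) h - x *\<^sub>R f u x h = h *\<^sub>R f u (x + h) h + x *\<^sub>R (f u (x + h) h - f u x h)"
      by (simp add: algebra_simps)
    then show ?thesis by (simp only: f'(2)) (simp add: scaleR_add_right mult.commute)
  qed
  then show ?case using f'(1) mult_x.hyps
    by (intro exI[of _ "\<lambda>u x h. f u (x + h) h + x *\<^sub>R f' u x h"])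
      (auto intro: polyfun.intros polyfun_shift)
qed

text \<open>Supplies the start of the recursion: the constant interpolant at node \<open>x\<close>
  misses the value at \<open>u\<close> by a multiple of the single node distance, and the quotient
  is the first remainder polynomial.\<close>

lemma polyfun_difference_quotient:
  assumes "polyfun f"
  shows "\<exists>g. polyfun g \<and> (\<forall>u x h. f 0 x 0 - f 0 u 0 = (u - x) *\<^sub>R g u x h)"
  using assms
proof induction
  case (add f g)
  then obtain f' g' where "polyfun f'" "polyfun g'"
    and "\<And>u x h. f 0 x 0 - f 0 u 0 = (u - x) *\<^sub>R f' u x h" "\<And>u x h. g 0 x 0 - g 0 u 0 = (u - x) *\<^sub>R g' u x h"
    by metis
  then show ?case
    by (intro exI[of _ "\<lambda>u x h. f' u x h + g' u x h"])
      (auto intro: polyfun.add simp: scaleR_add_right algebra_simps)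
next
  case (mult_x f)
  then obtain f' where f': "polyfun f'" "\<And>u x h. f 0 x 0 - f 0 u 0 = (u - x) *\<^sub>R f' u x h" by metis
  have "x *\<^sub>R f 0 x 0 - u *\<^sub>R f 0 u 0 = (u - x) *\<^sub>R (u *\<^sub>R f' u x h - f 0 x 0)" for u x h
  proof -
    have "x *\<^sub>R f 0 x 0 - u *\<^sub>R f 0 u 0 = u *\<^sub>R (f 0 x 0 - f 0 u 0) - (u - x) *\<^sub>R f 0 x 0"
      by (simp add: algebra_simps)
    then show ?thesis unfolding f'(2)[of x u h] by (simp add: algebra_simps)
  qed
  then show ?case using f'(1) mult_x.hyps
    by (intro exI[of _ "\<lambda>u x h. u *\<^sub>R f' u x h - f 0 x 0"])
      (auto intro: polyfun.intros polyfun_diff polyfun_at_zero)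
qed (auto intro!: exI[of _ "\<lambda>u x h. 0"] intro: polyfun.const)

lemma polyfun_bounded:
  assumes "polyfun f"
  shows "\<exists>C. \<forall>u x h. \<bar>u\<bar> \<le> \<rho> \<longrightarrow> \<bar>x\<bar> \<le> \<rho> \<longrightarrow> \<bar>h\<bar> \<le> \<rho> \<longrightarrow> norm (f u x h) \<le> C"
  using assms
proof induction
  case (add f g)
  then obtain C C' where
    "\<And>u x h. \<bar>u\<bar> \<le> \<rho> \<Longrightarrow> \<bar>x\<bar> \<le> \<rho> \<Longrightarrow> \<bar>h\<bar> \<le> \<rho> \<Longrightarrow> norm (f u x h) \<le> C"
    "\<And>u x h. \<bar>u\<bar> \<le> \<rho> \<Longrightarrow> \<bar>x\<bar> \<le> \<rho> \<Longrightarrow> \<bar>h\<bar> \<le> \<rho> \<Longrightarrow> norm (g u x h) \<le> C'" by blast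
  then show ?case
    by (intro exI[of _ "C + C'"]) (auto intro!: norm_triangle_mono)
next
  case (mult_u f)
  then obtain C where "\<And>u x h. \<bar>u\<bar> \<le> \<rho> \<Longrightarrow> \<bar>x\<bar> \<le> \<rho> \<Longrightarrow> \<bar>h\<bar> \<le> \<rho> \<Longrightarrow> norm (f u x h) \<le> C"
    by blast
  then show ?case by (intro exI[of _ "\<bar>\<rho>\<bar> * C"]) (auto intro!: mult_mono)
next
  case (mult_x f)
  then obtain C where "\<And>u x h. \<bar>u\<bar> \<le> \<rho> \<Longrightarrow> \<bar>x\<bar> \<le> \<rho> \<Longrightarrow> \<bar>h\<bar> \<le> \<rho> \<Longrightarrow> norm (f u x h) \<le> C"
    by blast
  then show ?case by (intro exI[of _ "\<bar>\<rho>\<bar> * C"]) (auto intro!: mult_mono)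
next
  case (mult_h f)
  then obtain C where "\<And>u x h. \<bar>u\<bar> \<le> \<rho> \<Longrightarrow> \<bar>x\<bar> \<le> \<rho> \<Longrightarrow> \<bar>h\<bar> \<le> \<rho> \<Longrightarrow> norm (f u x h) \<le> C"
    by blast
  then show ?case by (intro exI[of _ "\<bar>\<rho>\<bar> * C"]) (auto intro!: mult_mono)
qed auto

lemma funpow_matrix_scaleR:
  fixes M A :: "real^'m::finite^'m"
  shows "((\<lambda>X. (c *\<^sub>R M) ** X) ^^ p) A = c ^ p *\<^sub>R ((\<lambda>X. M ** X) ^^ p) A"
  by (induction p) (simp_all add: mm.scaleR_left mm.scaleR_right mult.commute)

text \<open>For \<open>l = w / (K h)\<close> each of the \<open>p\<close> factors of the numerator
  absorbs one \<open>h\<close>, so no negative power of \<open>h\<close> survives. The factors for 0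
  and 1 are \<open>w / K\<close> and \<open>(w - K h) / K\<close>: up to constants, the distances to
  the first and to the last node.\<close>

lemma gbinomial_mult_power:
  fixes w h K :: real
  assumes "2 \<le> p" "K \<noteq> 0" "h \<noteq> 0"
  shows "((w / (K * h)) gchoose p) * h ^ p =
     w * (w - K * h) * ((\<Prod>i=2..<p. w / K - real i * h) / (K\<^sup>2 * fact p))"
proof -
  have "((w / (K * h)) gchoose p) * h ^ p = (\<Prod>i=0..<p. (w / (K * h) - real i) * h) / fact p"
    by (simp add: gbinomial_prod_rev prod.distrib)
  also have "(\<Prod>i=0..<p. (w / (K * h) - real i) * h) = (\<Prod>i=0..<p. w / K - real i * h)"
    using assms by (intro prod.cong) (auto simp: field_simps)
  also have "{0..<p} = {0, 1} \<union> {2..<p}" using assms(1) by auto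
  also have "(\<Prod>i\<in>{0, 1} \<union> {2..<p}. w / K - real i * h) =
      (w / K) * (w / K - h) * (\<Prod>i=2..<p. w / K - real i * h)"
    by (subst prod.union_disjoint) auto
  finally show ?thesis using assms by (simp add: field_simps power2_eq_square)
qed

text \<open>
  One step of the recursion raises the order: with \<open>a = s u + \<Pi> R\<close>, where \<open>\<Pi>\<close> is the product of the
  distances to the \<open>k + 1\<close> nodes, the linear part is Neville's scheme, and the nonlinear terms carry
  the factor \<open>l (l - 1) h\<^sup>2\<close>, which vanishes at the first and last node.
\<close>

lemma glerp_poly_step:
  fixes s :: "real \<Rightarrow> real^'m::finite^'m"
  assumes s: "polyfun (\<lambda>u x h. s u)" and R: "polyfun R"
    and a: "\<And>u x h. a u x h = s u + (\<Prod>i\<le>k. u - x - real i * h) *\<^sub>R R u x h"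
  obtains E R' where "polyfun E" "polyfun R'"
    "\<And>u x h. a u (x + h) h - a u x h = h *\<^sub>R E u x h"
    "\<And>u x h. h \<noteq> 0 \<Longrightarrow> glerp_poly N ((u - x) / (real (Suc k) * h)) (a u x h) (a u (x + h) h) =
       s u + (\<Prod>i\<le>Suc k. u - x - real i * h) *\<^sub>R R' u x h"
proof -
  obtain Q where Q: "polyfun Q" "\<And>u x h. R u (x + h) h - R u x h = h *\<^sub>R Q u x h"
    using polyfun_shift_quotient[OF R] by blast
  define K where "K = real (Suc k)"
  \<comment> \<open>\<open>P\<close> collects the nodes shared by the two neighbours; one product
    adds the first node, the other the last.\<close>
  define P where "P u x h = (\<Prod>i\<in>{1..k}. u - x - real i * h)" for u x h
  \<comment> \<open>Obtained from \<open>(w - K h) R(x + h) - w R(x)\<close> with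
    \<open>w = u - x\<close> by substituting \<open>R(x) = R(x + h) - h Q\<close> and dividing by
    \<open>h\<close>.\<close>
  define E where "E u x h = (u - x) *\<^sub>R Q u x h - K *\<^sub>R R u (x + h) h" for u x h
  \<comment> \<open>The \<open>p\<close> copies of the difference bring in \<open>P ^ p\<close>: one
    factor goes into the new node product, \<open>p - 1\<close> remain.\<close>
  define c where "c p u x h = P u x h ^ (p - 1) * ((\<Prod>i=2..<p. (u - x) / K - real i * h) / (K\<^sup>2 * fact p))"
    for p :: nat and u x h
  define R' where "R' u x h = (1 / K) *\<^sub>R Q u x h +
     (\<Sum>p=2..N. c p u x h *\<^sub>R (((\<lambda>X. E u x h ** a u x h ** X) ^^ p) (a u x h)))" for u x h
  have K: "K \<noteq> 0" by (simp add: K_def)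
  have a': "polyfun a"
    unfolding a[abs_def] by (intro polyfun_intros s R) auto
  have pP: "polyfun P" unfolding P_def by (intro polyfun_intros) auto
  have pE: "polyfun E" unfolding E_def by (intro polyfun_intros Q polyfun_shift R)
  have pc: "polyfun (c p)" for p
    unfolding c_def divide_inverse by (intro polyfun_intros pP) auto
  have pR': "polyfun R'"
    unfolding R'_def by (intro polyfun_intros pE a' pc Q) auto
  have P0: "(\<Prod>i\<le>k. u - x - real i * h) = (u - x) * P u x h" for u x h
  proof -
    have "{..k} = insert 0 {1..k}" by auto
    then show ?thesis by (simp add: P_def)
  qed
  have P1: "(\<Prod>i\<le>k. u - (x + h) - real i * h) = (u - x - K * h) * P u x h" for u x h
  proof -
    have "(\<Prod>i\<le>k. u - (x + h) - real i * h) = (\<Prod>i\<le>k. u - x - real (Suc i) * h)"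
      by (intro prod.cong) (auto simp: algebra_simps)
    also have "\<dots> = (\<Prod>i\<in>{1..Suc k}. u - x - real i * h)"
      using prod.shift_bounds_cl_Suc_ivl[of "\<lambda>i. u - x - real i * h" 0 k]
      by (simp add: atMost_atLeast0)
    finally show ?thesis by (simp add: P_def K_def mult.commute)
  qed
  have P2: "(\<Prod>i\<le>Suc k. u - x - real i * h) = (u - x) * (u - x - K * h) * P u x h" for u x h
    using P0[of u x h] by (simp add: K_def mult_ac)
  have d: "a u (x + h) h - a u x h = (h * P u x h) *\<^sub>R E u x h" for u x h
  proof -
    have R1: "R u x h = R u (x + h) h - h *\<^sub>R Q u x h" using Q(2)[of u x h] by (simp add: algebra_simps)
    show ?thesis
      unfolding a P1 unfolding P0 E_def R1 by (simp add: algebra_simps)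
  qed
  have step: "glerp_poly N ((u - x) / (K * h)) (a u x h) (a u (x + h) h) =
       s u + ((u - x) * (u - x - K * h) * P u x h) *\<^sub>R R' u x h" if h: "h \<noteq> 0" for u x h
  proof -
    define w where "w = u - x"
    \<comment> \<open>Neville's identity: the combination removes \<open>R\<close> and leaves its
      divided difference \<open>Q / K\<close> as the linear contribution to the new
      remainder.\<close>
    have lin: "a u x h + (w / (K * h)) *\<^sub>R (a u (x + h) h - a u x h) =
        s u + (w * (w - K * h) * P u x h) *\<^sub>R ((1 / K) *\<^sub>R Q u x h)"
    proof -
      have R1: "R u (x + h) h = R u x h + h *\<^sub>R Q u x h" using Q(2)[of u x h] by (simp add: algebra_simps)
      have "(w / (K * h)) *\<^sub>R (a u (x + h) h - a u x h) = (w * P u x h / K) *\<^sub>R E u x h"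
        using h by (simp add: d)
      also have "\<dots> = (w * P u x h * (w / K - h)) *\<^sub>R Q u x h - (w * P u x h) *\<^sub>R R u x h"
        using K unfolding E_def R1 w_def[symmetric]
        by (simp add: algebra_simps)
      also have "w * P u x h * (w / K - h) = (w * (w - K * h) * P u x h) * (1 / K)"
        using K by (simp add: field_simps)
      finally have e: "(w / (K * h)) *\<^sub>R (a u (x + h) h - a u x h) =
         (w * (w - K * h) * P u x h * (1 / K)) *\<^sub>R Q u x h - (w * P u x h) *\<^sub>R R u x h" .
      have "a u x h = s u + (w * P u x h) *\<^sub>R R u x h" by (simp add: a P0 w_def)
      then show ?thesis unfolding e by simp
    qed
    have T: "((w / (K * h)) gchoose p) *\<^sub>R (((\<lambda>X. (a u (x + h) h - a u x h) ** a u x h ** X) ^^ p) (a u x h)) =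
       (w * (w - K * h) * P u x h) *\<^sub>R (c p u x h *\<^sub>R (((\<lambda>X. E u x h ** a u x h ** X) ^^ p) (a u x h)))"
      if p: "p \<in> {2..N}" for p
    proof -
      have "((\<lambda>X. (a u (x + h) h - a u x h) ** a u x h ** X) ^^ p) (a u x h) =
         (h * P u x h) ^ p *\<^sub>R ((\<lambda>X. E u x h ** a u x h ** X) ^^ p) (a u x h)"
        unfolding d mm.scaleR_left[of "h * P u x h" "E u x h"] by (rule funpow_matrix_scaleR)
      moreover have "((w / (K * h)) gchoose p) * (h * P u x h) ^ p = w * (w - K * h) * P u x h * c p u x h"
      proof -
        have "P u x h ^ p = P u x h * P u x h ^ (p - 1)" using p by (cases p) auto
        moreover have "((w / (K * h)) gchoose p) * (h * P u x h) ^ p =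
            (((w / (K * h)) gchoose p) * h ^ p) * P u x h ^ p" by (simp add: power_mult_distrib)
        ultimately show ?thesis
          using p h K by (subst (asm) gbinomial_mult_power) (auto simp: c_def w_def)
      qed
      ultimately show ?thesis by simp
    qed
    show ?thesis
      unfolding glerp_poly_def w_def[symmetric] lin R'_def scaleR_add_right
      using T by (simp add: scaleR_sum_right add.assoc)
  qed
  show ?thesis
  proof (rule that[of "\<lambda>u x h. P u x h *\<^sub>R E u x h" R'])
    show "polyfun (\<lambda>u x h. P u x h *\<^sub>R E u x h)" by (intro polyfun_intros pP pE)
    show "polyfun R'" by fact
    show "a u (x + h) h - a u x h = h *\<^sub>R P u x h *\<^sub>R E u x h" for u x h by (simp add: d)
    show "glerp_poly N ((u - x) / (real (Suc k) * h)) (a u x h) (a u (x + h) h) =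
       s u + (\<Prod>i\<le>Suc k. u - x - real i * h) *\<^sub>R R' u x h" if "h \<noteq> 0" for u x h
      using step[OF that] unfolding P2 K_def .
  qed
qed

subsection \<open>Error terms\<close>

definition bigo :: "'p filter \<Rightarrow> ('p \<Rightarrow> real) \<Rightarrow> ('p \<Rightarrow> 'v::real_normed_vector) \<Rightarrow> bool" where
  "bigo F w f \<longleftrightarrow> (\<exists>C. \<forall>\<^sub>F p in F. norm (f p) \<le> C * \<bar>w p\<bar>)"

lemma bigoE:
  assumes "bigo F w f"
  obtains C where "C \<ge> 0" "\<forall>\<^sub>F p in F. norm (f p) \<le> C * \<bar>w p\<bar>"
proof -
  obtain C where C: "\<forall>\<^sub>F p in F. norm (f p) \<le> C * \<bar>w p\<bar>" using assms by (auto simp: bigo_def)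
  have "\<forall>\<^sub>F p in F. norm (f p) \<le> \<bar>C\<bar> * \<bar>w p\<bar>"
    using C by eventually_elim (meson abs_ge_self abs_ge_zero mult_right_mono order_trans)
  then show ?thesis using that[of "\<bar>C\<bar>"] by simp
qed

lemma bigoI: "\<forall>\<^sub>F p in F. norm (f p) \<le> C * \<bar>w p\<bar> \<Longrightarrow> bigo F w f"
  by (auto simp: bigo_def)

lemma bigo_mono_weight:
  assumes "bigo F w f" "\<forall>\<^sub>F p in F. \<bar>w p\<bar> \<le> K * \<bar>w' p\<bar>"
  shows "bigo F w' f"
proof -
  obtain C where C: "C \<ge> 0" "\<forall>\<^sub>F p in F. norm (f p) \<le> C * \<bar>w p\<bar>" by (rule bigoE[OF assms(1)])
  from C(2) assms(2) have "\<forall>\<^sub>F p in F. norm (f p) \<le> (C * K) * \<bar>w' p\<bar>"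
    by eventually_elim (metis C(1) mult.assoc mult_left_mono order_trans)
  then show ?thesis by (rule bigoI)
qed

lemma bigo_cong:
  assumes "\<forall>\<^sub>F p in F. f p = g p" "bigo F w f"
  shows "bigo F w g"
proof -
  obtain C where "\<forall>\<^sub>F p in F. norm (f p) \<le> C * \<bar>w p\<bar>" using assms by (auto simp: bigo_def)
  with assms(1) have "\<forall>\<^sub>F p in F. norm (g p) \<le> C * \<bar>w p\<bar>" by eventually_elim simp
  then show ?thesis by (rule bigoI)
qed

lemma bigo_const: "bigo F (\<lambda>_. 1) (\<lambda>_. c)"
  by (rule bigoI[where C = "norm c"]) simp

lemma bigo_zero: "bigo F w (\<lambda>_. 0)"
  by (rule bigoI[where C = 0]) simp

lemma bigo_add:
  assumes "bigo F w f" "bigo F w g"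
  shows "bigo F w (\<lambda>p. f p + g p)"
proof -
  obtain C where "\<forall>\<^sub>F p in F. norm (f p) \<le> C * \<bar>w p\<bar>" using assms by (auto simp: bigo_def)
  moreover obtain C' where "\<forall>\<^sub>F p in F. norm (g p) \<le> C' * \<bar>w p\<bar>" using assms by (auto simp: bigo_def)
  ultimately have "\<forall>\<^sub>F p in F. norm (f p + g p) \<le> (C + C') * \<bar>w p\<bar>"
    by eventually_elim (auto simp: distrib_right intro: norm_triangle_mono)
  then show ?thesis by (rule bigoI)
qed

lemma bigo_linear:
  assumes "bounded_linear L" "bigo F w f"
  shows "bigo F w (\<lambda>p. L (f p))"
proof -
  obtain C where C: "\<forall>\<^sub>F p in F. norm (f p) \<le> C * \<bar>w p\<bar>" using assms by (auto simp: bigo_def)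
  obtain K where K: "K \<ge> 0" "\<And>x. norm (L x) \<le> norm x * K"
    using bounded_linear.nonneg_bounded[OF assms(1)] by blast
  from C have "\<forall>\<^sub>F p in F. norm (L (f p)) \<le> (C * K) * \<bar>w p\<bar>"
  proof eventually_elim
    case (elim p)
    have "norm (L (f p)) \<le> norm (f p) * K" by (rule K)
    also have "\<dots> \<le> (C * \<bar>w p\<bar>) * K" by (intro mult_right_mono elim K)
    finally show ?case by (simp add: mult_ac)
  qed
  then show ?thesis by (rule bigoI)
qed

lemma bigo_diff:
  assumes "bigo F w f" "bigo F w g"
  shows "bigo F w (\<lambda>p. f p - g p)"
  using bigo_add[OF assms(1) bigo_linear[OF bounded_linear_minus[OF bounded_linear_ident] assms(2)]]
  by simp

lemma bigo_bilinear:
  assumes "bounded_bilinear B" "bigo F w f" "bigo F w' g"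
  shows "bigo F (\<lambda>p. w p * w' p) (\<lambda>p. B (f p) (g p))"
proof -
  obtain C where C: "C \<ge> 0" "\<forall>\<^sub>F p in F. norm (f p) \<le> C * \<bar>w p\<bar>" by (rule bigoE[OF assms(2)])
  obtain C' where C': "C' \<ge> 0" "\<forall>\<^sub>F p in F. norm (g p) \<le> C' * \<bar>w' p\<bar>" by (rule bigoE[OF assms(3)])
  obtain K where K: "K \<ge> 0" "\<And>x y. norm (B x y) \<le> norm x * norm y * K"
    using bounded_bilinear.nonneg_bounded[OF assms(1)] by blast
  from C(2) C'(2) have "\<forall>\<^sub>F p in F. norm (B (f p) (g p)) \<le> (C * C' * K) * \<bar>w p * w' p\<bar>"
  proof eventually_elim
    case (elim p)
    have "norm (B (f p) (g p)) \<le> norm (f p) * norm (g p) * K" by (rule K)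
    also have "\<dots> \<le> ((C * \<bar>w p\<bar>) * (C' * \<bar>w' p\<bar>)) * K"
      using elim C(1) C'(1) K(1) by (intro mult_right_mono mult_mono) auto
    finally show ?case by (simp add: mult_ac abs_mult)
  qed
  then show ?thesis by (rule bigoI)
qed

lemma bigo_prod:
  fixes f :: "'i \<Rightarrow> 'p \<Rightarrow> real"
  assumes "finite A" "\<And>i. i \<in> A \<Longrightarrow> bigo F w (f i)"
  shows "bigo F (\<lambda>p. w p ^ card A) (\<lambda>p. \<Prod>i\<in>A. f i p)"
  using assms
proof (induction A rule: finite_induct)
  case empty
  show ?case by (simp add: bigo_const)
next
  case (insert i A)
  then show ?case
    using bigo_bilinear[OF bounded_bilinear_mult, of F w "f i" "\<lambda>p. w p ^ card A"] by simp
qed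

text \<open>Boundedness of both sides is included so that the relation is preserved by bilinear
  maps, hence by polynomial expressions in matrices.\<close>

definition approx :: "'p filter \<Rightarrow> ('p \<Rightarrow> real) \<Rightarrow> ('p \<Rightarrow> 'v::real_normed_vector) \<Rightarrow> ('p \<Rightarrow> 'v) \<Rightarrow> bool" where
  "approx F w f g \<longleftrightarrow> bigo F (\<lambda>_. 1) f \<and> bigo F (\<lambda>_. 1) g \<and> bigo F w (\<lambda>p. f p - g p)"

lemma approx_refl: "bigo F (\<lambda>_. 1) f \<Longrightarrow> approx F w f f"
  by (simp add: approx_def bigo_zero)

lemma approx_trans:
  assumes "approx F w f g" "approx F w g k"
  shows "approx F w f k"
  using assms bigo_add[of F w "\<lambda>p. f p - g p" "\<lambda>p. g p - k p"] by (auto simp: approx_def)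

lemma approxI:
  assumes "bigo F (\<lambda>_. 1) g" "bigo F w (\<lambda>p. f p - g p)" "bigo F (\<lambda>_. 1) w"
  shows "approx F w f g"
proof -
  obtain K where "\<forall>\<^sub>F p in F. norm (w p) \<le> K * \<bar>1\<bar>" using assms(3) by (auto simp: bigo_def)
  then have "\<forall>\<^sub>F p in F. \<bar>w p\<bar> \<le> K * \<bar>1\<bar>" by simp
  from bigo_mono_weight[OF assms(2) this] have "bigo F (\<lambda>_. 1) (\<lambda>p. f p - g p)" by simp
  from bigo_add[OF this assms(1)] show ?thesis using assms by (simp add: approx_def)
qed

lemma approx_cong_left:
  assumes "approx F w f g" "\<forall>\<^sub>F p in F. f p = f' p"
  shows "approx F w f' g"
proof -
  have "bigo F (\<lambda>_. 1) f'" using assms bigo_cong by (auto simp: approx_def)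
  moreover have "\<forall>\<^sub>F p in F. f p - g p = f' p - g p" using assms(2) by eventually_elim simp
  then have "bigo F w (\<lambda>p. f' p - g p)" by (rule bigo_cong) (use assms(1) in \<open>simp add: approx_def\<close>)
  ultimately show ?thesis using assms(1) by (simp add: approx_def)
qed

lemma approx_cong_right:
  assumes "approx F w f g" "\<forall>\<^sub>F p in F. g p = g' p"
  shows "approx F w f g'"
proof -
  have "bigo F (\<lambda>_. 1) g'" using assms bigo_cong by (auto simp: approx_def)
  moreover have "\<forall>\<^sub>F p in F. f p - g p = f p - g' p" using assms(2) by eventually_elim simp
  then have "bigo F w (\<lambda>p. f p - g' p)" by (rule bigo_cong) (use assms(1) in \<open>simp add: approx_def\<close>)
  ultimately show ?thesis using assms(1) by (simp add: approx_def)
qed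

lemma approx_add:
  assumes "approx F w f f'" "approx F w g g'"
  shows "approx F w (\<lambda>p. f p + g p) (\<lambda>p. f' p + g' p)"
  using assms bigo_add[of F w "\<lambda>p. f p - f' p" "\<lambda>p. g p - g' p"]
  by (auto simp: approx_def bigo_add algebra_simps)

lemma approx_linear:
  assumes "bounded_linear L" "approx F w f f'"
  shows "approx F w (\<lambda>p. L (f p)) (\<lambda>p. L (f' p))"
  using assms bigo_linear[OF assms(1), of F w "\<lambda>p. f p - f' p"]
  by (simp add: approx_def bigo_linear bounded_linear.linear[THEN linear_diff])

lemma approx_diff:
  assumes "approx F w f f'" "approx F w g g'"
  shows "approx F w (\<lambda>p. f p - g p) (\<lambda>p. f' p - g' p)"
  using approx_add[OF assms(1) approx_linear[OF bounded_linear_minus[OF bounded_linear_ident] assms(2)]]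
  by simp

lemma approx_bilinear:
  assumes B: "bounded_bilinear B" and f: "approx F w f f'" and g: "approx F w g g'"
  shows "approx F w (\<lambda>p. B (f p) (g p)) (\<lambda>p. B (f' p) (g' p))"
proof -
  interpret bounded_bilinear B by fact
  have "bigo F w (\<lambda>p. B (f p - f' p) (g p))"
    using bigo_bilinear[OF B, of F w "\<lambda>p. f p - f' p" "\<lambda>_. 1" g] f g by (simp add: approx_def)
  moreover have "bigo F w (\<lambda>p. B (f' p) (g p - g' p))"
    using bigo_bilinear[OF B, of F "\<lambda>_. 1" f' w "\<lambda>p. g p - g' p"] f g by (simp add: approx_def)
  ultimately have "bigo F w (\<lambda>p. B (f p) (g p) - B (f' p) (g' p))"
    using bigo_add by (fastforce simp: diff_left diff_right)
  then show ?thesis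
    using bigo_bilinear[OF B, of F "\<lambda>_. 1" f "\<lambda>_. 1" g] bigo_bilinear[OF B, of F "\<lambda>_. 1" f' "\<lambda>_. 1" g'] f g
    by (simp add: approx_def)
qed

lemmas approx_scaleR = approx_bilinear[OF bounded_bilinear_scaleR]
lemmas approx_matrix_mult = approx_bilinear[OF bounded_bilinear_matrix_mult]

lemma approx_sum:
  "finite A \<Longrightarrow> (\<And>i. i \<in> A \<Longrightarrow> approx F w (f i) (g i)) \<Longrightarrow>
    approx F w (\<lambda>p. \<Sum>i\<in>A. f i p) (\<lambda>p. \<Sum>i\<in>A. g i p)"
proof (induction A rule: finite_induct)
  case empty
  show ?case by (simp add: approx_refl bigo_zero)
qed (auto intro: approx_add)

lemma approx_funpow:
  fixes f f' g g' :: "'p \<Rightarrow> real^'m::finite^'m"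
  assumes "approx F w f f'" "approx F w g g'"
  shows "approx F w (\<lambda>p. ((\<lambda>X. f p ** X) ^^ n) (g p)) (\<lambda>p. ((\<lambda>X. f' p ** X) ^^ n) (g' p))"
  using assms by (induction n) (auto intro: approx_matrix_mult)

lemma bigo_gbinomial:
  fixes l :: "'p \<Rightarrow> real"
  assumes "bigo F (\<lambda>_. 1) l"
  shows "bigo F (\<lambda>_. 1) (\<lambda>p. l p gchoose k)"
proof -
  have "bigo F (\<lambda>p. 1 ^ card {0..<k}) (\<lambda>p. \<Prod>i=0..<k. l p - real i)"
    by (intro bigo_prod bigo_diff assms bigo_const) auto
  from bigo_linear[OF bounded_linear_mult_left this, of "1 / fact k"]
  show ?thesis by (simp add: gbinomial_prod_rev)
qed

lemma approx_glerp_poly: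
  assumes "bigo F (\<lambda>_. 1) l" "approx F w A A'" "approx F w B B'"
  shows "approx F w (\<lambda>p. glerp_poly N (l p) (A p) (B p)) (\<lambda>p. glerp_poly N (l p) (A' p) (B' p))"
  unfolding glerp_poly_def
  by (intro approx_add approx_scaleR approx_diff approx_sum approx_funpow approx_matrix_mult assms
      approx_refl bigo_gbinomial) auto

subsection \<open>Taylor expansion of the curve\<close>

text \<open>Induction on \<open>k\<close>: the expansion of the derivative \<open>D t 1\<close> is
  integrated, with the mean value inequality in place of an integral. A \<open>C^k\<close> curve is
  matched by a polynomial of degree below \<open>k\<close> with error of order \<open>k\<close>, so
  the base case is mere boundedness on a compact interval.\<close>

lemma Ck_on_taylor:
  fixes f :: "real \<Rightarrow> 'v::real_normed_vector"
  assumes "Ck_on k S f" "{a..b} \<subseteq> S"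
  shows "\<exists>c C. \<forall>t\<in>{a..b}. norm (f t - (\<Sum>i<k. (t - a) ^ i *\<^sub>R c i)) \<le> C * (t - a) ^ k"
  using assms(1)
proof (induction k arbitrary: f)
  case 0
  then have "continuous_on {a..b} f" using assms(2) continuous_on_subset by auto
  then have "bounded (f ` {a..b})" by (intro compact_imp_bounded compact_continuous_image) auto
  then show ?case by (auto simp: bounded_iff)
next
  case (Suc k)
  then obtain D where D: "\<And>x. x \<in> S \<Longrightarrow> (f has_derivative D x) (at x within S)"
    and "Ck_on k S (\<lambda>x. D x 1)"
    using Ck_on.simps(2)[of k S f] by blast
  with Suc.IH obtain c C where C: "\<And>t. t \<in> {a..b} \<Longrightarrow>
     norm (D t 1 - (\<Sum>i<k. (t - a) ^ i *\<^sub>R c i)) \<le> C * (t - a) ^ k"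
    by blast
  define c' where "c' i = (case i of 0 \<Rightarrow> f a | Suc i \<Rightarrow> c i /\<^sub>R real (Suc i))" for i
  define F where "F t = f t - (\<Sum>i<k. ((t - a) ^ Suc i / real (Suc i)) *\<^sub>R c i)" for t
  have "norm (f t - (\<Sum>i<Suc k. (t - a) ^ i *\<^sub>R c' i)) \<le> \<bar>C\<bar> * (t - a) ^ Suc k"
    if t: "t \<in> {a..b}" for t
  proof -
    have der: "(F has_vector_derivative (D x 1 - (\<Sum>i<k. (x - a) ^ i *\<^sub>R c i))) (at x within {a..t})"
      if x: "x \<in> {a..t}" for x
    proof -
      have xS: "x \<in> S" "{a..t} \<subseteq> S" using x t assms(2) by auto
      have Dx: "(f has_derivative D x) (at x within {a..t})"
        using D[OF xS(1)] xS(2) by (rule has_derivative_subset)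
      have "D x s = s *\<^sub>R D x 1" for s
        using linear_scale[OF has_derivative_linear[OF Dx], of s 1] by simp
      then have "D x = (\<lambda>s. s *\<^sub>R D x 1)" by (rule ext)
      from subst[OF this, where P = "\<lambda>L. (f has_derivative L) (at x within {a..t})", OF Dx]
      have "(f has_vector_derivative D x 1) (at x within {a..t})"
        unfolding has_vector_derivative_def .
      moreover have "((\<lambda>x. ((x - a) ^ Suc i / real (Suc i)) *\<^sub>R c i) has_vector_derivative
          (x - a) ^ i *\<^sub>R c i) (at x within {a..t})" for i
      proof -
        have "((\<lambda>x. (x - a) ^ Suc i / real (Suc i)) has_real_derivative (x - a) ^ i) (at x within {a..t})"
          by (auto intro!: derivative_eq_intros simp del: power_Suc of_nat_Suc) 
        from has_vector_derivative_scaleR[OF this has_vector_derivative_const[of "c i"]]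
        show ?thesis by simp
      qed
      ultimately show ?thesis unfolding F_def
        by (intro has_vector_derivative_diff has_vector_derivative_sum)
    qed
    have "norm (F t - F a) \<le> (\<bar>C\<bar> * (t - a) ^ k) * norm (t - a)"
    proof (rule differentiable_bound[of "{a..t}"])
      show "onorm (\<lambda>s. s *\<^sub>R (D x 1 - (\<Sum>i<k. (x - a) ^ i *\<^sub>R c i))) \<le> \<bar>C\<bar> * (t - a) ^ k"
        if x: "x \<in> {a..t}" for x
      proof (rule onorm_le)
        fix s
        have "norm (D x 1 - (\<Sum>i<k. (x - a) ^ i *\<^sub>R c i)) \<le> C * (x - a) ^ k"
          using x t by (intro C) auto
        also have "\<dots> \<le> \<bar>C\<bar> * (t - a) ^ k"
          using x by (intro mult_mono power_mono) auto
        finally show "norm (s *\<^sub>R (D x 1 - (\<Sum>i<k. (x - a) ^ i *\<^sub>R c i))) \<le> \<bar>C\<bar> * (t - a) ^ k * norm s"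
          by (simp add: mult.commute mult_left_mono)
      qed
    qed (use der t in \<open>auto simp: has_vector_derivative_def\<close>)
    moreover have "F a = f a" by (simp add: F_def)
    moreover have "F t - f a = f t - (\<Sum>i<Suc k. (t - a) ^ i *\<^sub>R c' i)"
      unfolding sum.lessThan_Suc_shift by (simp add: F_def c'_def divide_inverse)
    ultimately show ?thesis using t by (simp add: mult_ac)
  qed
  then show ?case by blast
qed

text \<open>Unlike for \<open>at_right 0\<close>, what holds eventually here also holds at 0, which
  occurs as the offset of the first node and of \<open>t = t0\<close>.\<close>

abbreviation right_nhds0 :: "real filter" where
  "right_nhds0 \<equiv> inf (nhds 0) (principal {0..})"

lemma eventually_right_nhds0:
  "eventually P right_nhds0 \<longleftrightarrow> (\<exists>d>0. \<forall>u. 0 \<le> u \<longrightarrow> u < d \<longrightarrow> P u)"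
  by (auto simp: eventually_inf_principal eventually_nhds_metric dist_real_def)

lemma bigo_power_right_nhds0: "bigo right_nhds0 (\<lambda>_. 1) (\<lambda>u. u ^ k)"
proof (rule bigoI[where C = 1])
  show "\<forall>\<^sub>F u in right_nhds0. norm (u ^ k) \<le> 1 * \<bar>1\<bar>"
    unfolding eventually_right_nhds0 by (intro exI[of _ 1]) (auto intro: power_le_one)
qed

lemma bigo_power_weight:
  assumes "bigo right_nhds0 (\<lambda>u. u ^ j) f" "i \<le> j"
  shows "bigo right_nhds0 (\<lambda>u. u ^ i) f"
proof (rule bigo_mono_weight[OF assms(1), where K = 1])
  show "\<forall>\<^sub>F u in right_nhds0. \<bar>u ^ j\<bar> \<le> 1 * \<bar>u ^ i\<bar>"
    unfolding eventually_right_nhds0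
    using assms(2) by (intro exI[of _ 1]) (auto intro: power_decreasing)
qed

lemma bounded_linear_transpose:
  "bounded_linear (transpose :: real^'a::finite^'b::finite \<Rightarrow> real^'b^'a)"
  unfolding linear_conv_bounded_linear[symmetric]
  by (auto intro!: linearI simp: transpose_def vec_eq_iff)

lemma bigo_polyfun_right_nhds0:
  assumes "polyfun f"
  shows "bigo right_nhds0 (\<lambda>_. 1) (\<lambda>u. f 0 u 0)"
proof -
  obtain C where C: "\<And>u x h. \<bar>u\<bar> \<le> 1 \<Longrightarrow> \<bar>x\<bar> \<le> 1 \<Longrightarrow> \<bar>h\<bar> \<le> 1 \<Longrightarrow> norm (f u x h) \<le> C"
    using polyfun_bounded[OF assms, of 1] by blast
  show ?thesis
  proof (rule bigoI[where C = C])
    show "\<forall>\<^sub>F u in right_nhds0. norm (f 0 u 0) \<le> C * \<bar>1\<bar>"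
      unfolding eventually_right_nhds0 by (intro exI[of _ 1]) (auto intro: C)
  qed
qed

section \<open>Projections expressed in the affine chart\<close>

lemma norm_stiefel_le:
  fixes Y :: "real^'r::finite^'m::finite"
  assumes "Y \<in> stiefel"
  shows "norm Y \<le> real (CARD('m) * CARD('r))"
  using norm_matrix_le[of Y 1] norm_stiefel_mult[OF assms] by simp

text \<open>The columns of \<open>B = Y0 + X\<close> form a basis of \<open>S\<close> with Gram
  matrix \<open>1 + X^T X\<close>, as \<open>X\<close> is tangent at \<open>Y0\<close>; the
  projection is therefore \<open>B (B^T B)^-1 B^T\<close>. \<open>Q\<close> is this inverse Gram
  matrix, written through orthonormal representatives so that its boundedness is visible.\<close>

lemma projection_of_chart:
  fixes Y0 :: "real^'r::finite^'m::finite"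
  assumes Y0: "Y0 \<in> stiefel" and S: "S \<in> gr_chart_dom Y0"
  defines "X \<equiv> gr_chart Y0 S" and "Y \<equiv> gr_rep S :: real^'r^'m"
  defines "Q \<equiv> (transpose Y0 ** Y) ** transpose (transpose Y0 ** Y)"
  shows "Q ** (mat 1 + transpose X ** X) = mat 1"
    "Y ** transpose Y = (Y0 + X) ** Q ** transpose (Y0 + X)"
    "Y \<in> stiefel"
proof -
  define A where "A = transpose Y0 ** Y"
  define G where "G = matrix_inv A"
  have inv: "invertible A" and "S \<in> grassmannian TYPE('r)"
    using S by (simp_all add: gr_chart_dom_def A_def Y_def)
  then show Y: "Y \<in> stiefel" using grassmannian_rep gr_rep unfolding Y_def by blast
  have G: "A ** G = mat 1" "G ** A = mat 1" using matrix_inv[OF inv] by (simp_all add: G_def)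
  have X: "Y0 + X = Y ** G" by (simp add: X_def gr_chart_def Let_def Y_def G_def A_def)
  have "transpose Y0 ** (Y0 + X) = mat 1" by (simp add: X matrix_mul_assoc A_def[symmetric] G)
  then have YX: "transpose Y0 ** X = 0" using Y0 by (simp add: mm.add_right stiefel_def)
  then have "transpose (transpose Y0 ** X) = 0" by (simp add: transpose_def vec_eq_iff)
  then have XY: "transpose X ** Y0 = 0" by (simp add: matrix_transpose_mul)
  have tr: "transpose (Y0 + X) = transpose Y0 + transpose X"
    by (simp add: transpose_def vec_eq_iff)
  have "transpose (Y0 + X) ** (Y0 + X) = mat 1 + transpose X ** X"
    unfolding tr using Y0 YX XY by (simp add: mm.add_left mm.add_right stiefel_def)
  moreover have "transpose (Y0 + X) ** (Y0 + X) = transpose G ** (transpose Y ** Y) ** G"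
    unfolding X by (simp add: matrix_transpose_mul matrix_mul_assoc)
  ultimately have M: "mat 1 + transpose X ** X = transpose G ** G"
    using Y by (simp add: stiefel_def)
  have tG: "transpose A ** transpose G = mat 1" "transpose G ** transpose A = mat 1"
    using G by (metis matrix_transpose_mul transpose_mat)+
  have "Q ** (transpose G ** G) = A ** (transpose A ** transpose G) ** G"
    by (simp add: Q_def A_def[symmetric] matrix_mul_assoc)
  then show "Q ** (mat 1 + transpose X ** X) = mat 1" by (simp add: M tG G)
  have "(Y0 + X) ** Q ** transpose (Y0 + X) =
      Y ** (G ** A) ** (transpose A ** transpose G) ** transpose Y"
    unfolding X Q_def A_def[symmetric] by (simp add: matrix_transpose_mul matrix_mul_assoc)
  then show "Y ** transpose Y = (Y0 + X) ** Q ** transpose (Y0 + X)" by (simp add: G tG)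
qed

text \<open>A finite geometric sum with exact remainder, so no convergence is involved: the inverse
  \<open>Q\<close> is given, and bounds on \<open>Q\<close> and \<open>Z\<close> yield the order of
  the remainder.\<close>

lemma neumann_remainder:
  fixes Q Z :: "real^'r::finite^'r"
  assumes "Q ** (mat 1 - Z) = mat 1"
  shows "Q - (\<Sum>i<N. ((\<lambda>W. Z ** W) ^^ i) (mat 1)) = Q ** ((\<lambda>W. Z ** W) ^^ N) (mat 1)"
proof (induction N)
  case (Suc N)
  define W where "W = ((\<lambda>W. Z ** W) ^^ N) (mat 1)"
  have "Q = mat 1 + Q ** Z" using assms by (simp add: mm.diff_right algebra_simps)
  then have "Q ** W = W + Q ** Z ** W" by (metis matrix_mul_lid mm.add_left)
  then show ?case using Suc by (simp add: W_def[symmetric] matrix_mul_assoc algebra_simps)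
qed simp

lemma grassmannian_colspan:
  fixes Y :: "real^'r::finite^'m::finite"
  assumes "Y \<in> stiefel"
  shows "colspan Y \<in> grassmannian TYPE('r)"
proof -
  have "inj ((*v) Y)"
    using assms unfolding matrix_left_invertible_injective[symmetric] stiefel_def by auto
  then have "dim (columns Y) = CARD('r)"
    using full_rank_injective[of Y] by (simp add: column_rank_def)
  then show ?thesis by (simp add: grassmannian_def colspan_def)
qed

text \<open>For any orthonormal representative \<open>Y\<close> the condition reads
  \<open>det (transpose Y0 ** Y) \<noteq> 0\<close>, because the chosen representative differs from
  \<open>Y\<close> by an invertible right factor. Openness is then continuity of the
  determinant.\<close>

lemma openin_gr_chart_dom:
  fixes Y0 :: "real^'r::finite^'m::finite"
  shows "openin (gr_topology TYPE('r)) (gr_chart_dom Y0)"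
proof -
  have "invertible (transpose Y0 ** (gr_rep (colspan Y) :: real^'r^'m)) \<longleftrightarrow> det (transpose Y0 ** Y) \<noteq> 0"
    if Y: "Y \<in> stiefel" for Y :: "real^'r^'m"
  proof -
    define Z where "Z = (gr_rep (colspan Y) :: real^'r^'m)"
    have Z: "Z \<in> stiefel" "colspan Z = colspan Y" using gr_rep[OF Y refl] by (simp_all add: Z_def)
    have ZY: "Z ** transpose Z ** Y = Y" using Z by (intro stiefel_proj_mult) auto
    have "transpose (transpose Z ** Y) ** (transpose Z ** Y) = transpose Y ** (Z ** transpose Z ** Y)"
      by (simp add: matrix_transpose_mul matrix_mul_assoc)
    then have "transpose (transpose Z ** Y) ** (transpose Z ** Y) = mat 1"
      using Y by (simp add: ZY stiefel_def)
    then have "invertible (transpose Z ** Y)" by (auto simp: invertible_left_inverse)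
    then have "det (transpose Z ** Y) \<noteq> 0" by (simp add: invertible_det_nz)
    moreover have "transpose Y0 ** Y = (transpose Y0 ** Z) ** (transpose Z ** Y)"
      by (metis ZY matrix_mul_assoc)
    then have "det (transpose Y0 ** Y) = det (transpose Y0 ** Z) * det (transpose Z ** Y)"
      by (simp add: det_mul)
    ultimately show ?thesis by (simp add: Z_def[symmetric] invertible_det_nz)
  qed
  then have eq: "{Y \<in> (stiefel :: (real^'r^'m) set). colspan Y \<in> gr_chart_dom Y0} =
      stiefel \<inter> (\<lambda>Y. det (transpose Y0 ** Y)) -` (- {0})"
    by (auto simp: gr_chart_dom_def grassmannian_colspan)
  have "continuous_on UNIV (\<lambda>Y :: real^'r^'m. det (transpose Y0 ** Y))"
    unfolding det_def matrix_matrix_mult_def by (intro continuous_intros)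
  then have "openin (top_of_set stiefel) (stiefel \<inter> (\<lambda>Y. det (transpose Y0 ** Y)) -` (- {0}))"
    by (intro continuous_openin_preimage_gen) (auto elim: continuous_on_subset)
  then show ?thesis
    unfolding openin_gr_topology eq by (auto simp: gr_chart_dom_def)
qed

text \<open>Differentiability is given in charts, while the recursion is studied in matrices. In the
  chart centred at \<open>\<gamma> t0\<close> the curve has a Taylor polynomial, and the projection
  is a rational function of the chart value; replacing its inverse factor by a truncated Neumann
  series leaves a polynomial up to order \<open>k\<close>.\<close>

lemma gr_refl_curve_jet:
  fixes \<gamma> :: "real \<Rightarrow> (real^'m::finite) set"
  assumes \<gamma>: "Ck_into_gr TYPE('r::finite) k {a..b} \<gamma>" and t0: "t0 \<in> {a..<b}" and k: "0 < k"
  obtains s :: "real \<Rightarrow> real \<Rightarrow> real \<Rightarrow> real^'m^'m" where "polyfun s"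
    "approx right_nhds0 (\<lambda>u. u ^ k) (\<lambda>u. gr_refl TYPE('r) (\<gamma> (t0 + u))) (\<lambda>u. s 0 u 0)"
    "\<forall>\<^sub>F u in right_nhds0. \<gamma> (t0 + u) \<in> grassmannian TYPE('r)"
proof -
  have cont: "continuous_map (top_of_set {a..b}) (gr_topology TYPE('r)) \<gamma>"
    and Ck: "\<And>Y0 :: real^'r^'m. Y0 \<in> stiefel \<Longrightarrow>
       Ck_on k {x \<in> {a..b}. \<gamma> x \<in> gr_chart_dom Y0} (\<lambda>x. gr_chart Y0 (\<gamma> x))"
    using \<gamma> by (auto simp: Ck_into_gr_def)
  have "topspace (gr_topology TYPE('r)) \<subseteq> (grassmannian TYPE('r) :: (real^'m) set set)"
    using openin_topspace[of "gr_topology TYPE('r) :: (real^'m) set topology"]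
    unfolding openin_gr_topology by blast
  moreover have "\<gamma> t0 \<in> topspace (gr_topology TYPE('r))"
    using continuous_map_image_subset_topspace[OF cont] t0 by auto
  ultimately have g0: "\<gamma> t0 \<in> grassmannian TYPE('r)" by blast
  define Y0 where "Y0 = (gr_rep (\<gamma> t0) :: real^'r^'m)"
  have Y0: "Y0 \<in> stiefel" using grassmannian_rep[OF g0] gr_rep unfolding Y0_def by blast
  then have Y01: "transpose Y0 ** Y0 = mat 1" by (simp add: stiefel_def)
  have inv1: "matrix_inv (mat 1 :: real^'r^'r) = mat 1"
    using matrix_inv[of "mat 1 :: real^'r^'r"] by (auto simp: invertible_def)
  have dom0: "\<gamma> t0 \<in> gr_chart_dom Y0"
    using g0 Y01 by (auto simp: gr_chart_dom_def Y0_def[symmetric] invertible_def)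
  have X0: "gr_chart Y0 (\<gamma> t0) = 0"
    by (simp add: gr_chart_def Y0_def[symmetric] Y01 inv1)
  define N where "N = {x \<in> {a..b}. \<gamma> x \<in> gr_chart_dom Y0}"
  have "openin (top_of_set {a..b}) N"
    using openin_continuous_map_preimage[OF cont openin_gr_chart_dom[of Y0]] by (simp add: N_def)
  moreover have "t0 \<in> N" using t0 dom0 by (simp add: N_def)
  ultimately obtain e where e: "e > 0" "ball t0 e \<inter> {a..b} \<subseteq> N"
    unfolding openin_contains_ball by blast
  define d where "d = min (e / 2) (b - t0)"
  have d: "d > 0" using e t0 by (simp add: d_def)
  have sub: "{t0..t0 + d} \<subseteq> N"
  proof
    fix t assume "t \<in> {t0..t0 + d}"
    then have "t \<in> ball t0 e \<inter> {a..b}" using e(1) t0 by (auto simp: d_def dist_real_def min_def split: if_splits)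
    then show "t \<in> N" using e(2) by blast
  qed
  define X where "X u = gr_chart Y0 (\<gamma> (t0 + u))" for u
  define Y where "Y u = (gr_rep (\<gamma> (t0 + u)) :: real^'r^'m)" for u
  define Q where "Q u = (transpose Y0 ** Y u) ** transpose (transpose Y0 ** Y u)" for u
  have evd: "\<forall>\<^sub>F u in right_nhds0. \<gamma> (t0 + u) \<in> gr_chart_dom Y0"
    unfolding eventually_right_nhds0
  proof (intro exI[of _ d] conjI allI impI d)
    fix u :: real assume "0 \<le> u" "u < d"
    then have "t0 + u \<in> {t0..t0 + d}" by simp
    then have "t0 + u \<in> N" using sub by blast
    then show "\<gamma> (t0 + u) \<in> gr_chart_dom Y0" by (simp add: N_def)
  qed
  obtain c C where C: "\<And>t. t \<in> {t0..t0 + d} \<Longrightarrow>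
     norm (gr_chart Y0 (\<gamma> t) - (\<Sum>i<k. (t - t0) ^ i *\<^sub>R c i)) \<le> C * (t - t0) ^ k"
    using Ck_on_taylor[OF Ck[OF Y0, folded N_def] sub] by blast
  \<comment> \<open>The chart is centred at \<open>\<gamma> t0\<close>, so the Taylor polynomial has
    no constant term. This gives \<open>X = O(u)\<close>, on which the order of the Neumann
    remainder rests.\<close>
  have "c 0 = 0"
  proof -
    have "(\<Sum>i<k. (t0 - t0) ^ i *\<^sub>R c i) = (\<Sum>i<k. if i = 0 then c 0 else 0)"
      by (intro sum.cong) auto
    then show ?thesis using C[of t0] d k X0 by (simp add: power_0_left)
  qed
  define q where "q u x h = (\<Sum>i\<in>{1..<k}. x ^ i *\<^sub>R c i)" for u x h :: real
  have q: "polyfun q" unfolding q_def by (intro polyfun_intros) auto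
  have qc: "(\<Sum>i<k. u ^ i *\<^sub>R c i) = q 0 u 0" for u
  proof -
    have "{..<k} = insert 0 {1..<k}" using k by auto
    then show ?thesis by (simp add: q_def \<open>c 0 = 0\<close>)
  qed
  have Xq: "approx right_nhds0 (\<lambda>u. u ^ k) X (\<lambda>u. q 0 u 0)"
  proof (rule approxI[OF bigo_polyfun_right_nhds0[OF q] bigoI[where C = C] bigo_power_right_nhds0])
    show "\<forall>\<^sub>F u in right_nhds0. norm (X u - q 0 u 0) \<le> C * \<bar>u ^ k\<bar>"
      unfolding eventually_right_nhds0
    proof (intro exI[of _ d] conjI allI impI d)
      fix u :: real assume "0 \<le> u" "u < d"
      then show "norm (X u - q 0 u 0) \<le> C * \<bar>u ^ k\<bar>"
        using C[of "t0 + u"] by (simp add: X_def qc)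
    qed
  qed
  have Xu: "bigo right_nhds0 (\<lambda>u. u ^ 1) X"
  proof -
    have "bigo right_nhds0 (\<lambda>u. u ^ 1) (\<lambda>u. q 0 u 0)"
    proof -
      have "bigo right_nhds0 (\<lambda>u. u ^ i) (\<lambda>u. u ^ i *\<^sub>R c i)" for i
        using bigo_bilinear[OF bounded_bilinear_scaleR, of right_nhds0 "\<lambda>u. u ^ i" "\<lambda>u. u ^ i" "\<lambda>_. 1" "\<lambda>_. c i"]
        by (simp add: bigo_const bigoI[where C = 1])
      from this have "bigo right_nhds0 (\<lambda>u. u ^ 1) (\<lambda>u. u ^ i *\<^sub>R c i)" if "i \<in> {1..<k}" for i
        by (rule bigo_power_weight) (use that in auto)
      then show ?thesis
        unfolding q_def
        by (induction rule: finite_induct[OF finite_atLeastLessThan[of 1 k]])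
          (auto intro: bigo_add bigo_zero simp del: power_one_right)
    qed
    moreover have "bigo right_nhds0 (\<lambda>u. u ^ 1) (\<lambda>u. X u - q 0 u 0)"
      by (rule bigo_power_weight[of k]) (use Xq k in \<open>auto simp: approx_def\<close>)
    ultimately show ?thesis using bigo_add by fastforce
  qed
  define Z where "Z u = - (transpose (X u) ** X u)" for u
  define z where "z u x h = - (transpose (q u x h) ** q u x h)" for u x h
  have pz: "polyfun z"
    unfolding z_def
    by (intro polyfun_linear[OF bounded_linear_minus[OF bounded_linear_ident]] polyfun_intros
        polyfun_linear[OF bounded_linear_transpose] q)
  have Zz: "approx right_nhds0 (\<lambda>u. u ^ k) Z (\<lambda>u. z 0 u 0)"
    unfolding Z_def z_def
    by (intro approx_linear[OF bounded_linear_minus[OF bounded_linear_ident]] approx_matrix_mult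
        approx_linear[OF bounded_linear_transpose] Xq)
  \<comment> \<open>\<open>Z\<close> is even \<open>O(u^2)\<close>; order 1 already gives
    \<open>O(u^k)\<close> for its \<open>k\<close>-th power.\<close>
  have Zu: "bigo right_nhds0 (\<lambda>u. u ^ 1) Z"
  proof -
    have "bigo right_nhds0 (\<lambda>u. u ^ 1 * u ^ 1) (\<lambda>u. transpose (X u) ** X u)"
      by (intro bigo_bilinear[OF bounded_bilinear_matrix_mult] bigo_linear[OF bounded_linear_transpose] Xu)
    then have "bigo right_nhds0 (\<lambda>u. u ^ 2) Z"
      unfolding Z_def using bigo_linear[OF bounded_linear_minus[OF bounded_linear_ident]]
      by (simp add: power2_eq_square)
    then show ?thesis by (rule bigo_power_weight) simp
  qed
  have Zi: "bigo right_nhds0 (\<lambda>u. u ^ i) (\<lambda>u. ((\<lambda>W. Z u ** W) ^^ i) (mat 1))" for i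
  proof (induction i)
    case 0
    show ?case by (simp add: bigo_const)
  next
    case (Suc i)
    from bigo_bilinear[OF bounded_bilinear_matrix_mult Zu this] show ?case by simp
  qed
  have evQ: "\<forall>\<^sub>F u in right_nhds0. Q u ** (mat 1 - Z u) = mat 1 \<and> Y u \<in> stiefel \<and>
      Y u ** transpose (Y u) = (Y0 + X u) ** Q u ** transpose (Y0 + X u)"
    using evd
  proof eventually_elim
    case (elim u)
    from projection_of_chart[OF Y0 elim] show ?case
      by (simp add: Q_def Y_def X_def Z_def)
  qed
  have Q1: "bigo right_nhds0 (\<lambda>_. 1) Q"
  proof -
    have "\<forall>\<^sub>F u in right_nhds0. norm (Y u) \<le> real (CARD('m) * CARD('r)) * \<bar>1\<bar>"
      using evQ by eventually_elim (simp add: norm_stiefel_le del: of_nat_mult)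
    then have "bigo right_nhds0 (\<lambda>_. 1) Y" by (rule bigoI)
    from bigo_bilinear[OF bounded_bilinear_matrix_mult bigo_const[of _ "transpose Y0"] this]
    have 1: "bigo right_nhds0 (\<lambda>_. 1) (\<lambda>u. transpose Y0 ** Y u)" by simp
    from bigo_bilinear[OF bounded_bilinear_matrix_mult 1 bigo_linear[OF bounded_linear_transpose 1]]
    show ?thesis by (simp add: Q_def[abs_def])
  qed
  define v where "v u x h = (\<Sum>i<k. ((\<lambda>W. z u x h ** W) ^^ i) (mat 1))" for u x h
  have pv: "polyfun v" unfolding v_def by (intro polyfun_intros pz) auto
  define V where "V u = (\<Sum>i<k. ((\<lambda>W. Z u ** W) ^^ i) (mat 1))" for u
  have Vv: "approx right_nhds0 (\<lambda>u. u ^ k) V (\<lambda>u. v 0 u 0)"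
    unfolding V_def v_def
    by (intro approx_sum approx_funpow Zz approx_refl bigo_const) auto
  have "approx right_nhds0 (\<lambda>u. u ^ k) Q V"
  proof (rule approxI[OF _ _ bigo_power_right_nhds0])
    show "bigo right_nhds0 (\<lambda>_. 1) V" using Vv by (simp add: approx_def)
    have "\<forall>\<^sub>F u in right_nhds0. Q u ** ((\<lambda>W. Z u ** W) ^^ k) (mat 1) = Q u - V u"
      using evQ by eventually_elim (simp add: V_def neumann_remainder)
    moreover have "bigo right_nhds0 (\<lambda>u. u ^ k) (\<lambda>u. Q u ** ((\<lambda>W. Z u ** W) ^^ k) (mat 1))"
      using bigo_bilinear[OF bounded_bilinear_matrix_mult Q1 Zi[of k]] by simp
    ultimately show "bigo right_nhds0 (\<lambda>u. u ^ k) (\<lambda>u. Q u - V u)"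
      by (rule bigo_cong)
  qed
  from approx_trans[OF this Vv] have Qv: "approx right_nhds0 (\<lambda>u. u ^ k) Q (\<lambda>u. v 0 u 0)" .
  define s where "s u x h = 2 *\<^sub>R ((Y0 + q u x h) ** v u x h ** transpose (Y0 + q u x h)) - mat 1" for u x h
  show ?thesis
  proof (rule that[of s])
    have q': "polyfun (\<lambda>u x h. Y0 + q u x h)" by (intro polyfun.add polyfun.const q)
    show "polyfun s"
      unfolding s_def
      by (intro polyfun_diff polyfun_scaleR polyfun_matrix_mult polyfun.const
          polyfun_linear[OF bounded_linear_transpose q'] q' pv)
    have X': "approx right_nhds0 (\<lambda>u. u ^ k) (\<lambda>u. Y0 + X u) (\<lambda>u. Y0 + q 0 u 0)"
      by (intro approx_add Xq approx_refl bigo_const)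
    have c: "approx right_nhds0 (\<lambda>u. u ^ k) (\<lambda>_. C) (\<lambda>_. C)" for C :: "'z::real_normed_vector"
      by (intro approx_refl bigo_const)
    have "approx right_nhds0 (\<lambda>u. u ^ k)
        (\<lambda>u. 2 *\<^sub>R ((Y0 + X u) ** Q u ** transpose (Y0 + X u)) - mat 1) (\<lambda>u. s 0 u 0)"
      unfolding s_def
      by (intro approx_diff[OF approx_scaleR[OF c approx_matrix_mult[OF approx_matrix_mult[OF X' Qv]
              approx_linear[OF bounded_linear_transpose X']]] c])
    moreover have "\<forall>\<^sub>F u in right_nhds0. 2 *\<^sub>R ((Y0 + X u) ** Q u ** transpose (Y0 + X u)) - mat 1 =
        gr_refl TYPE('r) (\<gamma> (t0 + u))"
      using evQ by eventually_elim (simp only: gr_refl_def reflection_def Y_def)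
    ultimately show "approx right_nhds0 (\<lambda>u. u ^ k) (\<lambda>u. gr_refl TYPE('r) (\<gamma> (t0 + u))) (\<lambda>u. s 0 u 0)"
      by (rule approx_cong_left)
    show "\<forall>\<^sub>F u in right_nhds0. \<gamma> (t0 + u) \<in> grassmannian TYPE('r)"
      using evd by eventually_elim (simp add: gr_chart_dom_def)
  qed
qed

subsection \<open>Geodesic distance\<close>

text \<open>From \<open>sin y \<ge> y cos y\<close> at \<open>y = x / 2\<close> and the double angle
  formula, \<open>sin x \<ge> x (cos (x / 2))^2\<close>; the squared cosine is at least 1/2 because
  \<open>x / 2 \<le> pi / 4\<close>.\<close>

lemma half_le_sin:
  assumes "0 \<le> x" "x \<le> pi / 2"
  shows "x / 2 \<le> sin x"
proof -
  have "sin 0 - 0 * cos 0 \<le> sin (x / 2) - x / 2 * cos (x / 2)"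
  proof (rule DERIV_nonneg_imp_nondecreasing[where f = "\<lambda>y. sin y - y * cos y"])
    show "\<exists>D. ((\<lambda>y. sin y - y * cos y) has_real_derivative D) (at y) \<and> 0 \<le> D"
      if "0 \<le> y" "y \<le> x / 2" for y
    proof (intro exI conjI)
      show "((\<lambda>y. sin y - y * cos y) has_real_derivative y * sin y) (at y)"
        by (auto intro!: derivative_eq_intros)
      show "0 \<le> y * sin y"
        using that assms by (intro mult_nonneg_nonneg sin_ge_zero) auto
    qed
  qed (use assms in auto)
  then have s: "x / 2 * cos (x / 2) \<le> sin (x / 2)" by simp
  have "cos (pi / 4) \<le> cos (x / 2)"
    using assms by (subst cos_mono_le_eq) auto
  then have c: "sqrt 2 / 2 \<le> cos (x / 2)" by (simp add: cos_45)
  then have "(sqrt 2 / 2)\<^sup>2 \<le> (cos (x / 2))\<^sup>2" by (intro power_mono) auto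
  then have c2: "1 / 2 \<le> (cos (x / 2))\<^sup>2" by (simp add: power_divide)
  have "x / 2 \<le> x * (cos (x / 2))\<^sup>2" using mult_left_mono[OF c2, of x] assms by simp
  also have "\<dots> = 2 * (x / 2 * cos (x / 2)) * cos (x / 2)" by (simp add: power2_eq_square)
  also have "\<dots> \<le> 2 * sin (x / 2) * cos (x / 2)"
    using s order_trans[OF _ c, of 0] by (intro mult_right_mono mult_left_mono) auto
  also have "\<dots> = sin x" using sin_double[of "x / 2"] by simp
  finally show ?thesis .
qed

lemma norm_transpose_stiefel_le:
  fixes Y :: "real^'r::finite^'m::finite"
  assumes "Y \<in> stiefel"
  shows "norm (transpose Y *v w) \<le> norm w"
proof -
  define x where "x = transpose Y *v w"
  have "norm x * norm x = w \<bullet> (Y *v x)"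
    unfolding x_def power2_norm_eq_inner[unfolded power2_eq_square]
    by (simp add: inner_transpose_matrix_vector)
  also have "\<dots> \<le> norm w * norm (Y *v x)" by (rule norm_cauchy_schwarz)
  also have "norm (Y *v x) = norm x" by (rule norm_stiefel_mult[OF assms])
  finally have "norm x \<le> norm w" by (cases "norm x = 0") (auto simp: mult_le_cancel_right)
  then show ?thesis by (simp add: x_def)
qed

text \<open>For a right singular vector \<open>v\<close> with singular value
  \<open>cos \<phi>\<close>, the unit vector \<open>z = Y1 *v v\<close> has distance
  \<open>sin \<phi>\<close> to its projection onto the other subspace, and the difference of the
  reflections maps \<open>z\<close> to twice that residual. Hence
  \<open>\<phi> \<le> 2 sin \<phi> \<le> D\<close>; the factor \<open>CARD('r)\<close> comes from
  bounding the Euclidean norm of the angles by their sum.\<close>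

lemma gr_dist_le:
  fixes A B :: "(real^'m::finite) set"
  assumes "\<exists>Y::real^'r::finite^'m. Y \<in> stiefel \<and> colspan Y = A"
    and "\<exists>Y::real^'r^'m. Y \<in> stiefel \<and> colspan Y = B"
  shows "gr_dist TYPE('r) A B \<le> real CARD('r) * norm (gr_refl TYPE('r) A - gr_refl TYPE('r) B)"
proof -
  define Y0 Y1 where "Y0 = (gr_rep A :: real^'r^'m)" and "Y1 = (gr_rep B :: real^'r^'m)"
  have Y0: "Y0 \<in> stiefel" and Y1: "Y1 \<in> stiefel"
    using assms gr_rep unfolding Y0_def Y1_def by blast+
  define M where "M = transpose Y0 ** Y1"
  define \<Theta> where "\<Theta> \<theta> \<longleftrightarrow> (\<forall>j. 0 \<le> \<theta> $ j \<and> \<theta> $ j \<le> pi / 2) \<and>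
           (\<exists>U V. thin_svd M U (\<chi> j. cos (\<theta> $ j)) V)" for \<theta> :: "real^'r"
  have svd: "orthogonal_matrix V \<and> (\<forall>j. norm (column j V) = 1) \<and> (\<forall>j. norm (column j U) = 1) \<and>
      (\<forall>j. M *v column j V = s $ j *\<^sub>R column j U)" if "thin_svd M U s V" for U s V
  proof -
    have U: "transpose U ** U = mat 1" and V: "orthogonal_matrix V"
      and M: "M = U ** diag s ** transpose V" using that by (auto simp: thin_svd_def)
    then have VV: "transpose V ** V = mat 1" by (simp add: orthogonal_matrix)
    have "M ** V = U ** diag s ** (transpose V ** V)" unfolding M by (simp add: matrix_mul_assoc)
    then have "M ** V = U ** diag s" by (simp add: VV)
    then have "M *v column j V = s $ j *\<^sub>R column j U" for j
      by (metis column_matrix_mult column_mult_diag)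
    then show ?thesis using U VV V by (simp add: transpose_mult_eq_1_iff norm_eq_1)
  qed
  \<comment> \<open>The angles are a choice, so a witness is needed: neither factor of
    \<open>M\<close> increases norms, the singular values therefore lie in [0, 1], and their
    arccosines qualify.\<close>
  have "\<exists>\<theta>. \<Theta> \<theta>"
  proof -
    obtain U s V where t: "thin_svd M U s V" using thin_svd_exists[of M] by auto
    have s: "0 \<le> s $ j" "s $ j \<le> 1" for j
    proof -
      show s0: "0 \<le> s $ j" using t by (simp add: thin_svd_def)
      have "s $ j = norm (M *v column j V)" using svd[OF t] s0 by simp
      also have "\<dots> \<le> norm (Y1 *v column j V)"
        unfolding M_def matrix_vector_mul_assoc[symmetric] by (rule norm_transpose_stiefel_le[OF Y0])
      also have "\<dots> = norm (column j V)" by (rule norm_stiefel_mult[OF Y1])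
      finally show "s $ j \<le> 1" using svd[OF t] by simp
    qed
    have "cos (arccos (s $ j)) = s $ j" "0 \<le> arccos (s $ j)" "arccos (s $ j) \<le> pi / 2" for j
      using s[of j] cos_arccos[of "s $ j"] arccos_lbound[of "s $ j"] arccos_le_pi2[of "s $ j"]
      by simp_all
    with t have "\<Theta> (\<chi> j. arccos (s $ j))" unfolding \<Theta>_def
      by (intro conjI allI exI[of _ U] exI[of _ V]) auto
    then show ?thesis by blast
  qed
  then have "\<Theta> (SOME \<theta>. \<Theta> \<theta>)" by (rule someI_ex)
  moreover have "principal_angles A B = (SOME \<theta>. \<Theta> \<theta>)"
    by (simp add: principal_angles_def \<Theta>_def[abs_def] Let_def M_def Y0_def Y1_def)
  ultimately have "\<Theta> (principal_angles A B)" by simp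
  then obtain U V where t: "thin_svd M U (\<chi> j. cos ((principal_angles A B :: real^'r) $ j)) V"
    and \<theta>: "\<And>j. 0 \<le> (principal_angles A B :: real^'r) $ j" "\<And>j. (principal_angles A B :: real^'r) $ j \<le> pi / 2"
    by (auto simp: \<Theta>_def)
  define D where "D = norm (gr_refl TYPE('r) A - gr_refl TYPE('r) B)"
  have "(principal_angles A B :: real^'r) $ j \<le> D" for j
  proof -
    define \<phi> where "\<phi> = (principal_angles A B :: real^'r) $ j"
    define v u where "v = column j V" and "u = column j U"
    have nv: "norm v = 1" and nu: "norm u = 1" and Mv: "M *v v = cos \<phi> *\<^sub>R u"
      using svd[OF t] by (simp_all add: v_def u_def \<phi>_def)
    define z where "z = Y1 *v v"
    have Yz: "transpose Y1 *v z = v" "transpose Y0 *v z = cos \<phi> *\<^sub>R u"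
      using Y1 Mv by (simp_all add: z_def matrix_vector_mul_assoc stiefel_def M_def)
    have zz: "z \<bullet> z = 1"
      using inner_transpose_matrix_vector[of Y1 z v] Yz(1) nv
      by (simp add: z_def[symmetric] norm_eq_1)
    have zu: "z \<bullet> (Y0 *v u) = cos \<phi>"
      using inner_transpose_matrix_vector[of Y0 z u] Yz(2) nu by (simp add: norm_eq_1)
    have uu: "(Y0 *v u) \<bullet> (Y0 *v u) = 1"
      using norm_stiefel_mult[OF Y0, of u] nu by (simp add: norm_eq_1)
    have e: "(reflection Y0 - reflection Y1) *v z = 2 *\<^sub>R (cos \<phi> *\<^sub>R (Y0 *v u) - z)"
      by (simp add: matrix_vector_mult_diff_rdistrib reflection_mult_vector Yz z_def[symmetric]
          matrix_vector_mult_scaleR scaleR_diff_right)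
    have "(cos \<phi> *\<^sub>R (Y0 *v u) - z) \<bullet> (cos \<phi> *\<^sub>R (Y0 *v u) - z) = (sin \<phi>)\<^sup>2"
      by (simp add: inner_diff_left inner_diff_right uu zz zu inner_commute[of "Y0 *v u" z]
          sin_squared_eq power2_eq_square algebra_simps)
    then have "norm (cos \<phi> *\<^sub>R (Y0 *v u) - z) = \<bar>sin \<phi>\<bar>"
      by (simp add: norm_eq_sqrt_inner)
    then have "2 * \<bar>sin \<phi>\<bar> = norm ((reflection Y0 - reflection Y1) *v z)" unfolding e by simp
    also have "\<dots> \<le> norm (reflection Y0 - reflection Y1) * norm z" by (rule norm_matrix_vector_mult)
    also have "\<dots> = D" using zz by (simp add: D_def gr_refl_def Y0_def Y1_def norm_eq_sqrt_inner)
    finally show ?thesis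
      using half_le_sin[of \<phi>] \<theta>[of j] unfolding \<phi>_def by linarith
  qed
  then have "(\<Sum>j\<in>UNIV. (principal_angles A B :: real^'r) $ j) \<le> (\<Sum>j\<in>(UNIV :: 'r set). D)"
    by (intro sum_mono)
  moreover have "gr_dist TYPE('r) A B \<le> (\<Sum>j\<in>UNIV. (principal_angles A B :: real^'r) $ j)"
    unfolding gr_dist_def using L2_set_le_sum[of UNIV "\<lambda>j. (principal_angles A B :: real^'r) $ j"] \<theta>
    by (simp add: L2_set_def)
  ultimately show ?thesis by (simp add: D_def)
qed

subsection \<open>Convergence order\<close>

text \<open>Pairs \<open>(u, h)\<close> with \<open>h\<close> tending to \<open>0\<close> from the right and \<open>t0 + u\<close> between the extreme nodes.\<close>

definition stencil :: "nat \<Rightarrow> (real \<times> real) filter" where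
  "stencil n = inf (filtercomap snd (at_right 0)) (principal {p. 0 \<le> fst p \<and> fst p \<le> real n * snd p})"

lemma eventually_stencil:
  "eventually P (stencil n) \<longleftrightarrow>
     (\<exists>d>0. \<forall>u h. 0 < h \<longrightarrow> h < d \<longrightarrow> 0 \<le> u \<longrightarrow> u \<le> real n * h \<longrightarrow> P (u, h))"
proof
  assume "eventually P (stencil n)"
  then obtain Q where Q: "eventually Q (at_right 0)"
     "\<And>p. Q (snd p) \<Longrightarrow> 0 \<le> fst p \<Longrightarrow> fst p \<le> real n * snd p \<Longrightarrow> P p"
    by (auto simp: stencil_def eventually_inf_principal eventually_filtercomap)
  then obtain d where "d > 0" "\<And>h. 0 < h \<Longrightarrow> h < d \<Longrightarrow> Q h"
    by (auto simp: eventually_at_right_field)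
  then show "\<exists>d>0. \<forall>u h. 0 < h \<longrightarrow> h < d \<longrightarrow> 0 \<le> u \<longrightarrow> u \<le> real n * h \<longrightarrow> P (u, h)"
    using Q(2) by (intro exI[of _ d]) auto
next
  assume "\<exists>d>0. \<forall>u h. 0 < h \<longrightarrow> h < d \<longrightarrow> 0 \<le> u \<longrightarrow> u \<le> real n * h \<longrightarrow> P (u, h)"
  then obtain d where d: "d > 0" "\<And>u h. 0 < h \<Longrightarrow> h < d \<Longrightarrow> 0 \<le> u \<Longrightarrow> u \<le> real n * h \<Longrightarrow> P (u, h)"
    by blast
  then have "eventually (\<lambda>h. \<forall>u. 0 \<le> u \<longrightarrow> u \<le> real n * h \<longrightarrow> P (u, h)) (at_right 0)"
    by (auto simp: eventually_at_right_field)
  then show "eventually P (stencil n)"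
    unfolding stencil_def eventually_inf_principal eventually_filtercomap
    by (intro exI conjI) auto
qed

lemma stencil_linear_bounds:
  assumes "\<And>u h. 0 < h \<Longrightarrow> h < 1 \<Longrightarrow> 0 \<le> u \<Longrightarrow> u \<le> real n * h \<Longrightarrow> \<bar>f (u, h)\<bar> \<le> C * h"
  shows "bigo (stencil n) snd f"
proof (rule bigoI[where C = C])
  show "\<forall>\<^sub>F p in stencil n. norm (f p) \<le> C * \<bar>snd p\<bar>"
    unfolding eventually_stencil using assms by (intro exI[of _ 1]) auto
qed

lemma bigo_stencil_polyfun:
  assumes "polyfun f"
  shows "bigo (stencil n) (\<lambda>_. 1) (\<lambda>p. f (fst p) (c * snd p) (snd p))"
proof -
  define \<rho> where "\<rho> = real n + \<bar>c\<bar> + 1"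
  obtain C where C: "\<And>u x h. \<bar>u\<bar> \<le> \<rho> \<Longrightarrow> \<bar>x\<bar> \<le> \<rho> \<Longrightarrow> \<bar>h\<bar> \<le> \<rho> \<Longrightarrow> norm (f u x h) \<le> C"
    using polyfun_bounded[OF assms, of \<rho>] by blast
  show ?thesis
  proof (rule bigoI[where C = C])
    show "\<forall>\<^sub>F p in stencil n. norm (f (fst p) (c * snd p) (snd p)) \<le> C * \<bar>1\<bar>"
      unfolding eventually_stencil
    proof (intro exI[of _ 1] conjI allI impI)
      fix u h :: real
      assume h: "0 < h" "h < 1" and u: "0 \<le> u" "u \<le> real n * h"
      have "real n * h \<le> real n" using h by (simp add: mult_left_le)
      moreover have "\<bar>c * h\<bar> \<le> \<bar>c\<bar>" using h by (simp add: abs_mult mult_left_le)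
      ultimately show "norm (f (fst (u, h)) (c * snd (u, h)) (snd (u, h))) \<le> C * \<bar>1\<bar>"
        using u h by (auto simp: \<rho>_def intro!: C)
    qed simp
  qed
qed

lemma bigo_stencil_power: "bigo (stencil n) (\<lambda>_. 1) (\<lambda>p. snd p ^ k)"
  using bigo_stencil_polyfun[OF polyfun_power[OF polyfun_vars(3), of k], of n] by simp

lemma eventually_stencil_of_right_nhds0:
  assumes "eventually P right_nhds0"
    and K: "\<And>u h. 0 < h \<Longrightarrow> 0 \<le> u \<Longrightarrow> u \<le> real n * h \<Longrightarrow> 0 \<le> \<phi> (u, h) \<and> \<phi> (u, h) \<le> real n * h"
  shows "\<forall>\<^sub>F p in stencil n. P (\<phi> p)"
proof -
  obtain d where d: "d > 0" "\<And>u. 0 \<le> u \<Longrightarrow> u < d \<Longrightarrow> P u"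
    using assms(1) by (auto simp: eventually_right_nhds0)
  show ?thesis
    unfolding eventually_stencil
  proof (intro exI[of _ "d / (real n + 1)"] conjI allI impI)
    fix u h :: real
    assume h: "0 < h" "h < d / (real n + 1)" and u: "0 \<le> u" "u \<le> real n * h"
    have "real n * h \<le> (real n + 1) * h" using h by simp
    also have "\<dots> < d" using h by (simp add: field_simps)
    finally show "P (\<phi> (u, h))" using K[OF h(1) u] by (intro d(2)) auto
  qed (use d in auto)
qed

text \<open>Transfers a one-variable estimate to pairs along a sampling point \<open>\<phi>\<close>
  between the extreme nodes; it is applied to a node \<open>j h\<close> and to the position
  \<open>u\<close> itself.\<close>

lemma bigo_stencil_of_right_nhds0:
  assumes "bigo right_nhds0 (\<lambda>u. u ^ k) f"
    and K: "\<And>u h. 0 < h \<Longrightarrow> 0 \<le> u \<Longrightarrow> u \<le> real n * h \<Longrightarrow> 0 \<le> \<phi> (u, h) \<and> \<phi> (u, h) \<le> real n * h"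
  shows "bigo (stencil n) (\<lambda>p. snd p ^ k) (\<lambda>p. f (\<phi> p))"
proof -
  obtain C where C: "C \<ge> 0" "\<forall>\<^sub>F u in right_nhds0. norm (f u) \<le> C * \<bar>u ^ k\<bar>"
    by (rule bigoE[OF assms(1)])
  have "\<forall>\<^sub>F p in stencil n. norm (f (\<phi> p)) \<le> C * \<bar>\<phi> p ^ k\<bar>"
    by (rule eventually_stencil_of_right_nhds0[OF C(2) K])
  moreover have "\<forall>\<^sub>F p in stencil n. \<bar>\<phi> p ^ k\<bar> \<le> real n ^ k * \<bar>snd p ^ k\<bar>"
    unfolding eventually_stencil
  proof (intro exI[of _ 1] conjI allI impI)
    fix u h :: real
    assume h: "0 < h" "h < 1" and u: "0 \<le> u" "u \<le> real n * h"
    have "\<phi> (u, h) ^ k \<le> (real n * h) ^ k" using K[OF h(1) u] by (intro power_mono) auto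
    then show "\<bar>\<phi> (u, h) ^ k\<bar> \<le> real n ^ k * \<bar>snd (u, h) ^ k\<bar>"
      using K[OF h(1) u] h by (simp add: power_mult_distrib)
  qed simp
  ultimately have "\<forall>\<^sub>F p in stencil n. norm (f (\<phi> p)) \<le> (C * real n ^ k) * \<bar>snd p ^ k\<bar>"
    by eventually_elim (metis C(1) mult.assoc mult_left_mono order_trans)
  then show ?thesis by (rule bigoI)
qed

text \<open>\<open>R\<close> is quantified before \<open>j\<close> since the next level compares two
  neighbours: reading one polynomial at \<open>x\<close> and at \<open>x + h\<close> is what gives
  the difference a factor \<open>h\<close>. An orthonormal representative is carried along because
  the expansion of \<open>glerp\<close> presupposes one for both arguments.\<close>

lemma gider_step_refl_expansion:
  fixes \<gamma> :: "real \<Rightarrow> (real^'m::finite) set"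
  assumes le: "CARD('r::finite) \<le> CARD('m)" and n: "1 \<le> n" and s: "polyfun s"
    and jet: "approx right_nhds0 (\<lambda>u. u ^ (n + 1)) (\<lambda>u. gr_refl TYPE('r) (\<gamma> (t0 + u))) (\<lambda>u. s 0 u 0)"
    and gr: "\<forall>\<^sub>F u in right_nhds0. \<gamma> (t0 + u) \<in> grassmannian TYPE('r)"
  defines "I \<equiv> \<lambda>k j p. gider_step TYPE('r) (\<lambda>i. t0 + real i * snd p) (\<lambda>i. \<gamma> (t0 + real i * snd p)) k j (t0 + fst p)"
  assumes "k \<le> n"
  shows "\<exists>R. polyfun R \<and> (\<forall>j. j + k \<le> n \<longrightarrow>
     (\<forall>\<^sub>F p in stencil n. \<exists>Y::real^'r^'m. Y \<in> stiefel \<and> colspan Y = I k j p) \<and>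
     approx (stencil n) (\<lambda>p. snd p ^ (n + 1)) (\<lambda>p. gr_refl TYPE('r) (I k j p))
       (\<lambda>p. s 0 (fst p) 0 + (\<Prod>i\<le>k. fst p - real j * snd p - real i * snd p) *\<^sub>R
          R (fst p) (real j * snd p) (snd p)))"
  using \<open>k \<le> n\<close>
proof (induction k)
  case 0
  obtain g where g: "polyfun g" "\<And>u x h. s 0 x 0 - s 0 u 0 = (u - x) *\<^sub>R g u x h"
    using polyfun_difference_quotient[OF s] by blast
  show ?case
  proof (intro exI[of _ g] conjI allI impI g(1))
    fix j assume j: "j + 0 \<le> n"
    have K: "0 \<le> real j * snd (u, h) \<and> real j * snd (u, h) \<le> real n * h" if "0 < h" for u h :: real
      using that j by (simp add: mult_right_mono)
    show "\<forall>\<^sub>F p in stencil n. \<exists>Y::real^'r^'m. Y \<in> stiefel \<and> colspan Y = I 0 j p"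
      using eventually_stencil_of_right_nhds0[OF gr, of n "\<lambda>p. real j * snd p"] K
      by (auto simp: I_def elim!: eventually_mono intro: grassmannian_rep)
    have "bigo (stencil n) (\<lambda>p. snd p ^ (n + 1))
      (\<lambda>p. gr_refl TYPE('r) (\<gamma> (t0 + real j * snd p)) - s 0 (real j * snd p) 0)"
      using jet K
      by (intro bigo_stencil_of_right_nhds0[where \<phi> = "\<lambda>p. real j * snd p"]) (auto simp: approx_def)
    moreover have "bigo (stencil n) (\<lambda>_. 1) (\<lambda>p. s 0 (real j * snd p) 0)"
      using bigo_stencil_polyfun[OF polyfun_at_zero(2)[OF s]] by simp
    moreover have "bigo (stencil n) (\<lambda>_. 1) (\<lambda>p. snd p ^ (n + 1))"
      by (rule bigo_stencil_power)
    ultimately have "approx (stencil n) (\<lambda>p. snd p ^ (n + 1)) (\<lambda>p. gr_refl TYPE('r) (I 0 j p))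
        (\<lambda>p. s 0 (real j * snd p) 0)"
      by (intro approxI) (simp_all add: I_def)
    moreover have "s 0 (real j * snd p) 0 =
      s 0 (fst p) 0 + (\<Prod>i\<le>0. fst p - real j * snd p - real i * snd p) *\<^sub>R
          g (fst p) (real j * snd p) (snd p)" for p :: "real \<times> real"
      using g(2)[of "real j * snd p" "fst p" "snd p"] by (simp add: algebra_simps)
    ultimately show "approx (stencil n) (\<lambda>p. snd p ^ (n + 1)) (\<lambda>p. gr_refl TYPE('r) (I 0 j p))
       (\<lambda>p. s 0 (fst p) 0 + (\<Prod>i\<le>0. fst p - real j * snd p - real i * snd p) *\<^sub>R
          g (fst p) (real j * snd p) (snd p))"
      by simp
  qed
next
  case (Suc k)
  from Suc.IH[OF Suc_leD[OF Suc.prems]]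
  obtain R where IH: "polyfun R \<and> (\<forall>j. j + k \<le> n \<longrightarrow>
     (\<forall>\<^sub>F p in stencil n. \<exists>Y::real^'r^'m. Y \<in> stiefel \<and> colspan Y = I k j p) \<and>
     approx (stencil n) (\<lambda>p. snd p ^ (n + 1)) (\<lambda>p. gr_refl TYPE('r) (I k j p))
       (\<lambda>p. s 0 (fst p) 0 + (\<Prod>i\<le>k. fst p - real j * snd p - real i * snd p) *\<^sub>R
          R (fst p) (real j * snd p) (snd p)))" ..
  note R = IH[THEN conjunct1]
  note good = IH[THEN conjunct2, rule_format, THEN conjunct1]
  note app = IH[THEN conjunct2, rule_format, THEN conjunct2]
  \<comment> \<open>The models of the two neighbours are \<open>a\<close> at \<open>x\<close> and at
    \<open>x + h\<close>. As neighbours differ by \<open>O(h)\<close>, truncating the series at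
    \<open>n\<close> costs only \<open>O(h^(n + 1))\<close>.\<close>
  define a where "a u x h = s 0 u 0 + (\<Prod>i\<le>k. u - x - real i * h) *\<^sub>R R u x h" for u x h
  obtain E R' where E: "polyfun E" and R': "polyfun R'"
    and aE: "\<And>u x h. a u (x + h) h - a u x h = h *\<^sub>R E u x h"
    and step: "\<And>u x h. h \<noteq> 0 \<Longrightarrow> glerp_poly n ((u - x) / (real (Suc k) * h)) (a u x h) (a u (x + h) h) =
       s 0 u 0 + (\<Prod>i\<le>Suc k. u - x - real i * h) *\<^sub>R R' u x h"
    by (rule glerp_poly_step[OF polyfun_at_zero(1)[OF s] R a_def]) blast
  obtain C where C: "\<And>A B l. \<lbrakk>\<exists>Y::real^'r^'m. Y \<in> stiefel \<and> colspan Y = A;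
     \<exists>Y::real^'r^'m. Y \<in> stiefel \<and> colspan Y = B; \<bar>l\<bar> \<le> real n;
     norm (gr_refl TYPE('r) B - gr_refl TYPE('r) A) \<le> 1 / 4\<rbrakk> \<Longrightarrow>
     (\<exists>Y::real^'r^'m. Y \<in> stiefel \<and> colspan Y = glerp TYPE('r) A B l) \<and>
     norm (gr_refl TYPE('r) (glerp TYPE('r) A B l) -
        glerp_poly n l (gr_refl TYPE('r) A) (gr_refl TYPE('r) B)) \<le>
       C * norm (gr_refl TYPE('r) B - gr_refl TYPE('r) A) ^ (n + 1)"
    by (rule glerp_expansion[OF le n, of "real n"]) (simp, rule that)
  let ?w = "\<lambda>p::real \<times> real. snd p ^ (n + 1)"
  show ?case
  proof (intro exI[of _ R'] conjI allI impI R')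
    fix j assume j: "j + Suc k \<le> n"
    define A where "A p = gr_refl TYPE('r) (I k j p)" for p
    define B where "B p = gr_refl TYPE('r) (I k (Suc j) p)" for p
    define a' where "a' p = a (fst p) (real j * snd p) (snd p)" for p
    define b' where "b' p = a (fst p) (real j * snd p + snd p) (snd p)" for p
    define l where "l p = (fst p - real j * snd p) / (real (Suc k) * snd p)" for p :: "real \<times> real"
    have A: "approx (stencil n) ?w A a'"
      using app[of j] j by (simp add: A_def[abs_def] a'_def[abs_def] a_def)
    have B: "approx (stencil n) ?w B b'"
      using app[of "Suc j"] j by (simp add: B_def[abs_def] b'_def[abs_def] a_def distrib_right add.commute)
    \<comment> \<open>Position and node offset both lie in \<open>[0, n h]\<close>, and the
      denominator is at least \<open>h\<close>. Extrapolation takes the parameter out of [0, 1], but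
      it stays bounded.\<close>
    have l: "\<forall>\<^sub>F p in stencil n. \<bar>l p\<bar> \<le> real n"
      unfolding eventually_stencil
    proof (intro exI[of _ 1] conjI allI impI)
      fix u h :: real
      assume h: "0 < h" "h < 1" and u: "0 \<le> u" "u \<le> real n * h"
      have "real j * h \<le> real n * h" using j h by (intro mult_right_mono) auto
      moreover have "0 \<le> real j * h" using h by simp
      ultimately have "\<bar>u - real j * h\<bar> \<le> real n * h" using u by linarith
      also have "\<dots> \<le> real n * (real (Suc k) * h)"
        using h by (intro mult_left_mono) auto
      finally show "\<bar>l (u, h)\<bar> \<le> real n"
        using h by (simp add: l_def abs_mult pos_divide_le_eq del: of_nat_Suc)
    qed simp
    then have l1: "bigo (stencil n) (\<lambda>_. 1) l" by (intro bigoI[where C = "real n"]) simp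
    have hpos: "\<forall>\<^sub>F p in stencil n. 0 < snd p \<and> snd p < 1"
      unfolding eventually_stencil by (intro exI[of _ 1]) auto
    have w_h: "\<forall>\<^sub>F p in stencil n. \<bar>?w p\<bar> \<le> 1 * \<bar>snd p\<bar>"
      using hpos by eventually_elim (simp add: mult_left_le power_le_one)
    \<comment> \<open>The models differ by \<open>h E\<close>, and passing from them to the actual
      reflections costs \<open>O(h^(n + 1))\<close>, in particular \<open>O(h)\<close>.\<close>
    have D: "bigo (stencil n) snd (\<lambda>p. B p - A p)"
    proof -
      have 1: "bigo (stencil n) snd (\<lambda>p. B p - b' p)" and 2: "bigo (stencil n) snd (\<lambda>p. A p - a' p)"
        using A B by (auto simp: approx_def intro: bigo_mono_weight[OF _ w_h])
      have "bigo (stencil n) (\<lambda>p. snd p * 1) (\<lambda>p. snd p *\<^sub>R E (fst p) (real j * snd p) (snd p))"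
        by (intro bigo_bilinear[OF bounded_bilinear_scaleR] bigo_stencil_polyfun E
            bigoI[where C = 1]) simp
      then have "bigo (stencil n) snd (\<lambda>p. b' p - a' p)"
        by (simp add: a'_def b'_def aE)
      from bigo_add[OF bigo_diff[OF 1 2] this] show ?thesis by (simp add: algebra_simps)
    qed
    then obtain K where K: "K \<ge> 0" "\<forall>\<^sub>F p in stencil n. norm (B p - A p) \<le> K * \<bar>snd p\<bar>"
      by (rule bigoE)
    have "\<forall>\<^sub>F p in stencil n. K * \<bar>snd p\<bar> \<le> 1 / 4"
      unfolding eventually_stencil
    proof (intro exI[of _ "1 / (4 * (K + 1))"] conjI allI impI)
      fix u h :: real
      assume "0 < h" "h < 1 / (4 * (K + 1))"
      then have "(K + 1) * h \<le> 1 / 4" using K(1) by (simp add: field_simps)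
      then show "K * \<bar>snd (u, h)\<bar> \<le> 1 / 4" using \<open>0 < h\<close> by (simp add: algebra_simps)
    qed (use K in auto)
    \<comment> \<open>Brings the pair below the threshold 1/4 of the geodesic expansion.\<close>
    with K(2) have small: "\<forall>\<^sub>F p in stencil n. norm (B p - A p) \<le> 1 / 4"
      by eventually_elim simp
    have IS: "I (Suc k) j p = glerp TYPE('r) (I k j p) (I k (Suc j) p) (l p)" for p
    proof -
      have "(t0 + fst p - (t0 + real j * snd p)) / (t0 + real (j + Suc k) * snd p - (t0 + real j * snd p)) = l p"
        unfolding l_def by (simp add: algebra_simps)
      then show ?thesis by (simp add: I_def)
    qed
    have ev: "\<forall>\<^sub>F p in stencil n. (\<exists>Y::real^'r^'m. Y \<in> stiefel \<and> colspan Y = I (Suc k) j p) \<and>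
       norm (gr_refl TYPE('r) (I (Suc k) j p) - glerp_poly n (l p) (A p) (B p)) \<le> C * norm (B p - A p) ^ (n + 1)"
      using good[of j, OF Suc_leD[OF j[unfolded add_Suc_right]]] good[of "Suc j", unfolded add_Suc, OF j[unfolded add_Suc_right]] l small
      by eventually_elim (use C in \<open>simp add: IS A_def B_def\<close>)
    then show "\<forall>\<^sub>F p in stencil n. \<exists>Y::real^'r^'m. Y \<in> stiefel \<and> colspan Y = I (Suc k) j p"
      by eventually_elim simp
    have "bigo (stencil n) ?w (\<lambda>p. gr_refl TYPE('r) (I (Suc k) j p) - glerp_poly n (l p) (A p) (B p))"
    proof (rule bigoI[where C = "\<bar>C\<bar> * K ^ (n + 1)"])
      show "\<forall>\<^sub>F p in stencil n. norm (gr_refl TYPE('r) (I (Suc k) j p) - glerp_poly n (l p) (A p) (B p))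
         \<le> \<bar>C\<bar> * K ^ (n + 1) * \<bar>?w p\<bar>"
        using ev K(2)
      proof eventually_elim
        case (elim p)
        have "C * norm (B p - A p) ^ (n + 1) \<le> \<bar>C\<bar> * (K * \<bar>snd p\<bar>) ^ (n + 1)"
          using elim by (intro mult_mono power_mono) auto
        also have "\<dots> = \<bar>C\<bar> * K ^ (n + 1) * \<bar>?w p\<bar>"
          by (simp add: power_mult_distrib power_abs abs_mult)
        finally show ?case using elim by linarith
      qed
    qed
    \<comment> \<open>Besides the truncation error, the data inside the truncated series are
      exchanged for their polynomial models; boundedness of \<open>l\<close> keeps this error
      \<open>O(h^(n + 1))\<close>.\<close>
    moreover have gp: "approx (stencil n) ?w (\<lambda>p. glerp_poly n (l p) (A p) (B p)) (\<lambda>p. glerp_poly n (l p) (a' p) (b' p))"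
      by (rule approx_glerp_poly[OF l1 A B])
    moreover have "bigo (stencil n) (\<lambda>_. 1) ?w" by (rule bigo_stencil_power)
    ultimately have "approx (stencil n) ?w (\<lambda>p. gr_refl TYPE('r) (I (Suc k) j p)) (\<lambda>p. glerp_poly n (l p) (A p) (B p))"
      by (intro approxI) (auto simp: approx_def)
    from approx_trans[OF this gp]
    have 1: "approx (stencil n) ?w (\<lambda>p. gr_refl TYPE('r) (I (Suc k) j p)) (\<lambda>p. glerp_poly n (l p) (a' p) (b' p))" .
    have eq: "\<forall>\<^sub>F p in stencil n. glerp_poly n (l p) (a' p) (b' p) =
       s 0 (fst p) 0 + (\<Prod>i\<le>Suc k. fst p - real j * snd p - real i * snd p) *\<^sub>R
          R' (fst p) (real j * snd p) (snd p)"
      using hpos by eventually_elim (unfold a'_def b'_def l_def, rule step, simp)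
    show "approx (stencil n) ?w (\<lambda>p. gr_refl TYPE('r) (I (Suc k) j p))
       (\<lambda>p. s 0 (fst p) 0 + (\<Prod>i\<le>Suc k. fst p - real j * snd p - real i * snd p) *\<^sub>R
          R' (fst p) (real j * snd p) (snd p))"
      by (rule approx_cong_right[OF 1 eq])
  qed
qed

theorem theorem5p4:
  fixes \<gamma> :: "real \<Rightarrow> (real^'m::finite) set"
    and a b t0 :: real
    and n :: nat
  assumes "CARD('r::finite) \<le> CARD('m)"
    and "1 \<le> n"
    and "Ck_into_gr TYPE('r) (n + 1) {a..b} \<gamma>"
    and "t0 \<in> {a..<b}"
    and "\<exists>U K. normal_nbhd TYPE('r) U \<and> compactin (gr_topology TYPE('r)) K \<and> K \<subseteq> U \<and>
           (\<forall>\<^sub>F h in at_right 0.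
              let \<tau> = (\<lambda>j. t0 + real j * h); Y = (\<lambda>j. \<gamma> (\<tau> j)) in
                \<tau> n \<le> b \<longrightarrow>
                \<gamma> ` {t0..\<tau> n} \<subseteq> K \<and>
                (\<forall>j\<le>n. Y j \<in> K) \<and>
                (\<forall>k\<in>{1..n}. \<forall>j\<le>n - k. \<forall>t\<in>{t0..\<tau> n}.
                   gr_log_unique TYPE('r)
                     (gider_step TYPE('r) \<tau> Y (k - 1) j t)
                     (gider_step TYPE('r) \<tau> Y (k - 1) (j + 1) t) \<and>
                   gider_step TYPE('r) \<tau> Y k j t \<in> K))"
  shows "\<exists>C. \<forall>\<^sub>F h in at_right 0.
           let \<tau> = (\<lambda>j. t0 + real j * h); Y = (\<lambda>j. \<gamma> (\<tau> j)) in
             \<tau> n \<le> b \<longrightarrow>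
             (\<forall>t\<in>{t0..\<tau> n}.
                gr_dist TYPE('r) (\<gamma> t) (gider TYPE('r) n \<tau> Y t) \<le> C * h ^ (n + 1))"
proof -
  obtain s :: "real \<Rightarrow> real \<Rightarrow> real \<Rightarrow> real^'m^'m" where s: "polyfun s"
    and jet: "approx right_nhds0 (\<lambda>u. u ^ (n + 1)) (\<lambda>u. gr_refl TYPE('r) (\<gamma> (t0 + u))) (\<lambda>u. s 0 u 0)"
    and gr: "\<forall>\<^sub>F u in right_nhds0. \<gamma> (t0 + u) \<in> grassmannian TYPE('r)"
    using gr_refl_curve_jet[OF assms(3,4)] by auto
  define I where "I p = gider_step TYPE('r) (\<lambda>i. t0 + real i * snd p) (\<lambda>i. \<gamma> (t0 + real i * snd p)) n 0 (t0 + fst p)"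
    for p
  let ?w = "\<lambda>p::real \<times> real. snd p ^ (n + 1)"
  let ?\<Pi> = "\<lambda>p::real \<times> real. \<Prod>i\<le>n. fst p - real i * snd p"
  obtain R where R: "polyfun R"
    and good: "\<forall>\<^sub>F p in stencil n. \<exists>Y::real^'r^'m. Y \<in> stiefel \<and> colspan Y = I p"
    and app: "approx (stencil n) ?w (\<lambda>p. gr_refl TYPE('r) (I p))
       (\<lambda>p. s 0 (fst p) 0 + ?\<Pi> p *\<^sub>R R (fst p) 0 (snd p))"
    using gider_step_refl_expansion[OF assms(1,2) s jet gr order_refl]
    by (auto simp: I_def dest: spec[of _ 0])
  \<comment> \<open>At the last level the product runs over all \<open>n + 1\<close> nodes, and each
    factor is a distance of at most \<open>n h\<close>.\<close>
  have "bigo (stencil n) (\<lambda>p. snd p ^ card {..n}) ?\<Pi>"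
  proof (intro bigo_prod)
    fix i assume "i \<in> {..n}"
    show "bigo (stencil n) snd (\<lambda>p. fst p - real i * snd p)"
    proof (rule stencil_linear_bounds[where C = "real n"])
      fix u h :: real
      assume h: "0 < h" and u: "0 \<le> u" "u \<le> real n * h"
      have "real i * h \<le> real n * h" "0 \<le> real i * h"
        using \<open>i \<in> {..n}\<close> h by (auto intro: mult_right_mono)
      then show "\<bar>fst (u, h) - real i * snd (u, h)\<bar> \<le> real n * h" using u by simp
    qed
  qed simp
  then have "bigo (stencil n) ?w ?\<Pi>" by simp
  from bigo_bilinear[OF bounded_bilinear_scaleR this bigo_stencil_polyfun[OF R, of _ 0]]
  have 1: "bigo (stencil n) ?w (\<lambda>p. ?\<Pi> p *\<^sub>R R (fst p) 0 (snd p))" by simp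
  have 2: "bigo (stencil n) ?w (\<lambda>p. gr_refl TYPE('r) (I p) - (s 0 (fst p) 0 + ?\<Pi> p *\<^sub>R R (fst p) 0 (snd p)))"
    using app by (simp add: approx_def)
  \<comment> \<open>The exact curve and the interpolant share the leading part
    \<open>s 0 u 0\<close>, which cancels in the difference.\<close>
  have "bigo (stencil n) ?w (\<lambda>p. gr_refl TYPE('r) (\<gamma> (t0 + fst p)) - s 0 (fst p) 0)"
    using jet by (intro bigo_stencil_of_right_nhds0[where \<phi> = fst]) (auto simp: approx_def)
  from bigo_diff[OF bigo_diff[OF this 2] 1]
  have "bigo (stencil n) ?w (\<lambda>p. gr_refl TYPE('r) (\<gamma> (t0 + fst p)) - gr_refl TYPE('r) (I p))"
    by (simp add: algebra_simps)
  then obtain C where C: "\<forall>\<^sub>F p in stencil n. norm (gr_refl TYPE('r) (\<gamma> (t0 + fst p)) - gr_refl TYPE('r) (I p)) \<le> C * \<bar>?w p\<bar>"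
    by (auto simp: bigo_def)
  have "\<forall>\<^sub>F p in stencil n. \<gamma> (t0 + fst p) \<in> grassmannian TYPE('r)"
    by (rule eventually_stencil_of_right_nhds0[OF gr]) auto
  then have "\<forall>\<^sub>F p in stencil n. gr_dist TYPE('r) (\<gamma> (t0 + fst p)) (I p) \<le> real CARD('r) * C * \<bar>?w p\<bar>"
    using good C
  proof eventually_elim
    case (elim p)
    have "gr_dist TYPE('r) (\<gamma> (t0 + fst p)) (I p) \<le>
        real CARD('r) * norm (gr_refl TYPE('r) (\<gamma> (t0 + fst p)) - gr_refl TYPE('r) (I p))"
      using elim by (intro gr_dist_le) (auto intro: grassmannian_rep)
    also have "\<dots> \<le> real CARD('r) * (C * \<bar>?w p\<bar>)" using elim by (intro mult_left_mono) auto
    finally show ?case by (simp add: mult.assoc)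
  qed
  then obtain d where d: "d > 0" "\<And>u h. \<lbrakk>0 < h; h < d; 0 \<le> u; u \<le> real n * h\<rbrakk> \<Longrightarrow>
     gr_dist TYPE('r) (\<gamma> (t0 + u)) (I (u, h)) \<le> real CARD('r) * C * \<bar>h ^ (n + 1)\<bar>"
    unfolding eventually_stencil by auto
  show ?thesis
    unfolding Let_def gider_def eventually_at_right_field
  proof (rule exI[of _ "real CARD('r) * C"], rule exI[of _ d], intro conjI allI impI ballI d(1))
    fix h t assume h: "0 < h" "h < d" and t: "t \<in> {t0..t0 + real n * h}"
    from d(2)[OF h, of "t - t0"] t h
    show "gr_dist TYPE('r) (\<gamma> t) (gider_step TYPE('r) (\<lambda>j. t0 + real j * h) (\<lambda>j. \<gamma> (t0 + real j * h)) n 0 t)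
       \<le> real CARD('r) * C * h ^ (n + 1)"
      by (simp add: I_def)
  qed
qed

end
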